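(* Let $\lambda>2$, let $\theta\in\mathbb{R}$ be irrational, let $\omega\in[0,1)$, and let $H$ be the almost Mathieu operator on $\ell^2(\mathbb{Z})$, $[H\psi](n)=\psi(n+1)+\psi(n-1)+\lambda\cos(2\pi(n\theta+\omega))\psi(n)$. Then $\alpha_u^-(\lambda,\theta,\omega)=0$ (and hence $\beta^-_{\delta_1}(p,\lambda,\theta,\omega)=0$ for every $p>0$). If in addition $\theta$ satisfies $$\lim_{k\to\infty}\frac{\log q_{k+1}}{q_k}=0,$$ where $p_k/q_k$ are the continued fraction convergents of $\theta$, then $\alpha_u^+(\lambda,\theta,\omega)=0$ for every $\omega\in[0,1)$ (and hence $\beta^+_{\delta_1}(p,\lambda,\theta,\omega)=0$ for every $p>0$).
   Context: The convergents $p_k/q_k=a_0+\cfrac{1}{a_1+\cfrac{1}{\cdots+\cfrac1{a_k}}}$ (in lowest terms, $q_k\ge1$) are the truncations of the continued fraction expansion of $\theta$, with $a_0\in\mathbb{Z}$ and integers $a_n\ge1$ for $n\ge1$. Let $(\delta_n)$ be the canonical basis of $\ell^2(\mathbb{Z})$. For $T>0$ let $a(n,T)=\frac{2}{T}\int_0^\infty e^{-2t/T}|\langle e^{-itH}\delta_1,\delta_n\rangle|^2\,dt$. For $p>0$ let $\langle|X|^p_{\delta_1}\rangle(T)=\sum_n|n|^pa(n,T)$, and let $\beta^-_{\delta_1}(p)$ and $\beta^+_{\delta_1}(p)$ be the $\liminf$ and $\limsup$, respectively, as $T\to\infty$ of $\frac{\log\langle|X|^p_{\delta_1}\rangle(T)}{p\log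 T}$. For real $N$ let $P(N,T)=\sum_{|n|>N}a(n,T)$. For $\alpha\in[0,+\infty]$ let $S^-(\alpha)=-\liminf_{T\to\infty}\frac{\log P(T^\alpha-2,T)}{\log T}$ and $S^+(\alpha)=-\limsup_{T\to\infty}\frac{\log P(T^\alpha-2,T)}{\log T}$ (values in $[0,\infty]$), and $\alpha_u^\pm=\sup\{\alpha\ge0: S^\pm(\alpha)<\infty\}$. The arguments $\lambda,\theta,\omega$ indicate the dependence on the operator. *)

theory Defs
  imports "HOL-Analysis.Analysis"
begin

section \<open>The Hilbert space of square-summable functions on the integers\<close>

typedef ell2Z = "{f :: int \<Rightarrow> complex. (\<lambda>n. (cmod (f n))\<^sup>2) summable_on UNIV}"
  morphisms coord Abs_ell2Z
proof
  show "(\<lambda>_. 0) \<in> {f :: int \<Rightarrow> complex. (\<lambda>n. (cmod (f n))\<^sup>2) summable_on UNIV}"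
    by simp
qed

setup_lifting type_definition_ell2Z

lemma ell2Z_eqI: "(\<And>n. coord f n = coord g n) \<Longrightarrow> f = g"
  by (metis coord_inject ext)

lemma sq_summable_add:
  fixes f g :: "int \<Rightarrow> complex"
  assumes "(\<lambda>n. (cmod (f n))\<^sup>2) summable_on UNIV" "(\<lambda>n. (cmod (g n))\<^sup>2) summable_on UNIV"
  shows "(\<lambda>n. (cmod (f n + g n))\<^sup>2) summable_on UNIV"
proof (rule summable_on_comparison_test)
  show "(\<lambda>n. 2 * (cmod (f n))\<^sup>2 + 2 * (cmod (g n))\<^sup>2) summable_on UNIV"
    by (intro summable_on_add summable_on_cmult_right assms)
  fix n
  have "(cmod (f n + g n))\<^sup>2 \<le> (cmod (f n) + cmod (g n))\<^sup>2"
    by (intro power_mono norm_triangle_ineq) auto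
  also have "\<dots> \<le> 2 * (cmod (f n))\<^sup>2 + 2 * (cmod (g n))\<^sup>2"
    using sum_squares_bound[of "cmod (f n)" "cmod (g n)"]
    by (simp add: power2_eq_square algebra_simps)
  finally show "(cmod (f n + g n))\<^sup>2 \<le> 2 * (cmod (f n))\<^sup>2 + 2 * (cmod (g n))\<^sup>2" .
qed auto

lemma sq_summable_bounded_mult:
  fixes f v :: "int \<Rightarrow> complex"
  assumes "(\<lambda>n. (cmod (f n))\<^sup>2) summable_on UNIV" "\<And>n. cmod (v n) \<le> C"
  shows "(\<lambda>n. (cmod (v n * f n))\<^sup>2) summable_on UNIV"
proof (rule summable_on_comparison_test)
  show "(\<lambda>n. C\<^sup>2 * (cmod (f n))\<^sup>2) summable_on UNIV"
    by (intro summable_on_cmult_right assms)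
  fix n
  show "(cmod (v n * f n))\<^sup>2 \<le> C\<^sup>2 * (cmod (f n))\<^sup>2"
    unfolding norm_mult power_mult_distrib by (intro mult_right_mono power_mono assms) auto
qed auto

lemma sq_summable_shift:
  fixes f :: "int \<Rightarrow> complex"
  assumes "(\<lambda>n. (cmod (f n))\<^sup>2) summable_on UNIV"
  shows "(\<lambda>n. (cmod (f (n + k)))\<^sup>2) summable_on UNIV"
  using assms summable_on_reindex_bij_betw[of "\<lambda>n. n + k" UNIV UNIV "\<lambda>n. (cmod (f n))\<^sup>2"]
  by (auto simp: bij_plus_right)

lemma summable_prod_cnj:
  fixes f g :: "int \<Rightarrow> complex"
  assumes "(\<lambda>n. (cmod (f n))\<^sup>2) summable_on UNIV" "(\<lambda>n. (cmod (g n))\<^sup>2) summable_on UNIV"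
  shows "(\<lambda>n. f n * cnj (g n)) summable_on UNIV"
proof (rule abs_summable_summable, rule Infinite_Sum.abs_summable_on_comparison_test'
    [where g = "\<lambda>n. (cmod (f n))\<^sup>2 + (cmod (g n))\<^sup>2"])
  show "(\<lambda>n. (cmod (f n))\<^sup>2 + (cmod (g n))\<^sup>2) summable_on UNIV"
    by (intro summable_on_add assms)
  fix n
  have "2 * (cmod (f n) * cmod (g n)) \<le> (cmod (f n))\<^sup>2 + (cmod (g n))\<^sup>2"
    using sum_squares_bound[of "cmod (f n)" "cmod (g n)"] by simp
  moreover have "0 \<le> cmod (f n) * cmod (g n)" by simp
  ultimately show "norm (f n * cnj (g n)) \<le> (cmod (f n))\<^sup>2 + (cmod (g n))\<^sup>2"
    unfolding norm_mult complex_mod_cnj by linarith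
qed

lift_definition cscale :: "complex \<Rightarrow> ell2Z \<Rightarrow> ell2Z"  (infixr "*\<^sub>c" 75)
  is "\<lambda>c f n. c * f n"
  by (rule sq_summable_bounded_mult[OF _ order_refl])

lift_definition cinner :: "ell2Z \<Rightarrow> ell2Z \<Rightarrow> complex"
  is "\<lambda>f g. \<Sum>\<^sub>\<infinity>n. f n * cnj (g n)" .

lift_definition delta :: "int \<Rightarrow> ell2Z" is "\<lambda>m n. of_bool (n = m)"
proof -
  fix m :: int
  have "(\<lambda>n. (cmod (of_bool (n = m)))\<^sup>2) summable_on {m}" by simp
  then show "(\<lambda>n. (cmod (of_bool (n = m)))\<^sup>2) summable_on UNIV"
    by (rule summable_on_cong_neutral[THEN iffD1, rotated -1]) auto
qed

instantiation ell2Z :: real_inner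
begin

lift_definition zero_ell2Z :: ell2Z is "\<lambda>_. 0" by simp
lift_definition plus_ell2Z :: "ell2Z \<Rightarrow> ell2Z \<Rightarrow> ell2Z" is "\<lambda>f g n. f n + g n"
  by (rule sq_summable_add)
lift_definition uminus_ell2Z :: "ell2Z \<Rightarrow> ell2Z" is "\<lambda>f n. - f n" by simp
lift_definition minus_ell2Z :: "ell2Z \<Rightarrow> ell2Z \<Rightarrow> ell2Z" is "\<lambda>f g n. f n - g n"
proof -
  fix f g :: "int \<Rightarrow> complex"
  assume "(\<lambda>n. (cmod (f n))\<^sup>2) summable_on UNIV" "(\<lambda>n. (cmod (g n))\<^sup>2) summable_on UNIV"
  then show "(\<lambda>n. (cmod (f n - g n))\<^sup>2) summable_on UNIV"
    using sq_summable_add[of f "\<lambda>n. - g n"] by simp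
qed
lift_definition scaleR_ell2Z :: "real \<Rightarrow> ell2Z \<Rightarrow> ell2Z" is "\<lambda>r f n. r *\<^sub>R f n"
  unfolding scaleR_conv_of_real by (rule sq_summable_bounded_mult[OF _ order_refl])
definition inner_ell2Z :: "ell2Z \<Rightarrow> ell2Z \<Rightarrow> real" where
  "inner_ell2Z f g = Re (cinner f g)"
lift_definition norm_ell2Z :: "ell2Z \<Rightarrow> real" is "\<lambda>f. sqrt (\<Sum>\<^sub>\<infinity>n. (cmod (f n))\<^sup>2)" .
definition dist_ell2Z :: "ell2Z \<Rightarrow> ell2Z \<Rightarrow> real" where
  "dist_ell2Z f g = norm (f - g)"
definition sgn_ell2Z :: "ell2Z \<Rightarrow> ell2Z" where
  "sgn_ell2Z f = scaleR (inverse (norm f)) f"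
definition uniformity_ell2Z :: "(ell2Z \<times> ell2Z) filter" where
  "uniformity_ell2Z = (INF e\<in>{0<..}. principal {(x, y). dist x y < e})"
definition open_ell2Z :: "ell2Z set \<Rightarrow> bool" where
  "open_ell2Z U = (\<forall>x\<in>U. eventually (\<lambda>(x', y). x' = x \<longrightarrow> y \<in> U) uniformity)"

instance
proof
  have ss: "(\<lambda>n. (cmod (coord f n))\<^sup>2) summable_on UNIV" for f
    using coord by auto
  have pr: "(\<lambda>n. Re (coord f n * cnj (coord g n))) summable_on UNIV" for f g
    by (intro summable_on_Re summable_prod_cnj ss)
  have inn: "inner f g = (\<Sum>\<^sub>\<infinity>n. Re (coord f n * cnj (coord g n)))" for f g
    unfolding inner_ell2Z_def cinner.rep_eq
    by (intro infsum_Re[symmetric] summable_prod_cnj ss)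
  have self: "inner f f = (\<Sum>\<^sub>\<infinity>n. (cmod (coord f n))\<^sup>2)" for f
    unfolding inn complex_norm_square[symmetric] Re_complex_of_real ..
  fix x y z :: ell2Z and r s :: real
  show "dist x y = norm (x - y)" by (rule dist_ell2Z_def)
  show "sgn x = scaleR (inverse (norm x)) x" by (rule sgn_ell2Z_def)
  show "(uniformity :: (ell2Z \<times> ell2Z) filter) = (INF e\<in>{0<..}. principal {(x, y). dist x y < e})"
    by (rule uniformity_ell2Z_def)
  show "open U = (\<forall>x\<in>U. \<forall>\<^sub>F (x', y) in uniformity. x' = x \<longrightarrow> y \<in> U)" for U :: "ell2Z set"
    by (rule open_ell2Z_def)
  show "x + y + z = x + (y + z)" by transfer (simp add: add.assoc)
  show "x + y = y + x" by transfer (simp add: add.commute)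
  show "0 + x = x" by transfer simp
  show "- x + x = 0" by transfer simp
  show "x - y = x + - y" by transfer simp
  show "r *\<^sub>R (x + y) = r *\<^sub>R x + r *\<^sub>R y" by transfer (simp add: scaleR_add_right)
  show "(r + s) *\<^sub>R x = r *\<^sub>R x + s *\<^sub>R x" by transfer (simp add: scaleR_add_left)
  show "r *\<^sub>R s *\<^sub>R x = (r * s) *\<^sub>R x" by transfer simp
  show "1 *\<^sub>R x = x" by transfer simp
  show "inner x y = inner y x"
    unfolding inn by (simp add: mult.commute)
  show "inner (x + y) z = inner x z + inner y z"
    unfolding inn plus_ell2Z.rep_eq
    using infsum_add[OF pr[of x z] pr[of y z]] by (simp add: algebra_simps)
  show "inner (r *\<^sub>R x) y = r * inner x y"
    unfolding inn scaleR_ell2Z.rep_eq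
    using infsum_cmult_right'[of r "\<lambda>n. Re (coord x n * cnj (coord y n))" UNIV]
    by (simp add: algebra_simps)
  show "0 \<le> inner x x"
    unfolding self by (intro infsum_nonneg) auto
  show "inner x x = 0 \<longleftrightarrow> x = 0"
  proof
    assume "inner x x = 0"
    then have "(cmod (coord x n))\<^sup>2 = 0" for n
      using nonneg_infsum_le_0D[OF _ ss[of x], of n] unfolding self by auto
    then show "x = 0"
      by (intro ell2Z_eqI) (simp add: zero_ell2Z.rep_eq)
  qed (simp add: self zero_ell2Z.rep_eq)
  show "norm x = sqrt (inner x x)"
    unfolding self norm_ell2Z.rep_eq ..
qed

end

lemma coord_sq_summable: "(\<lambda>n. (cmod (coord f n))\<^sup>2) summable_on UNIV"
  using coord by auto

lemma norm_ell2Z_sq: "(norm f)\<^sup>2 = (\<Sum>\<^sub>\<infinity>n. (cmod (coord f n))\<^sup>2)"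
  unfolding norm_ell2Z.rep_eq by (intro real_sqrt_pow2 infsum_nonneg) auto

lemma finite_sum_le_norm_sq: "finite F \<Longrightarrow> (\<Sum>n\<in>F. (cmod (coord f n))\<^sup>2) \<le> (norm f)\<^sup>2"
  unfolding norm_ell2Z_sq by (intro finite_sum_le_infsum coord_sq_summable) auto

lemma cmod_coord_le_norm: "cmod (coord f n) \<le> norm f"
  by (rule power2_le_imp_le) (use finite_sum_le_norm_sq[of "{n}" f] in simp_all)

instance ell2Z :: banach
proof
  fix X :: "nat \<Rightarrow> ell2Z"
  assume C: "Cauchy X"
  have "Cauchy (\<lambda>k. coord (X k) n)" for n
  proof (rule metric_CauchyI)
    fix e :: real assume "e > 0"
    then obtain M where M: "\<And>k m. k \<ge> M \<Longrightarrow> m \<ge> M \<Longrightarrow> dist (X k) (X m) < e"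
      using metric_CauchyD[OF C] by blast
    have "dist (coord (X k) n) (coord (X m) n) < e" if "k \<ge> M" "m \<ge> M" for k m
      using M[OF that] cmod_coord_le_norm[of "X k - X m" n]
      by (simp add: dist_norm minus_ell2Z.rep_eq)
    then show "\<exists>M. \<forall>m\<ge>M. \<forall>k\<ge>M. dist (coord (X m) n) (coord (X k) n) < e" by blast
  qed
  then have "\<exists>l. (\<lambda>k. coord (X k) n) \<longlonglongrightarrow> l" for n
    using Cauchy_convergent convergent_def by blast
  then obtain L where L: "\<And>n. (\<lambda>k. coord (X k) n) \<longlonglongrightarrow> L n" by metis
  have fin: "\<exists>M. \<forall>m\<ge>M. \<forall>F. finite F \<longrightarrow> (\<Sum>n\<in>F. (cmod (coord (X m) n - L n))\<^sup>2) \<le> e\<^sup>2"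
    if "e > 0" for e
  proof -
    obtain M where M: "\<And>k m. k \<ge> M \<Longrightarrow> m \<ge> M \<Longrightarrow> dist (X k) (X m) < e"
      using metric_CauchyD[OF C \<open>e > 0\<close>] by blast
    have "(\<Sum>n\<in>F. (cmod (coord (X m) n - L n))\<^sup>2) \<le> e\<^sup>2" if "m \<ge> M" "finite F" for m F
    proof (rule tendsto_upperbound)
      show "(\<lambda>k. \<Sum>n\<in>F. (cmod (coord (X m) n - coord (X k) n))\<^sup>2)
          \<longlonglongrightarrow> (\<Sum>n\<in>F. (cmod (coord (X m) n - L n))\<^sup>2)"
        by (intro tendsto_intros L)
      show "\<forall>\<^sub>F k in sequentially. (\<Sum>n\<in>F. (cmod (coord (X m) n - coord (X k) n))\<^sup>2) \<le> e\<^sup>2"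
        using eventually_ge_at_top[of M]
      proof eventually_elim
        fix k assume "k \<ge> M"
        have "(\<Sum>n\<in>F. (cmod (coord (X m) n - coord (X k) n))\<^sup>2) \<le> (norm (X m - X k))\<^sup>2"
          using finite_sum_le_norm_sq[OF \<open>finite F\<close>, of "X m - X k"]
          by (simp add: minus_ell2Z.rep_eq)
        also have "\<dots> \<le> e\<^sup>2"
          using M[OF \<open>m \<ge> M\<close> \<open>k \<ge> M\<close>] by (intro power_mono) (auto simp: dist_norm)
        finally show "(\<Sum>n\<in>F. (cmod (coord (X m) n - coord (X k) n))\<^sup>2) \<le> e\<^sup>2" .
      qed
    qed simp
    then show ?thesis by blast
  qed
  have sumD: "(\<lambda>n. (cmod (coord (X m) n - L n))\<^sup>2) summable_on UNIV"
    if "\<forall>F. finite F \<longrightarrow> (\<Sum>n\<in>F. (cmod (coord (X m) n - L n))\<^sup>2) \<le> b" for m b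
    using that by (intro nonneg_bdd_above_summable_on) (auto simp: bdd_above_def)
  obtain m0 where "\<forall>F. finite F \<longrightarrow> (\<Sum>n\<in>F. (cmod (coord (X m0) n - L n))\<^sup>2) \<le> 1\<^sup>2"
    using fin[of 1] by auto
  from sumD[OF this] have "(\<lambda>n. (cmod (coord (X m0) n - L n))\<^sup>2) summable_on UNIV" .
  then have "(\<lambda>n. (cmod (- (coord (X m0) n - L n)))\<^sup>2) summable_on UNIV"
    by (simp only: norm_minus_cancel)
  from sq_summable_add[OF coord_sq_summable[of "X m0"] this]
  have "(\<lambda>n. (cmod (L n))\<^sup>2) summable_on UNIV" by simp
  then obtain l where l: "coord l = L"
    using Abs_ell2Z_inverse[of L] by blast
  have "X \<longlonglongrightarrow> l"
  proof (rule metric_LIMSEQ_I)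
    fix r :: real assume "r > 0"
    then obtain M where M: "\<And>m F. m \<ge> M \<Longrightarrow> finite F \<Longrightarrow>
        (\<Sum>n\<in>F. (cmod (coord (X m) n - L n))\<^sup>2) \<le> (r / 2)\<^sup>2"
      using fin[of "r / 2"] by auto
    have "dist (X m) l < r" if "m \<ge> M" for m
    proof -
      have "(norm (X m - l))\<^sup>2 \<le> (r / 2)\<^sup>2"
        unfolding norm_ell2Z_sq
        using M[OF that] by (intro infsum_le_finite_sums coord_sq_summable)
          (auto simp: minus_ell2Z.rep_eq l)
      then have "norm (X m - l) \<le> r / 2"
        by (rule power2_le_imp_le) (use \<open>r > 0\<close> in simp)
      then show ?thesis using \<open>r > 0\<close> by (simp add: dist_norm)
    qed
    then show "\<exists>M. \<forall>m\<ge>M. dist (X m) l < r" by blast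
  qed
  then show "convergent X" by (rule convergentI)
qed

lemma cinner_delta_right: "cinner f (delta n) = coord f n"
proof -
  have "cinner f (delta n) = (\<Sum>\<^sub>\<infinity>k\<in>{n}. coord f k)"
    unfolding cinner.rep_eq delta.rep_eq by (intro infsum_cong_neutral) auto
  then show ?thesis by simp
qed

lemma norm_cscale: "norm (c *\<^sub>c f) = cmod c * norm f"
  unfolding norm_ell2Z.rep_eq cscale.rep_eq
  by (simp add: norm_mult power_mult_distrib infsum_cmult_right' real_sqrt_mult)

section \<open>The almost Mathieu operator and its unitary group\<close>

lift_definition almost_mathieu :: "real \<Rightarrow> real \<Rightarrow> real \<Rightarrow> ell2Z \<Rightarrow> ell2Z"
  is "\<lambda>lam \<theta> \<omega> \<psi> n. \<psi> (n + 1) + \<psi> (n - 1)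
        + complex_of_real (lam * cos (2 * pi * (of_int n * \<theta> + \<omega>))) * \<psi> n"
proof -
  fix lam \<theta> \<omega> :: real and \<psi> :: "int \<Rightarrow> complex"
  assume s: "(\<lambda>n. (cmod (\<psi> n))\<^sup>2) summable_on UNIV"
  have "cmod (complex_of_real (lam * cos (2 * pi * (of_int n * \<theta> + \<omega>)))) \<le> \<bar>lam\<bar>" for n :: int
    by (simp add: norm_mult abs_mult mult_left_le)
  then show "(\<lambda>n. (cmod (\<psi> (n + 1) + \<psi> (n - 1)
      + complex_of_real (lam * cos (2 * pi * (of_int n * \<theta> + \<omega>))) * \<psi> n))\<^sup>2) summable_on UNIV"
    using sq_summable_shift[OF s, of 1] sq_summable_shift[OF s, of "-1"]
    by (intro sq_summable_add sq_summable_bounded_mult[OF s]) auto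
qed

text \<open>For a bounded operator \<open>A\<close>, the group \<open>exp (-itA)\<close> is given by the norm-convergent exponential
  series; \<open>summable_evolution\<close> below shows convergence for every bounded \<open>A\<close>, and
  \<open>bounded_linear_almost_mathieu\<close> shows that it applies to the almost Mathieu operator.\<close>

definition evolution :: "(ell2Z \<Rightarrow> ell2Z) \<Rightarrow> real \<Rightarrow> ell2Z \<Rightarrow> ell2Z" where
  "evolution A t \<psi> = (\<Sum>k. ((- \<i> * complex_of_real t) ^ k / fact k) *\<^sub>c ((A ^^ k) \<psi>))"

lemma summable_evolution:
  fixes A :: "ell2Z \<Rightarrow> ell2Z"
  assumes "bounded_linear A"
  shows "summable (\<lambda>k. ((- \<i> * complex_of_real t) ^ k / fact k) *\<^sub>c ((A ^^ k) \<psi>))"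
proof -
  obtain K where K: "K \<ge> 0" "\<And>x. norm (A x) \<le> norm x * K"
    using bounded_linear.nonneg_bounded[OF assms] by blast
  have pow: "norm ((A ^^ k) \<psi>) \<le> K ^ k * norm \<psi>" for k
  proof (induction k)
    case (Suc k)
    have "norm ((A ^^ Suc k) \<psi>) \<le> norm ((A ^^ k) \<psi>) * K"
      using K(2)[of "(A ^^ k) \<psi>"] by simp
    also have "\<dots> \<le> (K ^ k * norm \<psi>) * K" using Suc K(1) by (rule mult_right_mono)
    finally show ?case by (simp add: mult_ac)
  qed simp
  have "summable (\<lambda>k. (inverse (fact k) * (\<bar>t\<bar> * K) ^ k) * norm \<psi>)"
    by (intro summable_mult2 summable_exp)
  then show ?thesis
  proof (rule summable_comparison_test'[where N = 0], goal_cases)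
    case (1 k)
    have "norm (((- \<i> * complex_of_real t) ^ k / fact k) *\<^sub>c ((A ^^ k) \<psi>))
        = \<bar>t\<bar> ^ k / fact k * norm ((A ^^ k) \<psi>)"
      by (simp add: norm_cscale norm_divide norm_power norm_mult)
    also have "\<dots> \<le> \<bar>t\<bar> ^ k / fact k * (K ^ k * norm \<psi>)"
      by (intro mult_left_mono pow) auto
    finally show ?case by (simp add: field_simps power_mult_distrib)
  qed
qed

lemma bounded_linear_almost_mathieu: "bounded_linear (almost_mathieu lam \<theta> \<omega>)"
proof (rule bounded_linear_intro)
  show "almost_mathieu lam \<theta> \<omega> (x + y) = almost_mathieu lam \<theta> \<omega> x + almost_mathieu lam \<theta> \<omega> y"
    for x y
    by (rule ell2Z_eqI) (simp only: almost_mathieu.rep_eq plus_ell2Z.rep_eq distrib_left add_ac)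
  show "almost_mathieu lam \<theta> \<omega> (r *\<^sub>R x) = r *\<^sub>R almost_mathieu lam \<theta> \<omega> x" for r x
    by (rule ell2Z_eqI) (simp only: almost_mathieu.rep_eq scaleR_ell2Z.rep_eq
        scaleR_add_right mult_scaleR_right)
  fix x :: ell2Z
  define v where "v n = complex_of_real (lam * cos (2 * pi * (of_int n * \<theta> + \<omega>)))" for n :: int
  have v: "cmod (v n) \<le> \<bar>lam\<bar>" for n
    unfolding v_def by (simp add: norm_mult abs_mult mult_left_le)
  define f where "f k = Abs_ell2Z (\<lambda>n. coord x (n + k))" for k
  have f: "coord (f k) = (\<lambda>n. coord x (n + k))" for k
    unfolding f_def using sq_summable_shift[OF coord_sq_summable[of x], of k]
    by (simp add: Abs_ell2Z_inverse)
  have "norm (f k) = norm x" for k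
    unfolding norm_ell2Z.rep_eq f
    using infsum_reindex_bij_betw[of "\<lambda>n. n + k" UNIV UNIV "\<lambda>n. (cmod (coord x n))\<^sup>2"]
    by (simp add: bij_plus_right)
  note nf = this
  define g where "g = Abs_ell2Z (\<lambda>n. v n * coord x n)"
  have g: "coord g = (\<lambda>n. v n * coord x n)"
    unfolding g_def using sq_summable_bounded_mult[OF coord_sq_summable[of x] v]
    by (simp add: Abs_ell2Z_inverse)
  have "(norm g)\<^sup>2 \<le> (\<Sum>\<^sub>\<infinity>n. \<bar>lam\<bar>\<^sup>2 * (cmod (coord x n))\<^sup>2)"
    unfolding norm_ell2Z_sq
  proof (rule infsum_mono)
    show "(\<lambda>n. \<bar>lam\<bar>\<^sup>2 * (cmod (coord x n))\<^sup>2) summable_on UNIV"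
      by (intro summable_on_cmult_right coord_sq_summable)
    show "(cmod (coord g n))\<^sup>2 \<le> \<bar>lam\<bar>\<^sup>2 * (cmod (coord x n))\<^sup>2" for n
      unfolding g norm_mult power_mult_distrib by (intro mult_right_mono power_mono v) auto
  qed (rule coord_sq_summable)
  also have "\<dots> = (\<bar>lam\<bar> * norm x)\<^sup>2"
    by (simp add: infsum_cmult_right' power_mult_distrib norm_ell2Z_sq)
  finally have ng: "norm g \<le> \<bar>lam\<bar> * norm x"
    by (rule power2_le_imp_le) simp
  have "almost_mathieu lam \<theta> \<omega> x = f 1 + f (-1) + g"
    by (rule ell2Z_eqI) (simp add: almost_mathieu.rep_eq plus_ell2Z.rep_eq f g v_def)
  then have "norm (almost_mathieu lam \<theta> \<omega> x) \<le> norm (f 1) + norm (f (-1)) + norm g"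
    by (metis norm_triangle_ineq norm_triangle_mono order_refl)
  then show "norm (almost_mathieu lam \<theta> \<omega> x) \<le> norm x * (2 + \<bar>lam\<bar>)"
    using ng by (simp add: nf algebra_simps)
qed

section \<open>Time-averaged dynamics and transport exponents\<close>

definition avg_prob :: "(ell2Z \<Rightarrow> ell2Z) \<Rightarrow> int \<Rightarrow> real \<Rightarrow> real" where
  "avg_prob A n T = 2 / T *
     (LINT t:{0..}|lborel. exp (- 2 * t / T) * (cmod (cinner (evolution A t (delta 1)) (delta n)))\<^sup>2)"

text \<open>Sums of nonnegative terms are taken in \<open>ennreal\<close> and the logarithm is extended by
  \<open>log 0 = -\<infinity>\<close> and \<open>log \<infinity> = \<infinity>\<close>.  (The real \<open>ln\<close> has \<open>ln 0 = 0\<close>, which would be wrong for the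
  vanishing outside probability at \<open>\<alpha> = \<infinity>\<close>.)\<close>

definition elog :: "ennreal \<Rightarrow> ereal" where
  "elog x = (if x = 0 then - \<infinity> else if x = \<infinity> then \<infinity> else ereal (ln (enn2real x)))"

definition moment :: "(ell2Z \<Rightarrow> ell2Z) \<Rightarrow> real \<Rightarrow> real \<Rightarrow> ennreal" where
  "moment A p T = (\<Sum>\<^sub>\<infinity>n::int. ennreal (\<bar>real_of_int n\<bar> powr p * avg_prob A n T))"

definition beta_minus :: "(ell2Z \<Rightarrow> ell2Z) \<Rightarrow> real \<Rightarrow> ereal" where
  "beta_minus A p = Liminf at_top (\<lambda>T. elog (moment A p T) / ereal (p * ln T))"

definition beta_plus :: "(ell2Z \<Rightarrow> ell2Z) \<Rightarrow> real \<Rightarrow> ereal" where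
  "beta_plus A p = Limsup at_top (\<lambda>T. elog (moment A p T) / ereal (p * ln T))"

definition outside_prob :: "(ell2Z \<Rightarrow> ell2Z) \<Rightarrow> ereal \<Rightarrow> real \<Rightarrow> ennreal" where
  "outside_prob A N T = (\<Sum>\<^sub>\<infinity>n\<in>{n::int. ereal \<bar>real_of_int n\<bar> > N}. ennreal (avg_prob A n T))"

text \<open>\<open>T\<^sup>\<alpha>\<close> for \<open>T > 1\<close> and \<open>\<alpha> \<in> [0, \<infinity>]\<close>.\<close>

definition epow :: "real \<Rightarrow> ereal \<Rightarrow> ereal" where
  "epow T \<alpha> = (if \<alpha> = \<infinity> then \<infinity> else ereal (T powr real_of_ereal \<alpha>))"

definition S_minus :: "(ell2Z \<Rightarrow> ell2Z) \<Rightarrow> ereal \<Rightarrow> ereal" where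
  "S_minus A \<alpha> = - Liminf at_top (\<lambda>T. elog (outside_prob A (epow T \<alpha> - 2) T) / ereal (ln T))"

definition S_plus :: "(ell2Z \<Rightarrow> ell2Z) \<Rightarrow> ereal \<Rightarrow> ereal" where
  "S_plus A \<alpha> = - Limsup at_top (\<lambda>T. elog (outside_prob A (epow T \<alpha> - 2) T) / ereal (ln T))"

definition alpha_u_minus :: "(ell2Z \<Rightarrow> ell2Z) \<Rightarrow> ereal" where
  "alpha_u_minus A = Sup {\<alpha>. 0 \<le> \<alpha> \<and> S_minus A \<alpha> < \<infinity>}"

definition alpha_u_plus :: "(ell2Z \<Rightarrow> ell2Z) \<Rightarrow> ereal" where
  "alpha_u_plus A = Sup {\<alpha>. 0 \<le> \<alpha> \<and> S_plus A \<alpha> < \<infinity>}"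

section \<open>Continued fraction convergents\<close>

text \<open>Only meaningful for irrational \<open>\<theta>\<close>, whose complete quotients never become integers.\<close>

fun complete_quotient :: "real \<Rightarrow> nat \<Rightarrow> real" where
  "complete_quotient \<theta> 0 = \<theta>"
| "complete_quotient \<theta> (Suc n) = 1 / frac (complete_quotient \<theta> n)"

definition partial_quotient :: "real \<Rightarrow> nat \<Rightarrow> int" where
  "partial_quotient \<theta> n = \<lfloor>complete_quotient \<theta> n\<rfloor>"

fun cf_value :: "int list \<Rightarrow> rat" where
  "cf_value [] = 0"
| "cf_value [a] = of_int a"
| "cf_value (a # b # as) = of_int a + 1 / cf_value (b # as)"

definition convergent_frac :: "real \<Rightarrow> nat \<Rightarrow> rat" where
  "convergent_frac \<theta> k = cf_value (map (partial_quotient \<theta>) [0..<Suc k])"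

text \<open>\<open>quotient_of\<close> returns the lowest-terms representation with positive denominator.\<close>

definition convergent_denom :: "real \<Rightarrow> nat \<Rightarrow> int" where
  "convergent_denom \<theta> k = snd (quotient_of (convergent_frac \<theta> k))"

end

theory Submission
  imports Defs "HOL-Probability.Probability" "HOL-Complex_Analysis.Complex_Analysis"
    "HOL-Real_Asymp.Real_Asymp" "HOL-Number_Theory.Cong"
begin

text \<open>
  Put \<open>\<epsilon> = 1 / T\<close>. The Laplace transform \<open>g\<close> of the amplitudes \<open>\<langle>e\<^sup>-\<^sup>i\<^sup>t\<^sup>H \<delta>\<^sub>1, \<delta>\<^sub>n\<rangle>\<close> at \<open>z = E + i\<epsilon>\<close> solves
  \<open>(H - z) g = \<delta>\<^sub>1\<close> and is bounded by \<open>T\<close>. Let \<open>s\<close> be a solution of \<open>H s = z s\<close> with Dirichlet data at one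
  end of a block of sites. Comparing the Wronskian of \<open>s\<close> and \<open>g\<close> with their currents \<open>Im (s k * cnj (s (k + 1)))\<close>
  shows that \<open>g\<close> is at most \<open>T\<^sup>2 / sqrt \<bar>s\<bar>\<close> beyond the block, where \<open>\<bar>s\<bar>\<close> is taken at the other end.

  As a function of the phase \<open>w = e\<^sup>2\<^sup>\<pi>\<^sup>i\<^sup>\<omega>\<close>, \<open>w\<^sup>L s\<close> is for a block of length \<open>L\<close> a polynomial of degree at most
  \<open>2 L\<close> whose value at \<open>0\<close> has modulus \<open>(\<lambda> / 2)\<^sup>L\<close>, for every \<open>z\<close>. By the maximum principle and Bernstein's
  inequality, \<open>\<bar>s\<bar> \<ge> (\<lambda> / 2)\<^sup>L / 2\<close> on an arc of length of order \<open>1 / L\<close>. If \<open>q\<close> is the denominator of a convergent,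
  \<open>q\<close> consecutive points of the rotation by \<open>\<theta>\<close> are \<open>2 / q\<close>-dense, so for \<open>L = q div 200\<close> some block within
  distance \<open>2 q\<close> of the origin hits that arc. Hence \<open>g\<close> is exponentially small in \<open>q\<close> beyond \<open>2 q\<close>,
  uniformly in \<open>E\<close>, and so is the averaged probability: the amplitudes are Lipschitz in time, so smoothing
  them with a narrow Gaussian bounds them by their Fourier transform.
\<close>

section \<open>Convergents\<close>

text \<open>The product of the matrices with rows \<open>(a, 1)\<close> and \<open>(1, 0)\<close>,
  listed row by row. For a nonempty list the first column holds numerator and denominator of the
  continued fraction; the second column is the first column that belongs to the list without its
  last entry.\<close>

fun cf_matrix :: "int list \<Rightarrow> int \<times> int \<times> int \<times> int" where
  "cf_matrix [] = (1, 0, 0, 1)"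
| "cf_matrix (a # as) = (case cf_matrix as of (P, P', Q, Q') \<Rightarrow> (a * P + Q, a * P' + Q', P, P'))"

text \<open>Every factor has determinant -1; the absolute value spares the parity of the
  length.\<close>

lemma cf_matrix_det:
  "cf_matrix as = (P, P', Q, Q') \<Longrightarrow> \<bar>P * Q' - P' * Q\<bar> = 1"
proof (induction as arbitrary: P P' Q Q')
  case (Cons a as)
  obtain R R' S S' where m: "cf_matrix as = (R, R', S, S')" by (metis surj_pair)
  then have "P * Q' - P' * Q = - (R * S' - R' * S)"
    using Cons.prems by (auto simp: algebra_simps)
  then show ?case using Cons.IH[OF m] by simp
qed auto

text \<open>The bound by the length is what makes the denominators of convergents grow: they are the
  entry \<open>P\<close> for the list without its first partial quotient, the only one that may fail
  to be positive.\<close>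

lemma cf_matrix_pos:
  assumes "cf_matrix as = (P, P', Q, Q')" "\<forall>a\<in>set as. a \<ge> 1"
  shows "P \<ge> 1 \<and> P \<ge> int (length as) \<and> P' \<ge> 0 \<and> Q \<ge> 0 \<and> Q' \<ge> 0 \<and> (as \<noteq> [] \<longrightarrow> Q \<ge> 1)"
  using assms
proof (induction as arbitrary: P P' Q Q')
  case (Cons a as)
  obtain R R' S S' where m: "cf_matrix as = (R, R', S, S')" by (metis surj_pair)
  have IH: "R \<ge> 1 \<and> R \<ge> int (length as) \<and> R' \<ge> 0 \<and> S \<ge> 0 \<and> S' \<ge> 0 \<and> (as \<noteq> [] \<longrightarrow> S \<ge> 1)"
    using Cons.IH[OF m] Cons.prems by simp
  have a: "a \<ge> 1" using Cons.prems by simp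
  define t t' where "t = a * R" and "t' = a * R'"
  have "t \<ge> R" "t' \<ge> 0" unfolding t_def t'_def using IH a by (auto simp: mult_le_cancel_right1)
  moreover have "P = t + S" "P' = t' + S'" "Q = R" "Q' = R'"
    unfolding t_def t'_def using Cons.prems(1) m by auto
  ultimately show ?case using IH by (cases "as = []") auto
qed auto

lemma cf_value_cf_matrix:
  assumes "cf_matrix (a # as) = (P, P', Q, Q')" "\<forall>a\<in>set as. a \<ge> 1"
  shows "cf_value (a # as) = of_int P / of_int Q"
  using assms
proof (induction as arbitrary: a P P' Q Q')
  case (Cons b as)
  obtain R R' S S' where m: "cf_matrix (b # as) = (R, R', S, S')" by (metis surj_pair)
  have IH: "cf_value (b # as) = of_int R / of_int S"
    using Cons.IH[OF m] Cons.prems by simp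
  have "R \<ge> 1" "S \<ge> 1"
    using cf_matrix_pos[OF m] Cons.prems by auto
  moreover have "P = a * R + S" "Q = R" using Cons.prems(1) m by auto
  ultimately show ?case unfolding cf_value.simps IH by (simp add: field_simps)
qed auto

lemma frac_irrational:
  assumes "x \<notin> \<rat>"
  shows "0 < frac x" "1 / frac x \<notin> \<rat>"
proof -
  have f: "frac x \<notin> \<rat>"
    using assms by (metis Rats_add Rats_of_int frac_def diff_add_cancel)
  then have "frac x \<noteq> 0" by (metis Rats_0)
  then show "0 < frac x" by (simp add: order_less_le frac_ge_0)
  show "1 / frac x \<notin> \<rat>"
    using f by (metis Rats_1 Rats_divide div_by_1 divide_divide_eq_right mult_1)
qed

lemma complete_quotient_Suc': "complete_quotient x (Suc n) = complete_quotient (1 / frac x) n"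
  by (induction n) auto

lemma partial_quotient_Suc': "partial_quotient x (Suc n) = partial_quotient (1 / frac x) n"
  unfolding partial_quotient_def complete_quotient_Suc' ..

lemma complete_quotient_irrational: "x \<notin> \<rat> \<Longrightarrow> complete_quotient x n \<notin> \<rat>"
  by (induction n) (auto simp: frac_irrational(2))

lemma complete_quotient_gt_1:
  assumes "x \<notin> \<rat>" shows "complete_quotient x (Suc n) > 1"
  using frac_irrational(1)[OF complete_quotient_irrational[OF assms, of n]]
    frac_lt_1[of "complete_quotient x n"] by simp

lemma map_partial_quotient_Suc:
  "map (partial_quotient x) [0..<Suc n] = \<lfloor>x\<rfloor> # map (partial_quotient (1 / frac x)) [0..<n]"
  unfolding map_upt_Suc by (simp add: partial_quotient_Suc') (simp add: partial_quotient_def)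

text \<open>A number is the image of its complete quotient under the Moebius map of the matrix; the
  identity is that statement with denominators cleared. The induction peels off the first partial
  quotient, using \<open>x = \<lfloor>x\<rfloor> + frac x\<close>.\<close>

lemma cf_matrix_complete_quotient:
  assumes "x \<notin> \<rat>" "cf_matrix (map (partial_quotient x) [0..<n]) = (P, P', Q, Q')"
  shows "x * (Q * complete_quotient x n + Q') = P * complete_quotient x n + P'"
  using assms
proof (induction n arbitrary: x P P' Q Q')
  case (Suc n)
  let ?y = "1 / frac x" and ?c = "complete_quotient x (Suc n)"
  obtain R R' S S' where m: "cf_matrix (map (partial_quotient ?y) [0..<n]) = (R, R', S, S')"
    by (metis surj_pair)
  have f: "frac x > 0" "?y \<notin> \<rat>" using frac_irrational[OF Suc.prems(1)] by auto
  have IH: "R * ?c + R' = ?y * (S * ?c + S')"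
    using Suc.IH[OF f(2) m] unfolding complete_quotient_Suc' by (rule sym)
  have *: "P = \<lfloor>x\<rfloor> * R + S" "P' = \<lfloor>x\<rfloor> * R' + S'" "Q = R" "Q' = R'"
    using Suc.prems(2) m unfolding map_partial_quotient_Suc by auto
  have "R * ?c + R' = (S * ?c + S') / frac x" using IH by simp
  then have e: "S * ?c + S' = frac x * (R * ?c + R')"
    using f(1) by (simp del: complete_quotient.simps)
  have "x = \<lfloor>x\<rfloor> + frac x" by (simp add: frac_def)
  then have "x * (R * ?c + R') = \<lfloor>x\<rfloor> * (R * ?c + R') + frac x * (R * ?c + R')"
    by (metis distrib_right)
  then show ?case unfolding * e[symmetric] by (simp add: algebra_simps del: complete_quotient.simps)
qed auto

text \<open>Since \<theta> = (P y + P') / (Q y + Q') for the next complete quotient y > 1, the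
  determinant gives |\<theta> - P / Q| = 1 / (Q (Q y + Q')), and Q y + Q' is at least Q.\<close>

lemma convergent_denom_approx:
  assumes "\<theta> \<notin> \<rat>"
  shows "convergent_denom \<theta> k \<ge> 1" "convergent_denom \<theta> k \<ge> int k"
    and "\<exists>p. coprime p (convergent_denom \<theta> k) \<and>
      \<bar>\<theta> - of_int p / of_int (convergent_denom \<theta> k)\<bar> \<le> 1 / (of_int (convergent_denom \<theta> k))\<^sup>2"
proof -
  define as where "as = map (partial_quotient (1 / frac \<theta>)) [0..<k]"
  obtain P P' Q Q' where m: "cf_matrix (\<lfloor>\<theta>\<rfloor> # as) = (P, P', Q, Q')" by (metis surj_pair)
  obtain R R' S S' where m': "cf_matrix as = (R, R', S, S')" by (metis surj_pair)
  have QR: "Q = R" "Q' = R'" using m m' by auto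
  have "partial_quotient (1 / frac \<theta>) i \<ge> 1" for i
    using complete_quotient_gt_1[OF assms, of i]
    unfolding partial_quotient_def complete_quotient_Suc' by linarith
  then have pos: "\<forall>a\<in>set as. a \<ge> 1" unfolding as_def by simp
  have Q: "Q \<ge> 1" "Q \<ge> int k" "Q' \<ge> 0"
    using cf_matrix_pos[OF m' pos] unfolding QR as_def by auto
  have det: "\<bar>P * Q' - P' * Q\<bar> = 1" by (rule cf_matrix_det[OF m])
  have cop: "coprime P Q"
  proof (rule coprimeI)
    fix c assume "c dvd P" "c dvd Q"
    then have "c dvd \<bar>P * Q' - P' * Q\<bar>" by auto
    then show "is_unit c" unfolding det .
  qed
  have "convergent_frac \<theta> k = of_int P / of_int Q"
    unfolding convergent_frac_def map_partial_quotient_Suc using cf_value_cf_matrix[OF _ pos] m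
    unfolding as_def by blast
  also have "\<dots> = Rat.Fract P Q" by (simp add: Fract_of_int_quotient)
  \<comment> \<open>The determinant makes \<open>P / Q\<close> already reduced, so
    \<open>quotient_of\<close> returns \<open>Q\<close> itself.\<close>
  finally have q: "convergent_denom \<theta> k = Q"
    using cop Q unfolding convergent_denom_def
    by (simp add: quotient_of_Fract Rat.normalize_def)
  define y where "y = complete_quotient \<theta> (Suc k)"
  have y: "y > 1" unfolding y_def by (rule complete_quotient_gt_1[OF assms])
  have e: "\<theta> * (Q * y + Q') = P * y + P'"
    using cf_matrix_complete_quotient[OF assms, of "Suc k"] m
    unfolding map_partial_quotient_Suc as_def y_def by blast
  have Qy: "Q \<le> Q * y + Q'" using Q y by (simp add: add_increasing2)
  then have pos': "0 < Q * y + Q'" using Q by linarith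
  have "\<theta> - P / Q = (P * y + P') / (Q * y + Q') - P / Q"
    using e pos' by (simp add: field_simps)
  also have "\<dots> = - of_int (P * Q' - P' * Q) / (Q * (Q * y + Q'))"
    using pos' Q by (simp add: field_simps)
  finally have "\<bar>\<theta> - P / Q\<bar> = of_int \<bar>P * Q' - P' * Q\<bar> / (Q * (Q * y + Q'))"
    using pos' Q by (simp add: abs_mult)
  also have "\<dots> = 1 / (Q * (Q * y + Q'))" unfolding det by simp
  also have "\<dots> \<le> 1 / (of_int Q)\<^sup>2"
    unfolding power2_eq_square using Q Qy by (intro divide_left_mono mult_left_mono) auto
  finally have a: "\<bar>\<theta> - P / Q\<bar> \<le> 1 / (of_int Q)\<^sup>2" .
  show "convergent_denom \<theta> k \<ge> 1" "convergent_denom \<theta> k \<ge> int k" using q Q by auto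
  show "\<exists>p. coprime p (convergent_denom \<theta> k) \<and>
      \<bar>\<theta> - of_int p / of_int (convergent_denom \<theta> k)\<bar> \<le> 1 / (of_int (convergent_denom \<theta> k))\<^sup>2"
    unfolding q using cop a by blast
qed

section \<open>Decay of bounded solutions\<close>

text \<open>The current \<open>Im (g k * cnj (g (k + 1)))\<close> increases by \<open>Im z * |g k|\<^sup>2\<close> with each step to the left,
  and it vanishes at \<open>-\<infinity>\<close> because \<open>g\<close> is bounded.\<close>

lemma current_nonpos:
  fixes g :: "int \<Rightarrow> complex" and v :: "int \<Rightarrow> real"
  assumes eps: "Im z > 0"
    and rec: "\<And>k. k \<le> m \<Longrightarrow> g (k - 1) = (z - of_real (v k)) * g k - g (k + 1)"
    and bd: "\<And>k. norm (g k) \<le> B"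
    and jk: "j \<le> k" "k \<le> m"
  shows "Im z * (norm (g j))\<^sup>2 \<le> - Im (g k * cnj (g (k + 1)))"
proof -
  define J where "J k = Im (g k * cnj (g (k + 1)))" for k
  have J: "J (k - 1) = Im z * (norm (g k))\<^sup>2 + J k" if "k \<le> m" for k
  proof -
    have "J (k - 1) = Im ((z - of_real (v k)) * (g k * cnj (g k)) - g (k + 1) * cnj (g k))"
      unfolding J_def rec[OF that] by (simp add: algebra_simps)
    also have "(z - of_real (v k)) * (g k * cnj (g k)) = (z - of_real (v k)) * of_real ((norm (g k))\<^sup>2)"
      by (simp only: complex_norm_square)
    finally show ?thesis unfolding J_def by (simp add: algebra_simps)
  qed
  have sum: "J (k - int n) = (\<Sum>i<n. Im z * (norm (g (k - int i)))\<^sup>2) + J k" for n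
  proof (induction n)
    case (Suc n)
    then show ?case using J[of "k - int n"] jk by (simp add: algebra_simps)
  qed simp
  have Jb: "\<bar>J k\<bar> \<le> norm (g k) * B" for k
  proof -
    have "\<bar>J k\<bar> \<le> norm (g k * cnj (g (k + 1)))" unfolding J_def by (rule abs_Im_le_cmod)
    also have "\<dots> \<le> norm (g k) * B" unfolding norm_mult complex_mod_cnj by (intro mult_left_mono bd) auto
    finally show ?thesis .
  qed
  have B: "B \<ge> 0" using bd[of 0] norm_ge_zero order_trans by blast
  have Jb2: "\<bar>J k\<bar> \<le> B * B" for k
    using Jb[of k] mult_right_mono[OF bd[of k] B] by linarith
  \<comment> \<open>The telescoped sum is a difference of bounded currents. So the series converges,
    its terms tend to 0, and with them \<open>g\<close> and the current at -\<infinity>.\<close>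
  have sm: "summable (\<lambda>i. Im z * (norm (g (k - int i)))\<^sup>2)"
  proof (rule summableI_nonneg_bounded[where x = "2 * (B * B)"])
    show "(\<Sum>i<n. Im z * (norm (g (k - int i)))\<^sup>2) \<le> 2 * (B * B)" for n
      using sum[of n] Jb2[of "k - int n"] Jb2[of k] by linarith
  qed (use eps in auto)
  then have "(\<lambda>i. Im z * (norm (g (k - int i)))\<^sup>2) \<longlonglongrightarrow> 0" by (rule summable_LIMSEQ_zero)
  then have "(\<lambda>i. (1 / Im z) * (Im z * (norm (g (k - int i)))\<^sup>2)) \<longlonglongrightarrow> (1 / Im z) * 0"
    by (rule tendsto_mult_left)
  then have "(\<lambda>i. (norm (g (k - int i)))\<^sup>2) \<longlonglongrightarrow> 0" using eps by simp
  then have "(\<lambda>i. sqrt ((norm (g (k - int i)))\<^sup>2)) \<longlonglongrightarrow> sqrt 0" by (rule tendsto_real_sqrt)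
  then have "(\<lambda>i. norm (g (k - int i)) * B) \<longlonglongrightarrow> 0 * B" by (intro tendsto_mult_right) simp
  then have "(\<lambda>i. norm (g (k - int i)) * B) \<longlonglongrightarrow> 0" by simp
  then have J0: "(\<lambda>i. J (k - int i)) \<longlonglongrightarrow> 0"
    by (rule Lim_null_comparison[rotated]) (use Jb in auto)
  \<comment> \<open>For n > k - j the site \<open>j\<close> is one of the summands, all of which are
    nonnegative.\<close>
  have "Im z * (norm (g j))\<^sup>2 + J k \<le> J (k - int n)" if "n > nat (k - j)" for n
  proof -
    have "Im z * (norm (g (k - int (nat (k - j)))))\<^sup>2 \<le> (\<Sum>i<n. Im z * (norm (g (k - int i)))\<^sup>2)"
      using that eps by (intro member_le_sum) auto
    then show ?thesis using sum[of n] jk by simp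
  qed
  then have "Im z * (norm (g j))\<^sup>2 + J k \<le> 0"
    by (intro tendsto_lowerbound[OF J0]) (auto simp: eventually_sequentially intro!: exI[of _ "Suc (nat (k - j))"])
  then show ?thesis unfolding J_def by linarith
qed

text \<open>The Wronskian of \<open>s\<close> and \<open>g\<close> is constant to the left and
  equals \<open>g (m + 1)\<close> by the Dirichlet data. The currents of \<open>s\<close> and
  \<open>g\<close> have opposite signs, so the two terms of the Wronskian cannot cancel; this bounds
  \<open>g b\<close> by B / (Im z |s b|). The current of \<open>g\<close> at \<open>b - 1\<close>
  then dominates Im z |g j|^2 and is at most B |g b|, which is why only the square of
  \<open>g j\<close> is controlled.\<close>

lemma homogeneous_decay:
  fixes g s :: "int \<Rightarrow> complex" and v :: "int \<Rightarrow> real"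
  assumes eps: "Im z > 0"
    and g: "\<And>k. k \<le> m \<Longrightarrow> g (k - 1) = (z - of_real (v k)) * g k - g (k + 1)"
    and bd: "\<And>k. norm (g k) \<le> B"
    and s: "\<And>k. k \<le> m \<Longrightarrow> s (k - 1) = (z - of_real (v k)) * s k - s (k + 1)"
    and s1: "s (m + 1) = 0" "s m = 1" 
    and jb: "j < b" "b \<le> m"
  shows "(Im z)\<^sup>2 * norm (s b) * (norm (g j))\<^sup>2 \<le> B\<^sup>2"
proof -
  define W where "W k = s k * g (k + 1) - s (k + 1) * g k" for k
  have W: "W (k - 1) = W k" if "k \<le> m" for k
    unfolding W_def g[OF that] s[OF that] by (simp add: algebra_simps)
  have "W (m - int n) = g (m + 1)" for n
  proof (induction n)
    case 0 then show ?case by (simp add: W_def s1)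
  next
    case (Suc n) then show ?case using W[of "m - int n"] by (simp add: algebra_simps)
  qed
  from this[of "nat (m - (b - 1))"] have Wb: "s (b - 1) * g b - s b * g (b - 1) = g (m + 1)"
    using jb by (simp add: W_def)
  define J where "J k = Im (s k * cnj (s (k + 1)))" for k
  have J: "J (k - 1) = Im z * (norm (s k))\<^sup>2 + J k" if "k \<le> m" for k
  proof -
    have "J (k - 1) = Im ((z - of_real (v k)) * (s k * cnj (s k)) - s (k + 1) * cnj (s k))"
      unfolding J_def s[OF that] by (simp add: algebra_simps)
    also have "(z - of_real (v k)) * (s k * cnj (s k)) = (z - of_real (v k)) * of_real ((norm (s k))\<^sup>2)"
      by (simp only: complex_norm_square)
    finally show ?thesis unfolding J_def by (simp add: algebra_simps)
  qed
  have "J (m - int n) \<ge> 0" for n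
  proof (induction n)
    case 0 then show ?case by (simp add: J_def s1)
  next
    case (Suc n)
    have "0 \<le> Im z * (norm (s (m - int n)))\<^sup>2" using eps by simp
    then show ?case using J[of "m - int n"] Suc by (simp add: algebra_simps)
  qed
  from this[of "nat (m - b)"] have "J b \<ge> 0" using jb by simp
  then have Js: "Im z * (norm (s b))\<^sup>2 \<le> Im (s (b - 1) * cnj (s b))"
    using J[of b] jb by (simp add: J_def)
  have Jg: "Im (g (b - 1) * cnj (g b)) \<le> - (Im z * (norm (g j))\<^sup>2)"
    using current_nonpos[of z m g v B j "b - 1", OF eps g bd] jb by simp
  \<comment> \<open>Multiplying the Wronskian by \<open>cnj (s b * g b)\<close> turns its two terms
    into a current of one function times a squared modulus of the other; both contribute
    nonnegatively to the imaginary part.\<close>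
  have "(s (b - 1) * g b - s b * g (b - 1)) * cnj (s b * g b)
      = (s (b - 1) * cnj (s b)) * (g b * cnj (g b)) - (s b * cnj (s b)) * (g (b - 1) * cnj (g b))"
    by (simp add: algebra_simps)
  also have "Im \<dots> = (norm (g b))\<^sup>2 * Im (s (b - 1) * cnj (s b)) - (norm (s b))\<^sup>2 * Im (g (b - 1) * cnj (g b))"
    unfolding complex_norm_square[symmetric] by simp
  finally have "(norm (g b))\<^sup>2 * Im (s (b - 1) * cnj (s b)) - (norm (s b))\<^sup>2 * Im (g (b - 1) * cnj (g b))
      \<le> norm (g (m + 1) * cnj (s b * g b))"
    unfolding Wb using abs_Im_le_cmod[of "g (m + 1) * cnj (s b * g b)"] by linarith
  also have "\<dots> \<le> B * (norm (s b) * norm (g b))"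
    unfolding norm_mult complex_mod_cnj by (intro mult_right_mono bd) auto
  finally have *: "(norm (g b))\<^sup>2 * Im (s (b - 1) * cnj (s b)) - (norm (s b))\<^sup>2 * Im (g (b - 1) * cnj (g b))
      \<le> B * (norm (s b) * norm (g b))" .
  have "0 \<le> (norm (s b))\<^sup>2 * (- Im (g (b - 1) * cnj (g b)))"
  proof (rule mult_nonneg_nonneg)
    have "0 \<le> Im z * (norm (g j))\<^sup>2" using eps by simp
    then show "0 \<le> - Im (g (b - 1) * cnj (g b))" using Jg by linarith
  qed simp
  moreover have "(norm (g b))\<^sup>2 * (Im z * (norm (s b))\<^sup>2) \<le> (norm (g b))\<^sup>2 * Im (s (b - 1) * cnj (s b))"
    by (intro mult_left_mono Js) auto
  ultimately have "(norm (g b))\<^sup>2 * (Im z * (norm (s b))\<^sup>2) \<le> B * (norm (s b) * norm (g b))"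
    using * by linarith
  then have q: "(Im z * norm (s b) * norm (g b)) * (norm (s b) * norm (g b)) \<le> B * (norm (s b) * norm (g b))"
    by (simp add: power2_eq_square mult_ac)
  \<comment> \<open>The common factor is cancelled from \<open>q\<close>; where it vanishes, the
    left side is 0.\<close>
  have gb: "Im z * norm (s b) * norm (g b) \<le> B"
  proof (cases "norm (s b) * norm (g b) = 0")
    case True
    then show ?thesis using order_trans[OF norm_ge_zero bd[of 0]] by auto
  next
    case False
    then have "norm (s b) * norm (g b) > 0" by (simp add: zero_less_mult_iff)
    then show ?thesis using q mult_le_cancel_right_pos by blast
  qed
  have "Im z * (norm (g j))\<^sup>2 \<le> norm (g (b - 1) * cnj (g b))"
    using Jg abs_Im_le_cmod[of "g (b - 1) * cnj (g b)"] by linarith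
  also have "\<dots> \<le> B * norm (g b)"
    unfolding norm_mult complex_mod_cnj by (intro mult_right_mono bd) auto
  finally have "Im z * norm (s b) * (Im z * (norm (g j))\<^sup>2) \<le> Im z * norm (s b) * (B * norm (g b))"
    using eps by (intro mult_left_mono) auto
  also have "\<dots> = B * (Im z * norm (s b) * norm (g b))" by (simp add: mult_ac)
  also have "\<dots> \<le> B * B"
    using order_trans[OF norm_ge_zero bd[of 0]] by (intro mult_left_mono gb) auto
  finally show ?thesis by (simp add: power2_eq_square mult_ac)
qed

section \<open>Largeness of block determinants\<close>

lemma poly_le_on_disc:
  fixes P :: "complex poly"
  assumes M: "\<And>w. norm w = 1 \<Longrightarrow> norm (poly P w) \<le> M" and w: "norm w \<le> 1"
  shows "norm (poly P w) \<le> M"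
proof (rule maximum_modulus_frontier[where S = "cball 0 1" and f = "poly P"])
  show "poly P holomorphic_on interior (cball 0 1)"
    by (intro holomorphic_intros)
qed (use assms in \<open>auto intro!: continuous_intros\<close>)

text \<open>The reflected polynomial obeys the same bound on the circle, so the maximum principle
  bounds it at \<open>inverse w\<close> inside the disc; undoing the reflection costs a factor
  |w|^(degree).\<close>

lemma poly_growth:
  fixes P :: "complex poly"
  assumes M: "\<And>w. norm w = 1 \<Longrightarrow> norm (poly P w) \<le> M" and deg: "degree P \<le> n" and w: "norm w \<ge> 1"
  shows "norm (poly P w) \<le> M * norm w ^ n"
proof -
  have M0: "M \<ge> 0" using order_trans[OF norm_ge_zero M[of 1]] by simp
  have "norm (poly (reflect_poly P) u) \<le> M" if "norm u = 1" for u
  proof -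
    have "u \<noteq> 0" using that by auto
    then show ?thesis using M[of "inverse u"] that
      by (simp add: poly_reflect_poly_nz norm_mult norm_power norm_inverse)
  qed
  then have R: "norm (poly (reflect_poly P) (inverse w)) \<le> M"
    by (rule poly_le_on_disc) (use w in \<open>simp_all add: norm_inverse inverse_le_1_iff\<close>)
  have w0: "w \<noteq> 0" using w by auto
  then have "poly P w = w ^ degree P * poly (reflect_poly P) (inverse w)"
    by (simp add: poly_reflect_poly_nz field_simps)
  then have "norm (poly P w) = norm w ^ degree P * norm (poly (reflect_poly P) (inverse w))"
    by (simp add: norm_mult norm_power)
  also have "\<dots> \<le> norm w ^ n * M"
    using w deg M0 R by (intro mult_mono power_increasing) auto
  finally show ?thesis by (simp add: mult.commute)
qed

text \<open>A weak form of Bernstein's inequality, from Cauchy's estimate on discs of radius \<open>1 / n\<close>.\<close>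

lemma poly_lipschitz_on_disc:
  fixes P :: "complex poly"
  assumes M: "\<And>w. norm w = 1 \<Longrightarrow> norm (poly P w) \<le> M" and deg: "degree P \<le> n" and n: "n > 0"
    and w: "norm w \<le> 1" "norm w' \<le> 1"
  shows "norm (poly P w - poly P w') \<le> 3 * M * real n * norm (w - w')"
proof (rule field_differentiable_bound[of "cball 0 1" "poly P" "poly (pderiv P)" "3 * M * real n"])
  have M0: "M \<ge> 0" using order_trans[OF norm_ge_zero M[of 1]] by simp
  show "(poly P has_field_derivative poly (pderiv P) u) (at u within cball 0 1)" for u
    by (rule has_field_derivative_at_within[OF poly_DERIV])
  fix u :: complex assume u: "u \<in> cball 0 1"
  have "norm (poly P x) \<le> 3 * M" if x: "norm (u - x) = 1 / real n" for x
  proof (cases "norm x \<le> 1")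
    case True
    then show ?thesis using poly_le_on_disc[OF M, of x] M0 by linarith
  next
    case False
    have "norm x \<le> norm u + norm (u - x)"
      using norm_triangle_ineq4[of u "u - x"] by simp
    then have x1: "norm x \<le> 1 + 1 / real n" using u x by simp
    \<comment> \<open>The point lies within 1 / n of the disc, so the growth factor is at most (1 +
      1 / n)^n \<le> e \<le> 3; this is the constant 3 of the statement.\<close>
    have "norm (poly P x) \<le> M * norm x ^ n"
      using False by (intro poly_growth[OF M deg]) auto
    also have "\<dots> \<le> M * (1 + 1 / real n) ^ n"
      using x1 M0 by (intro mult_left_mono power_mono) auto
    also have "\<dots> \<le> M * exp (1 / real n) ^ n"
      using M0 by (intro mult_left_mono power_mono exp_ge_add_one_self) auto
    also have "exp (1 / real n) ^ n = exp 1" using n by (simp add: exp_of_nat_mult[symmetric])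
    also have "M * exp 1 \<le> M * 3" using M0 exp_le by (intro mult_left_mono) auto
    finally show ?thesis by simp
  qed
  then have "norm ((deriv ^^ 1) (poly P) u) \<le> fact 1 * (3 * M) / (1 / real n) ^ 1"
    using n by (intro Cauchy_inequality) (auto intro!: holomorphic_intros continuous_intros)
  then show "norm (poly (pderiv P) u) \<le> 3 * M * real n"
    using n DERIV_imp_deriv[OF poly_DERIV[of P u]] by (simp add: field_simps)
qed (use w in auto)

text \<open>On the unit circle \<open>cnj w = 1 / w\<close>, so
  \<open>w * (z - 2 * \<mu> * Re (\<zeta> * w))\<close> is the quadratic polynomial used here.
  Multiplying the eigenvalue recurrence by \<open>w\<close> at every step therefore yields
  polynomials whose values are \<open>w ^ n\<close> times the solution.\<close>

fun block_poly :: "complex \<Rightarrow> real \<Rightarrow> (nat \<Rightarrow> complex) \<Rightarrow> nat \<Rightarrow> complex poly" where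
  "block_poly z \<mu> \<zeta> 0 = 1"
| "block_poly z \<mu> \<zeta> (Suc 0) = [:- (of_real \<mu> * cnj (\<zeta> 0)), z, - (of_real \<mu> * \<zeta> 0):]"
| "block_poly z \<mu> \<zeta> (Suc (Suc n)) =
    [:- (of_real \<mu> * cnj (\<zeta> (Suc n))), z, - (of_real \<mu> * \<zeta> (Suc n)):] * block_poly z \<mu> \<zeta> (Suc n)
    - [:0, 0, 1:] * block_poly z \<mu> \<zeta> n"

lemma degree_block_poly: "degree (block_poly z \<mu> \<zeta> n) \<le> 2 * n"
proof (induction z \<mu> \<zeta> n rule: block_poly.induct)
  case (2 z \<mu> \<zeta>)
  show ?case by (simp add: degree_pCons_le order_trans[OF degree_pCons_le])
next
  case (3 z \<mu> \<zeta> n)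
  let ?q = "[:- (of_real \<mu> * cnj (\<zeta> (Suc n))), z, - (of_real \<mu> * \<zeta> (Suc n)):]"
  have "degree (?q * block_poly z \<mu> \<zeta> (Suc n)) \<le> 2 + 2 * Suc n"
    by (rule order_trans[OF degree_mult_le add_mono[OF _ 3(1)]]) simp
  moreover have "degree ([:0, 0, 1:] * block_poly z \<mu> \<zeta> n) \<le> 2 + 2 * n"
    by (rule order_trans[OF degree_mult_le add_mono[OF _ 3(2)]]) simp
  ultimately show ?case unfolding block_poly.simps by (intro degree_diff_le) auto
qed simp

text \<open>At 0 the subtracted term vanishes and each quadratic factor reduces to its constant
  coefficient, of modulus \<mu>. The spectral parameter \<open>z\<close> disappears, which is the
  source of all uniformity in the energy.\<close>

lemma norm_block_poly_0:
  assumes "\<And>i. norm (\<zeta> i) = 1" "\<mu> \<ge> 0"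
  shows "norm (poly (block_poly z \<mu> \<zeta> n) 0) = \<mu> ^ n"
  using assms
  by (induction z \<mu> \<zeta> n rule: block_poly.induct) (auto simp: norm_mult)

lemma poly_block_poly:
  assumes w: "norm w = 1"
    and s0: "s 0 = 1" "s 1 = z - of_real (2 * \<mu> * Re (\<zeta> 0 * w))"
    and s: "\<And>n. s (Suc (Suc n)) = (z - of_real (2 * \<mu> * Re (\<zeta> (Suc n) * w))) * s (Suc n) - s n"
  shows "poly (block_poly z \<mu> \<zeta> n) w = w ^ n * s n"
  using s0 s
proof (induction z \<mu> \<zeta> n rule: block_poly.induct)
  have ww: "w * cnj w = 1" using w by (simp add: complex_norm_square[symmetric])
  have R: "w * (z - of_real (2 * \<mu> * Re (x * w))) = - (of_real \<mu> * cnj x) + w * (z + w * - (of_real \<mu> * x))" for z \<mu> x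
  proof -
    have "of_real (2 * \<mu> * Re (x * w)) = of_real \<mu> * (x * w + cnj x * cnj w)"
      by (simp add: complex_eq_iff)
    then have "w * (z - of_real (2 * \<mu> * Re (x * w))) = w * z - of_real \<mu> * x * w * w - of_real \<mu> * cnj x * (w * cnj w)"
      by (simp add: algebra_simps)
    then show ?thesis unfolding ww by (simp add: algebra_simps)
  qed
  {
    case (1 z \<mu> \<zeta>) then show ?case by simp
  next
    case (2 z \<mu> \<zeta>) then show ?case using R[of z \<mu> "\<zeta> 0"] by simp
  next
    case (3 z \<mu> \<zeta> n)
    have "poly (block_poly z \<mu> \<zeta> (Suc (Suc n))) w
      = (w * (z - of_real (2 * \<mu> * Re (\<zeta> (Suc n) * w)))) * (w ^ Suc n * s (Suc n)) - w * w * (w ^ n * s n)"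
      unfolding block_poly.simps poly_diff poly_mult 3(1)[OF 3(3-)] 3(2)[OF 3(3-)] R
      by (simp only: poly_pCons poly_0 mult_zero_right add_0_left add_0_right mult_1_right mult.assoc)
    also have "\<dots> = w ^ Suc (Suc n) * ((z - of_real (2 * \<mu> * Re (\<zeta> (Suc n) * w))) * s (Suc n) - s n)"
      by (simp only: power_Suc right_diff_distrib mult_ac)
    finally show ?case unfolding 3(5)[of n] .
  }
qed

text \<open>Herman's trick: the maximum on the circle is at least the value at the centre.\<close>

lemma block_poly_large:
  assumes \<zeta>: "\<And>i. norm (\<zeta> i) = 1" and \<mu>: "\<mu> \<ge> 0" and n: "n > 0"
  obtains u where "norm u = 1"
    and "\<And>w. norm w = 1 \<Longrightarrow> 12 * real n * norm (w - u) \<le> 1 \<Longrightarrow> norm (poly (block_poly z \<mu> \<zeta> n) w) \<ge> \<mu> ^ n / 2"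
proof -
  let ?P = "block_poly z \<mu> \<zeta> n"
  have "continuous_on (sphere 0 1) (\<lambda>w. norm (poly ?P w))" by (intro continuous_intros)
  then obtain u where u: "norm u = 1" "\<And>w. norm w = 1 \<Longrightarrow> norm (poly ?P w) \<le> norm (poly ?P u)"
    using continuous_attains_sup[of "sphere (0::complex) 1" "\<lambda>w. norm (poly ?P w)"] by force
  let ?M = "norm (poly ?P u)"
  have M: "\<mu> ^ n \<le> ?M"
    using poly_le_on_disc[OF u(2), where w = 0] norm_block_poly_0[OF \<zeta> \<mu>] by simp
  show thesis
  proof (rule that[OF u(1)])
    fix w :: complex assume w: "norm w = 1" "12 * real n * norm (w - u) \<le> 1"
    \<comment> \<open>The degree is at most 2 n, so the Lipschitz constant is 6 n times the maximum;
      moving by 1 / (12 n) loses at most half of it.\<close>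
    have "norm (poly ?P w - poly ?P u) \<le> 3 * ?M * real (2 * n) * norm (w - u)"
      using n w u by (intro poly_lipschitz_on_disc[OF u(2) degree_block_poly]) auto
    also have "\<dots> = ?M * (12 * real n * norm (w - u)) / 2" by simp
    also have "\<dots> \<le> ?M * 1 / 2" by (intro divide_right_mono mult_left_mono w) auto
    finally have "norm (poly ?P w - poly ?P u) \<le> ?M / 2" by simp
    moreover have "?M \<le> norm (poly ?P w) + norm (poly ?P w - poly ?P u)"
      using norm_triangle_ineq4[of "poly ?P w" "poly ?P w - poly ?P u"] by simp
    ultimately show "\<mu> ^ n / 2 \<le> norm (poly ?P w)" using M by linarith
  qed
qed

text \<open>As \<open>p\<close> is invertible modulo \<open>q\<close>, the multiples of p / q run
  through all multiples of 1 / q modulo 1, one of which is within 1 / q of the target. Replacing p /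
  q by \<theta> over fewer than q steps costs at most q times 1 / q^2.\<close>

lemma orbit_dense:
  fixes p q :: int and \<theta> x y :: real
  assumes q: "q > 0" and cop: "coprime p q" and approx: "\<bar>\<theta> - p / q\<bar> \<le> 1 / (real_of_int q)\<^sup>2"
  obtains j n :: int where "0 \<le> j" "j < q" "\<bar>x - j * \<theta> - y - n\<bar> \<le> 2 / q"
proof -
  define r where "r = \<lfloor>q * (x - y)\<rfloor>"
  obtain i where i: "[p * i = 1] (mod q)" using cop cong_solve_coprime_int by blast
  \<comment> \<open>With \<open>i\<close> inverse to \<open>p\<close> this solves p j = r modulo q,
    where r / q is the multiple of 1 / q just below x - y.\<close>
  define j where "j = (i * r) mod q"
  have j: "0 \<le> j" "j < q" using q by (auto simp: j_def)
  have "[p * j = p * (i * r)] (mod q)" unfolding j_def by (intro cong_mult) auto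
  also have "[p * (i * r) = 1 * r] (mod q)" using cong_mult[OF i cong_refl[of r]] by (simp add: mult.assoc)
  finally obtain n where n: "p * j = r + q * n"
    by (metis cong_iff_lin cong_sym mult_1)
  have "\<bar>q * (x - y) - r\<bar> \<le> 1" unfolding r_def by linarith
  then have "\<bar>(q * (x - y) - r) / q\<bar> \<le> 1 / q"
    using q by (simp add: abs_divide divide_right_mono)
  also have "(q * (x - y) - r) / q = x - y - r / q" using q by (simp add: field_simps)
  finally have 1: "\<bar>x - y - r / q\<bar> \<le> 1 / q" .
  have "\<bar>j * (p / q - \<theta>)\<bar> = j * \<bar>\<theta> - p / q\<bar>" using j by (simp add: abs_mult abs_minus_commute)
  also have "\<dots> \<le> q * (1 / (real_of_int q)\<^sup>2)" using j approx by (intro mult_mono) auto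
  also have "\<dots> = 1 / q" using q by (simp add: power2_eq_square)
  finally have 2: "\<bar>j * (p / q - \<theta>)\<bar> \<le> 1 / q" .
  have "real_of_int (p * j) = real_of_int (r + q * n)" using n by simp
  then have "j * (p / q) = r / q + n" using q by (simp add: field_simps)
  then have "x - j * \<theta> - y - of_int (- n) = (x - y - r / q) + j * (p / q - \<theta>)"
    by (simp add: algebra_simps)
  then have "\<bar>x - j * \<theta> - y - of_int (- n)\<bar> \<le> 2 / q" using 1 2 by linarith
  then show thesis using that j by blast
qed

text \<open>Chord length is at most arc length; the free integer lets distances be measured modulo
  1.\<close>

lemma norm_cis_diff_le: "norm (cis (2 * pi * x) - cis (2 * pi * y)) \<le> 2 * pi * \<bar>x - y - of_int n\<bar>"
proof -
  have "cis (2 * pi * x) = cis (2 * pi * (x - n))"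
    by (simp add: cis.ctr complex_eq_iff right_diff_distrib cos_diff sin_diff sin_int_2pin cos_int_2pin)
  then have "cis (2 * pi * x) - cis (2 * pi * y) = cis (2 * pi * y) * (iexp (2 * pi * (x - y - n)) - 1)"
    unfolding cis_conv_exp[symmetric] by (simp add: cis_mult right_diff_distrib algebra_simps)
  then have "norm (cis (2 * pi * x) - cis (2 * pi * y)) = norm (iexp (2 * pi * (x - y - n)) - 1)"
    by (simp add: norm_mult)
  also have "\<dots> \<le> \<bar>2 * pi * (x - y - n)\<bar>"
    using iexp_approx1[of "2 * pi * (x - y - n)" 0] by simp
  finally show ?thesis by (simp add: abs_mult)
qed

text \<open>The solution that would be 0 one index before the start, hence the value
  \<open>d 0\<close> at index 1.\<close>

fun recurrence_solution :: "(nat \<Rightarrow> complex) \<Rightarrow> nat \<Rightarrow> complex" where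
  "recurrence_solution d 0 = 1"
| "recurrence_solution d (Suc 0) = d 0"
| "recurrence_solution d (Suc (Suc n)) = d (Suc n) * recurrence_solution d (Suc n) - recurrence_solution d n"

text \<open>Starting the block at \<open>- j\<close> instead of 0 rotates its phase by -j \<theta>.
  By density of the orbit some j < q moves the phase onto the arc where the block polynomial is
  large. The block may depend on \<open>z\<close>, but the lower bound does not.\<close>

lemma almost_mathieu_large_block:
  fixes p q :: int and lam \<theta> \<omega> :: real and z :: complex
  assumes q: "q \<ge> 200" and cop: "coprime p q" and approx: "\<bar>\<theta> - p / q\<bar> \<le> 1 / (real_of_int q)\<^sup>2"
    and lam: "lam \<ge> 0"
  obtains m :: int and s :: "int \<Rightarrow> complex"
  where "m \<le> 0" "- q < m" "s (m + 1) = 0" "s m = 1"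
    and "\<And>k. k \<le> m \<Longrightarrow> s (k - 1) = (z - of_real (lam * cos (2 * pi * (k * \<theta> + \<omega>)))) * s k - s (k + 1)"
    and "norm (s (m - q div 200)) \<ge> (lam / 2) ^ nat (q div 200) / 2"
proof -
  define \<mu> where "\<mu> = lam / 2"
  define L where "L = nat (q div 200)"
  have L: "L > 0" "int L = q div 200" using q unfolding L_def by auto
  \<comment> \<open>The minus sign is there because the block is traversed from right to left: its
    i-th site is -j - i.\<close>
  define \<zeta> where "\<zeta> i = cis (- (2 * pi * real i * \<theta>))" for i
  obtain u where u: "norm u = 1"
    "\<And>w. norm w = 1 \<Longrightarrow> 12 * real L * norm (w - u) \<le> 1 \<Longrightarrow> norm (poly (block_poly z \<mu> \<zeta> L) w) \<ge> \<mu> ^ L / 2"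
    using block_poly_large[of \<zeta> \<mu> L z] L lam unfolding \<zeta>_def \<mu>_def by auto
  have uy: "u = cis (2 * pi * (Arg u / (2 * pi)))"
    using u(1) cis_Arg[of u] by (cases "u = 0") (auto simp: sgn_div_norm)
  obtain j n where j: "0 \<le> j" "j < q" "\<bar>\<omega> - j * \<theta> - Arg u / (2 * pi) - of_int n\<bar> \<le> 2 / q"
    using orbit_dense[OF _ cop approx] q by (metis order_less_le_trans zero_less_numeral)
  define w where "w = cis (2 * pi * (\<omega> - j * \<theta>))"
  have "norm (w - u) \<le> 2 * pi * (2 / q)"
    unfolding w_def
    by (subst uy, rule order_trans[OF norm_cis_diff_le[where n = n]])
      (intro mult_left_mono j, simp)
  then have "12 * real L * norm (w - u) \<le> 12 * real L * (2 * pi * (2 / q))"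
    by (intro mult_left_mono) auto
  also have "\<dots> \<le> 12 * (q / 200) * (2 * pi * (2 / q))"
  proof -
    have "real L = real_of_int (q div 200)" using L(2) by (metis of_int_of_nat_eq)
    also have "\<dots> \<le> q / 200" using real_of_int_div4[of q 200] by simp
    finally show ?thesis using q by (intro mult_right_mono mult_left_mono) auto
  qed
  \<comment> \<open>This is where the length q div 200 comes from: density 2 / q must fit into the
    arc of radius 1 / (12 L), and 48 \<pi> < 200.\<close>
  also have "\<dots> = 48 * pi / 200" using q by (simp add: field_simps)
  also have "\<dots> \<le> 1" using pi_less_4 by simp
  finally have big: "norm (poly (block_poly z \<mu> \<zeta> L) w) \<ge> \<mu> ^ L / 2"
    by (intro u) (auto simp: w_def)
  define v where "v k = lam * cos (2 * pi * (of_int k * \<theta> + \<omega>))" for k :: int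
  define d where "d i = z - of_real (v (- j - int i))" for i
  have v: "v (- j - int i) = 2 * \<mu> * Re (\<zeta> i * w)" for i
    unfolding v_def \<mu>_def \<zeta>_def w_def cis_mult by (simp add: algebra_simps)
  have "poly (block_poly z \<mu> \<zeta> L) w = w ^ L * recurrence_solution d L"
    by (intro poly_block_poly) (auto simp: w_def d_def v[unfolded w_def])
  then have big': "norm (recurrence_solution d L) \<ge> \<mu> ^ L / 2"
    using big by (simp add: norm_mult norm_power w_def)
  \<comment> \<open>The value 0 to the right of -j is the Dirichlet condition; with it the
    recurrence at k = -j reproduces the first step \<open>d 0\<close>.\<close>
  define s where "s k = (if k \<le> - j then recurrence_solution d (nat (- j - k)) else 0)" for k :: int
  show thesis
  proof (rule that[of "- j" s])
    fix k :: int assume k: "k \<le> - j"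
    show "s (k - 1) = (z - of_real (lam * cos (2 * pi * (k * \<theta> + \<omega>)))) * s k - s (k + 1)"
    proof (cases "k = - j")
      case True
      then show ?thesis by (simp add: s_def d_def v_def)
    next
      case False
      define i where "i = nat (- j - k) - 1"
      have i: "nat (- j - (k + 1)) = i" "nat (- j - k) = Suc i" "nat (- j - (k - 1)) = Suc (Suc i)" "- j - int (Suc i) = k"
        using k False unfolding i_def by auto
      have "d (Suc i) = z - of_real (v k)" unfolding d_def i(4) ..
      then show ?thesis using k False unfolding s_def i v_def by simp
    qed
  next
    have "s (- j - q div 200) = recurrence_solution d L"
      unfolding s_def L_def using q by auto
    then show "norm (s (- j - q div 200)) \<ge> (lam / 2) ^ nat (q div 200) / 2"
      using big' by (simp add: \<mu>_def L_def)
  qed (use j in \<open>auto simp: s_def\<close>)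
qed

text \<open>The block starts to the right of -q and is much shorter than q, so its left end is to
  the right of -2 q and every site below -2 q lies beyond it.\<close>

lemma almost_mathieu_green_decay:
  fixes p q :: int and lam \<theta> \<omega> :: real and g :: "int \<Rightarrow> complex"
  assumes q: "q \<ge> 200" and cop: "coprime p q" and approx: "\<bar>\<theta> - p / q\<bar> \<le> 1 / (real_of_int q)\<^sup>2"
    and lam: "lam \<ge> 0" and z: "Im z > 0"
    and rec: "\<And>k. k \<le> 0 \<Longrightarrow> g (k - 1) = (z - of_real (lam * cos (2 * pi * (k * \<theta> + \<omega>)))) * g k - g (k + 1)"
    and bd: "\<And>k. norm (g k) \<le> B" and j: "j < - 2 * q"
  shows "(Im z)\<^sup>2 * ((lam / 2) ^ nat (q div 200) / 2) * (norm (g j))\<^sup>2 \<le> B\<^sup>2"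
proof -
  obtain m s where m: "m \<le> 0" "- q < m" "s (m + 1) = 0" "s m = 1"
    and s: "\<And>k. k \<le> m \<Longrightarrow> s (k - 1) = (z - of_real (lam * cos (2 * pi * (k * \<theta> + \<omega>)))) * s k - s (k + 1)"
    and big: "norm (s (m - q div 200)) \<ge> (lam / 2) ^ nat (q div 200) / 2"
    using almost_mathieu_large_block[OF q cop approx lam] by metis
  have "(Im z)\<^sup>2 * norm (s (m - q div 200)) * (norm (g j))\<^sup>2 \<le> B\<^sup>2"
    using m j q by (intro homogeneous_decay[OF z rec bd s m(3,4)]) auto
  moreover have "(Im z)\<^sup>2 * ((lam / 2) ^ nat (q div 200) / 2) * (norm (g j))\<^sup>2
      \<le> (Im z)\<^sup>2 * norm (s (m - q div 200)) * (norm (g j))\<^sup>2"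
    using big by (intro mult_right_mono mult_left_mono) auto
  ultimately show ?thesis by linarith
qed

section \<open>Laplace transforms and Fourier inversion\<close>

lemma exp_decay_integral:
  fixes e :: real assumes "e > 0"
  shows "set_integrable lborel {0..} (\<lambda>t. exp (- (e * t)))"
    and "(LINT t:{0..}|lborel. exp (- (e * t))) = 1 / e"
proof -
  \<comment> \<open>The Erlang density of order 0 is the exponential density, whose total mass is
    known.\<close>
  have "has_bochner_integral lborel (\<lambda>x. erlang_density 0 e x * x ^ 0) 1"
  proof (rule has_bochner_integral_nn_integral)
    show "(\<integral>\<^sup>+ x. ennreal (erlang_density 0 e x * x ^ 0) \<partial>lborel) = ennreal 1"
      using nn_integral_erlang_ith_moment[OF assms, of 0 0] by simp
  qed (use assms in \<open>auto simp: erlang_density_def\<close>)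
  then have "has_bochner_integral lborel (\<lambda>x. (1 / e) * (erlang_density 0 e x * x ^ 0)) ((1 / e) * 1)"
    by (intro has_bochner_integral_mult_right) simp
  also have "(\<lambda>x. (1 / e) * (erlang_density 0 e x * x ^ 0)) = (\<lambda>t. indicator {0..} t *\<^sub>R exp (- (e * t)))"
    using assms by (auto simp: erlang_density_def fun_eq_iff indicator_def mult.commute)
  finally have *: "has_bochner_integral lborel (\<lambda>t. indicator {0..} t *\<^sub>R exp (- (e * t))) (1 / e)" by simp
  show "set_integrable lborel {0..} (\<lambda>t. exp (- (e * t)))"
    using * unfolding set_integrable_def by (rule integrable.intros)
  show "(LINT t:{0..}|lborel. exp (- (e * t))) = 1 / e"
    using * unfolding set_lebesgue_integral_def by (rule has_bochner_integral_integral_eq)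
qed

lemma set_integrable_exp_decay_mult:
  fixes h :: "real \<Rightarrow> 'b::{real_normed_field, banach, second_countable_topology}"
  assumes "e > 0" "h \<in> borel_measurable borel" "\<And>t. t \<ge> 0 \<Longrightarrow> norm (h t) \<le> B * exp (- (e * t))"
  shows "set_integrable lborel {0..} h"
proof (rule set_integrable_bound)
  show "set_integrable lborel {0..} (\<lambda>t. B * exp (- (e * t)))"
    by (intro set_integrable_mult_right exp_decay_integral assms)
  show "set_borel_measurable lborel {0..} h"
    unfolding set_borel_measurable_def using assms(2) by measurable
  show "AE t in lborel. t \<in> {0..} \<longrightarrow> norm (h t) \<le> norm (B * exp (- (e * t)))"
    using assms(3) by (intro AE_I2) (force intro: order_trans)
qed

lemma norm_set_integral_exp_decay:
  fixes h :: "real \<Rightarrow> 'b::{real_normed_field, banach, second_countable_topology}"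
  assumes "e > 0" "h \<in> borel_measurable borel" "\<And>t. t \<ge> 0 \<Longrightarrow> norm (h t) \<le> B * exp (- (e * t))"
  shows "norm (LINT t:{0..}|lborel. h t) \<le> B / e"
proof -
  have h: "set_integrable lborel {0..} h" by (rule set_integrable_exp_decay_mult[OF assms])
  have "norm (LINT t:{0..}|lborel. h t) \<le> (LINT t:{0..}|lborel. norm (h t))"
    by (rule set_integral_norm_bound[OF h])
  also have "\<dots> \<le> (LINT t:{0..}|lborel. B * exp (- (e * t)))"
    by (intro set_integral_mono set_integrable_norm h set_integrable_mult_right exp_decay_integral assms) (auto simp: assms)
  also have "\<dots> = B / e" using exp_decay_integral(2)[OF assms(1)] by simp
  finally show ?thesis .
qed

lemma norm_exp_minus_mult: "norm (exp (- (s * of_real t)) * (x::complex)) = exp (- (Re s * t)) * norm x"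
  by (simp add: norm_mult)

lemma set_integral_Ioi_eq_Ici:
  fixes h :: "real \<Rightarrow> 'b::{banach, second_countable_topology}"
  assumes "h \<in> borel_measurable borel"
  shows "(LINT t:{0<..}|lborel. h t) = (LINT t:{0..}|lborel. h t)"
proof (rule set_integral_cong_set)
  have "AE x in lborel. x \<noteq> (0::real)" by (rule AE_lborel_singleton)
  then show "AE x in lborel. (x \<in> {0::real..}) = (x \<in> {0<..})" by eventually_elim auto
qed (use assms in \<open>auto simp: set_borel_measurable_def\<close>)

text \<open>Integration by parts: the fundamental theorem is applied to
  \<open>exp (- (s * of_real t)) * h t\<close>, which runs from \<open>h 0\<close> to 0 at infinity
  by the exponential damping.\<close>

lemma laplace_derivative:
  fixes h h' :: "real \<Rightarrow> complex"
  assumes s: "Re s > 0"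
    and d: "\<And>t. (h has_vector_derivative h' t) (at t)"
    and h'c: "continuous_on UNIV h'"
    and b: "\<And>t. t \<ge> 0 \<Longrightarrow> norm (h t) \<le> B" and b': "\<And>t. t \<ge> 0 \<Longrightarrow> norm (h' t) \<le> B'"
  shows "(LINT t:{0..}|lborel. exp (- (s * of_real t)) * h' t)
    = s * (LINT t:{0..}|lborel. exp (- (s * of_real t)) * h t) - h 0"
proof -
  have hc: "continuous_on UNIV h"
    by (intro continuous_at_imp_continuous_on ballI has_vector_derivative_continuous[OF d])
  have ec: "continuous_on UNIV (\<lambda>t::real. exp (- (s * of_real t)))" by (intro continuous_intros)
  let ?e = "\<lambda>t::real. exp (- (s * of_real t))"
  have m: "h \<in> borel_measurable borel" "h' \<in> borel_measurable borel" "?e \<in> borel_measurable borel"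
    using hc h'c ec by (auto intro: borel_measurable_continuous_onI)
  have i1: "set_integrable lborel {0..} (\<lambda>t. ?e t * h t)"
  proof (rule set_integrable_exp_decay_mult[where e = "Re s" and B = B])
    show "norm (?e t * h t) \<le> B * exp (- (Re s * t))" if "t \<ge> 0" for t
      using b[OF that] unfolding norm_exp_minus_mult by (simp add: mult.commute mult_right_mono)
  qed (use s m in auto)
  have i2: "set_integrable lborel {0..} (\<lambda>t. ?e t * h' t)"
  proof (rule set_integrable_exp_decay_mult[where e = "Re s" and B = B'])
    show "norm (?e t * h' t) \<le> B' * exp (- (Re s * t))" if "t \<ge> 0" for t
      using b'[OF that] unfolding norm_exp_minus_mult by (simp add: mult.commute mult_right_mono)
  qed (use s m in auto)
  let ?F' = "\<lambda>t. ?e t * h' t - s * (?e t * h t)"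
  have i3: "set_integrable lborel {0..} ?F'"
    by (intro set_integral_diff set_integrable_mult_right i1 i2)
  have "(LBINT t=ereal 0..\<infinity>. ?F' t) = 0 - h 0"
  proof (rule interval_integral_FTC_integrable)
    show "((\<lambda>t. ?e t * h t) has_vector_derivative ?F' t) (at t)" for t
    proof -
      have "((\<lambda>x. - (s * of_real x)) has_vector_derivative - s) (at t)"
        by (rule has_vector_derivative_eq_rhs, (rule derivative_intros)+) auto
      then have "(?e has_vector_derivative - s * ?e t) (at t)"
        using field_vector_diff_chain_at[of "\<lambda>x. - (s * of_real x)" "- s" t exp "?e t"]
        by (auto simp: o_def intro!: DERIV_exp)
      then have "((\<lambda>t. ?e t * h t) has_vector_derivative (?e t * h' t + (- s * ?e t) * h t)) (at t)"
        using d[of t] by (rule has_vector_derivative_mult)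
      then show ?thesis by (simp add: algebra_simps)
    qed
    show "isCont ?F' t" for t
      using hc h'c ec by (auto simp: continuous_on_eq_continuous_at intro!: continuous_intros)
    show "set_integrable lborel (einterval (ereal 0) \<infinity>) ?F'"
      by (rule set_integrable_subset[OF i3]) (auto simp: einterval_def)
    have "((\<lambda>t. ?e t * h t) \<longlongrightarrow> ?e 0 * h 0) (at_right 0)"
      using continuous_on_mult[OF ec hc]
      by (simp only: continuous_on_eq_continuous_at[OF open_UNIV] isCont_def filterlim_at_split) blast
    then have "((\<lambda>t. ?e t * h t) \<longlongrightarrow> h 0) (at_right 0)" by simp
    then show "(((\<lambda>t. ?e t * h t) \<circ> real_of_ereal) \<longlongrightarrow> h 0) (at_right (ereal 0))"
      by (simp only: ereal_tendsto_simps1)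
    have "((\<lambda>t. ?e t * h t) \<longlongrightarrow> 0) at_top"
    proof (rule Lim_null_comparison)
      show "\<forall>\<^sub>F t in at_top. norm (?e t * h t) \<le> exp (- (Re s * t)) * B"
        using eventually_ge_at_top[of 0]
        by eventually_elim (use b in \<open>auto simp: norm_exp_minus_mult intro: mult_left_mono\<close>)
      show "((\<lambda>t. exp (- (Re s * t)) * B) \<longlongrightarrow> 0) at_top"
        using s by real_asymp
    qed
    then show "(((\<lambda>t. ?e t * h t) \<circ> real_of_ereal) \<longlongrightarrow> 0) (at_left \<infinity>)"
      by (simp only: ereal_tendsto_simps1)
  qed simp
  then have "(LINT t:{0<..}|lborel. ?F' t) = - h 0"
    by (simp add: interval_integral_to_infinity_eq)
  also have "(LINT t:{0<..}|lborel. ?F' t) = (LINT t:{0..}|lborel. ?F' t)"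
    using m by (intro set_integral_Ioi_eq_Ici) auto
  also have "\<dots> = (LINT t:{0..}|lborel. ?e t * h' t) - s * (LINT t:{0..}|lborel. ?e t * h t)"
    using i1 i2 by (simp add: set_integral_diff)
  finally show ?thesis by (simp add: algebra_simps)
qed

lemma exp_minus_half_sq_eq_integral:
  "(LINT x|lborel. std_normal_density x *\<^sub>R iexp (u * x)) = complex_of_real (exp (- (u\<^sup>2) / 2))"
proof -
  have "char std_normal_distribution u = (LINT x|lborel. std_normal_density x *\<^sub>R iexp (u * x))"
    unfolding char_def by (intro integral_density) auto
  then show ?thesis by (simp add: char_std_normal_distribution)
qed

text \<open>Average \<open>f\<close> against a Gaussian of width \<sigma> centred at
  \<open>t\<close>. Writing the Gaussian as a Fourier integral and exchanging integrals bounds the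
  average by \<eta> / \<sigma>, while the Lipschitz property bounds its distance to
  \<open>f t\<close> by L times the first absolute moment. A uniform bound on the transform thus
  controls \<open>f\<close> pointwise.\<close>

lemma norm_le_of_small_fourier:
  fixes f :: "real \<Rightarrow> complex"
  assumes int: "integrable lborel f"
    and lip: "\<And>s t. norm (f s - f t) \<le> L * \<bar>s - t\<bar>"
    and small: "\<And>x. norm (LINT s|lborel. iexp (x * s) * f s) \<le> \<eta>"
    and \<sigma>: "\<sigma> > 0"
  shows "norm (f t) \<le> \<eta> / \<sigma> + L * \<sigma>"
proof -
  let ?g = "normal_density t \<sigma>" and ?n = std_normal_density
  let ?F = "\<lambda>x s. ?n x *\<^sub>R (iexp ((s - t) / \<sigma> * x) * f s)"
  have [measurable]: "f \<in> borel_measurable borel" using int by (simp add: borel_measurable_integrable)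
  have L: "L \<ge> 0" using order_trans[OF norm_ge_zero lip[of 1 0]] by simp
  have \<eta>: "\<eta> \<ge> 0" using order_trans[OF norm_ge_zero small[of 0]] by simp
  have ni: "integrable lborel ?n" by simp
  have inner: "integrable lborel (?F x)" for x
    using int by (intro integrable_scaleR_right Bochner_Integration.integrable_bound[OF int])
      (auto simp: norm_mult)
  \<comment> \<open>Absolute integrability is clear because the modulus is the product of a density
    in \<open>x\<close> and |f| in \<open>s\<close>.\<close>
  have F: "integrable (lborel \<Otimes>\<^sub>M lborel) (case_prod ?F)"
  proof (rule lborel_pair.Fubini_integrable)
    have "(\<lambda>x. LINT s|lborel. norm (case (x, s) of (x, s) \<Rightarrow> ?F x s)) = (\<lambda>x. ?n x * (LINT s|lborel. norm (f s)))"
      by (simp add: norm_mult)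
    then show "integrable lborel (\<lambda>x. LINT s|lborel. norm (case (x, s) of (x, s) \<Rightarrow> ?F x s))"
      using ni by simp
  qed (use inner in auto)
  have gF: "?g s *\<^sub>R f s = (1 / (\<sigma> * sqrt (2 * pi))) *\<^sub>R (LINT x|lborel. ?F x s)" for s
  proof -
    have "(LINT x|lborel. ?F x s) = (LINT x|lborel. ?n x *\<^sub>R iexp ((s - t) / \<sigma> * x)) * f s"
      by (subst integral_mult_left_zero[symmetric]) (simp add: mult_ac)
    also have "\<dots> = of_real (exp (- (((s - t) / \<sigma>)\<^sup>2) / 2)) * f s"
      unfolding exp_minus_half_sq_eq_integral ..
    finally show ?thesis
      using \<sigma> by (simp add: normal_density_def scaleR_conv_of_real real_sqrt_mult power_divide mult_ac)
  qed
  \<comment> \<open>In the other order the inner integral is the Fourier transform of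
    \<open>f\<close> at x / \<sigma>, up to a phase and the density.\<close>
  have FF: "(LINT s|lborel. ?F x s) = (?n x *\<^sub>R iexp (- (t / \<sigma> * x))) * (LINT s|lborel. iexp (x / \<sigma> * s) * f s)" for x
  proof -
    have *: "?F x s = (?n x *\<^sub>R iexp (- (t / \<sigma> * x))) * (iexp (x / \<sigma> * s) * f s)" for s
    proof -
      have "iexp ((s - t) / \<sigma> * x) = iexp (- (t / \<sigma> * x)) * iexp (x / \<sigma> * s)"
        unfolding exp_add[symmetric] using \<sigma> by (simp add: field_simps)
      then show ?thesis by (simp add: mult_ac)
    qed
    show ?thesis unfolding * by (rule integral_mult_right_zero)
  qed
  have gi: "integrable lborel (\<lambda>s. ?g s *\<^sub>R f s)"
  proof -
    have "integrable lborel (\<lambda>s. LINT x|lborel. ?F x s)"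
      using lborel_pair.integrable_snd[OF F] by simp
    then show ?thesis unfolding gF by (rule integrable_scaleR_right)
  qed
  have "(LINT s|lborel. ?g s *\<^sub>R f s) = (1 / (\<sigma> * sqrt (2 * pi))) *\<^sub>R (LINT s|lborel. LINT x|lborel. ?F x s)"
    unfolding gF by simp
  also have "(LINT s|lborel. LINT x|lborel. ?F x s) = (LINT x|lborel. LINT s|lborel. ?F x s)"
    by (rule lborel_pair.Fubini_integral[OF F])
  finally have I: "(LINT s|lborel. ?g s *\<^sub>R f s) = (1 / (\<sigma> * sqrt (2 * pi))) *\<^sub>R (LINT x|lborel. LINT s|lborel. ?F x s)" .
  have "norm (LINT x|lborel. LINT s|lborel. ?F x s) \<le> (LINT x|lborel. ?n x * \<eta>)"
  proof (rule Bochner_Integration.integral_norm_bound_integral)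
    show "integrable lborel (\<lambda>x. LINT s|lborel. ?F x s)"
      using lborel_pair.integrable_fst[OF F] by simp
    show "norm (LINT s|lborel. ?F x s) \<le> ?n x * \<eta>" for x
      unfolding FF norm_mult norm_scaleR using small[of "x / \<sigma>"] by (simp add: mult_left_mono)
  qed (use ni in simp)
  also have "\<dots> = \<eta>" by simp
  finally have "norm (LINT s|lborel. ?g s *\<^sub>R f s) \<le> (1 / (\<sigma> * sqrt (2 * pi))) * \<eta>"
    unfolding I norm_scaleR using \<sigma> by (simp add: divide_right_mono)
  also have "\<dots> \<le> \<eta> / \<sigma>"
  proof -
    have "sqrt (2 * pi) \<ge> 1" using pi_gt3 by simp
    then have "\<sigma> * 1 \<le> \<sigma> * sqrt (2 * pi)" using \<sigma> by (intro mult_left_mono) auto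
    then show ?thesis using \<eta> \<sigma> by (simp add: divide_left_mono)
  qed
  finally have A: "norm (LINT s|lborel. ?g s *\<^sub>R f s) \<le> \<eta> / \<sigma>" .
  have gn: "integrable lborel ?g" "(LINT s|lborel. ?g s) = 1" using \<sigma> by simp_all
  \<comment> \<open>The first absolute central moment is \<sigma> sqrt(2 / \<pi>), which is at most
    \<sigma>.\<close>
  have m: "has_bochner_integral lborel (\<lambda>s. ?g s * \<bar>s - t\<bar> ^ (2 * 0 + 1)) (2 ^ 0 * \<sigma> ^ (2 * 0 + 1) * fact 0 * sqrt (2 / pi))"
    by (rule normal_moment_abs_odd[OF \<sigma>])
  then have mi: "integrable lborel (\<lambda>s. ?g s * \<bar>s - t\<bar>)" "(LINT s|lborel. ?g s * \<bar>s - t\<bar>) = \<sigma> * sqrt (2 / pi)"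
    by (auto simp: has_bochner_integral_iff)
  have "norm (LINT s|lborel. ?g s *\<^sub>R (f t - f s)) \<le> (LINT s|lborel. L * (?g s * \<bar>s - t\<bar>))"
  proof (rule Bochner_Integration.integral_norm_bound_integral)
    show "integrable lborel (\<lambda>s. ?g s *\<^sub>R (f t - f s))"
      unfolding scaleR_diff_right using gn gi by (intro Bochner_Integration.integrable_diff) auto
    show "integrable lborel (\<lambda>s. L * (?g s * \<bar>s - t\<bar>))" using mi by simp
    show "norm (?g s *\<^sub>R (f t - f s)) \<le> L * (?g s * \<bar>s - t\<bar>)" for s
      using mult_left_mono[OF lip[of t s], of "?g s"] by (simp add: abs_minus_commute mult_ac)
  qed
  also have "\<dots> = L * (\<sigma> * sqrt (2 / pi))" using mi by simp
  also have "\<dots> \<le> L * (\<sigma> * 1)"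
    using L \<sigma> pi_gt3 by (intro mult_left_mono) auto
  finally have B: "norm (LINT s|lborel. ?g s *\<^sub>R (f t - f s)) \<le> L * \<sigma>" by simp
  have "(LINT s|lborel. ?g s *\<^sub>R (f t - f s)) = (LINT s|lborel. ?g s *\<^sub>R f t) - (LINT s|lborel. ?g s *\<^sub>R f s)"
    unfolding scaleR_diff_right using gn gi by (intro Bochner_Integration.integral_diff) auto
  also have "(LINT s|lborel. ?g s *\<^sub>R f t) = f t" using gn by simp
  finally have "f t = (LINT s|lborel. ?g s *\<^sub>R (f t - f s)) + (LINT s|lborel. ?g s *\<^sub>R f s)" by simp
  then have "norm (f t) \<le> norm (LINT s|lborel. ?g s *\<^sub>R (f t - f s)) + norm (LINT s|lborel. ?g s *\<^sub>R f s)"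
    using norm_triangle_ineq by metis
  then show ?thesis using A B by linarith
qed

section \<open>The time evolution in coordinates\<close>

text \<open>The evolution from site \<open>a\<close> enters only through its coordinates. The crude
  bound \<open>light_cone\<close> stands in for decay at infinity: it makes the currents far away
  negligible and yields the ballistic bound.\<close>

locale schroedinger_flow =
  fixes v :: "int \<Rightarrow> real" and V :: real and a :: int and c :: "real \<Rightarrow> int \<Rightarrow> complex"
  assumes v_le: "\<bar>v k\<bar> \<le> V"
    and flow: "((\<lambda>t. c t k) has_vector_derivative
        - \<i> * (c t (k + 1) + c t (k - 1) + of_real (v k) * c t k)) (at t)"
    and init: "c 0 k = of_bool (k = a)"
    and light_cone: "norm (c t k) \<le> exp (2 * (2 + V) * \<bar>t\<bar>) / 2 ^ nat \<bar>k - a\<bar>"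
begin

lemma V_nonneg: "V \<ge> 0" using v_le[of 0] by linarith

lemma continuous_flow: "continuous_on UNIV (\<lambda>t. c t k)"
  by (intro continuous_at_imp_continuous_on ballI has_vector_derivative_continuous[OF flow])

definition mass :: "nat \<Rightarrow> real \<Rightarrow> real" where
  "mass M t = (\<Sum>k\<in>{a - int M..a + int M}. (norm (c t k))\<^sup>2)"

lemma mass_Suc: "mass (Suc M) t = mass M t + (norm (c t (a + int M + 1)))\<^sup>2 + (norm (c t (a - int M - 1)))\<^sup>2"
proof -
  have "{a - int (Suc M)..a + int (Suc M)} = insert (a + int M + 1) (insert (a - int M - 1) {a - int M..a + int M})"
    by auto
  then show ?thesis unfolding mass_def by simp
qed

lemma mass_mono: "M \<le> M' \<Longrightarrow> mass M t \<le> mass M' t"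
  unfolding mass_def by (intro sum_mono2) auto

text \<open>The rate at which probability flows from site k + 1 to site k.\<close>

definition current :: "real \<Rightarrow> int \<Rightarrow> real" where
  "current t k = 2 * Im (cnj (c t k) * c t (k + 1))"

text \<open>The continuity equation; the potential is real and drops out.\<close>

lemma norm_sq_derivative:
  "((\<lambda>t. (norm (c t k))\<^sup>2) has_vector_derivative (current t k - current t (k - 1))) (at t)"
proof -
  have "((\<lambda>t. c t k \<bullet> c t k) has_vector_derivative
      (c t k \<bullet> (- \<i> * (c t (k + 1) + c t (k - 1) + of_real (v k) * c t k))
      + (- \<i> * (c t (k + 1) + c t (k - 1) + of_real (v k) * c t k)) \<bullet> c t k)) (at t)"
    by (intro bounded_bilinear.has_vector_derivative[OF bounded_bilinear_inner] flow)
  then show ?thesis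
    unfolding power2_norm_eq_inner
    by (rule has_vector_derivative_eq_rhs) (simp add: current_def inner_complex_def algebra_simps)
qed

lemma mass_derivative:
  "(mass M has_vector_derivative (current t (a + int M) - current t (a - int M - 1))) (at t)"
proof (induction M)
  case 0
  have "mass 0 = (\<lambda>t. (norm (c t a))\<^sup>2)" by (simp add: mass_def fun_eq_iff)
  then show ?case using norm_sq_derivative[of a t] by simp
next
  case (Suc M)
  have "mass (Suc M) = (\<lambda>t. mass M t + (norm (c t (a + int M + 1)))\<^sup>2 + (norm (c t (a - int M - 1)))\<^sup>2)"
    by (intro ext mass_Suc)
  then show ?case
    using has_vector_derivative_add[OF has_vector_derivative_add[OF Suc
        norm_sq_derivative[of "a + int M + 1" t]] norm_sq_derivative[of "a - int M - 1" t]]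
    by (simp add: algebra_simps)
qed

lemma norm_le_exp: "norm (c t k) \<le> exp (2 * (2 + V) * \<bar>t\<bar>)"
  by (rule order_trans[OF light_cone]) (simp add: divide_le_eq)

lemma current_le:
  assumes "nat \<bar>k - a\<bar> \<ge> M"
  shows "\<bar>current t k\<bar> \<le> 2 * (exp (2 * (2 + V) * \<bar>t\<bar>))\<^sup>2 / 2 ^ M"
proof -
  let ?e = "exp (2 * (2 + V) * \<bar>t\<bar>)"
  have "\<bar>current t k\<bar> \<le> 2 * norm (cnj (c t k) * c t (k + 1))"
    unfolding current_def using abs_Im_le_cmod[of "cnj (c t k) * c t (k + 1)"] by simp
  also have "\<dots> \<le> 2 * ((?e / 2 ^ M) * ?e)"
  proof -
    have "?e / 2 ^ nat \<bar>k - a\<bar> \<le> ?e / 2 ^ M"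
      using assms by (intro divide_left_mono power_increasing) auto
    then have "norm (c t k) \<le> ?e / 2 ^ M" using light_cone order_trans by blast
    then show ?thesis unfolding norm_mult complex_mod_cnj
      by (intro mult_left_mono mult_mono norm_le_exp) auto
  qed
  finally show ?thesis by (simp add: power2_eq_square)
qed

text \<open>Conservation of the norm: the mass of a window is 1 at time 0 and changes only by the
  currents through its two ends, which for fixed time are exponentially small in the width by the
  light cone.\<close>

lemma mass_tendsto: "(\<lambda>M. mass M t) \<longlonglongrightarrow> 1" if "t \<ge> 0"
proof -
  let ?C = "4 * (exp (2 * (2 + V) * t))\<^sup>2"
  have *: "\<bar>mass M t - 1\<bar> \<le> t * ?C * (1 / 2) ^ M" for M
  proof -
    have m0: "mass M 0 = 1"
      unfolding mass_def init by (simp add: of_bool_def if_distrib[of norm] if_distrib[of "\<lambda>x. x\<^sup>2"] cong: if_cong)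
    have "norm (mass M t - mass M 0) \<le> (?C / 2 ^ M) * norm (t - 0)"
    proof (rule differentiable_bound[OF convex_real_interval(5)[of 0 t]])
      show "(mass M has_derivative (\<lambda>h. h *\<^sub>R (current x (a + int M) - current x (a - int M - 1)))) (at x within {0..t})" for x
        using has_vector_derivative_at_within[OF mass_derivative, of M x "{0..t}"]
        unfolding has_vector_derivative_def .
      show "onorm (\<lambda>h. h *\<^sub>R (current x (a + int M) - current x (a - int M - 1))) \<le> ?C / 2 ^ M"
        if "x \<in> {0..t}" for x
      proof -
        have "\<bar>current x (a + int M) - current x (a - int M - 1)\<bar> \<le> 4 * (exp (2 * (2 + V) * \<bar>x\<bar>))\<^sup>2 / 2 ^ M"
        proof -
          have "\<bar>current x (a + int M)\<bar> \<le> 2 * (exp (2 * (2 + V) * \<bar>x\<bar>))\<^sup>2 / 2 ^ M"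
            by (rule current_le) linarith
          moreover have "\<bar>current x (a - int M - 1)\<bar> \<le> 2 * (exp (2 * (2 + V) * \<bar>x\<bar>))\<^sup>2 / 2 ^ M"
            by (rule current_le) linarith
          ultimately show ?thesis by simp
        qed
        also have "\<dots> \<le> ?C / 2 ^ M"
          using that V_nonneg by (intro divide_right_mono mult_left_mono power_mono) (auto intro!: mult_left_mono)
        finally have D: "\<bar>current x (a + int M) - current x (a - int M - 1)\<bar> \<le> ?C / 2 ^ M" .
        show ?thesis
        proof (rule onorm_bound)
          show "norm (h *\<^sub>R (current x (a + int M) - current x (a - int M - 1))) \<le> ?C / 2 ^ M * norm h" for h
            using mult_right_mono[OF D norm_ge_zero[of h]] unfolding norm_scaleR real_norm_def abs_mult real_scaleR_def
            by (simp only: mult.commute)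
        qed simp
      qed
    qed (use \<open>t \<ge> 0\<close> in auto)
    then show ?thesis using m0 that by (simp add: power_divide mult_ac)
  qed
  have "(\<lambda>M. t * ?C * (1 / 2) ^ M) \<longlonglongrightarrow> 0"
    by (intro tendsto_mult_right_zero LIMSEQ_realpow_zero) auto
  then have "(\<lambda>M. mass M t - 1) \<longlonglongrightarrow> 0"
    by (rule Lim_null_comparison[rotated]) (simp only: real_norm_def * eventually_True)
  then show ?thesis by (simp add: LIM_zero_iff)
qed

lemma mass_le_1: "t \<ge> 0 \<Longrightarrow> mass M t \<le> 1"
  by (rule tendsto_lowerbound[OF mass_tendsto eventually_mono[OF eventually_ge_at_top[of M]]])
    (auto intro: mass_mono)

lemma sum_norm_sq_le_1:
  assumes "t \<ge> 0" "finite F" shows "(\<Sum>k\<in>F. (norm (c t k))\<^sup>2) \<le> 1"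
proof -
  define M where "M = nat (\<Sum>k\<in>F. \<bar>k - a\<bar>)"
  have "F \<subseteq> {a - int M..a + int M}"
  proof
    fix k assume "k \<in> F"
    then have "\<bar>k - a\<bar> \<le> int M"
      unfolding M_def using member_le_sum[of k F "\<lambda>k. \<bar>k - a\<bar>"] assms(2) by simp
    then show "k \<in> {a - int M..a + int M}" by auto
  qed
  then have "(\<Sum>k\<in>F. (norm (c t k))\<^sup>2) \<le> mass M t"
    unfolding mass_def by (intro sum_mono2) auto
  then show ?thesis using mass_le_1[OF assms(1), of M] by linarith
qed

lemma norm_le_1: "t \<ge> 0 \<Longrightarrow> norm (c t k) \<le> 1"
  using sum_norm_sq_le_1[of t "{k}"] by (simp add: abs_square_le_1)

end

section \<open>The Green function as Laplace transform of the amplitudes\<close>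

context schroedinger_flow
begin

lemma measurable_flow [measurable]: "(\<lambda>t. c t k) \<in> borel_measurable borel"
  by (intro borel_measurable_continuous_onI continuous_flow)

lemma norm_flow_derivative_le:
  assumes "t \<ge> 0"
  shows "norm (- \<i> * (c t (k + 1) + c t (k - 1) + of_real (v k) * c t k)) \<le> 2 + V"
proof -
  have "norm (of_real (v k) * c t k) \<le> V * 1"
    unfolding norm_mult norm_of_real using v_le norm_le_1[OF assms] V_nonneg by (intro mult_mono) auto
  then have "norm (c t (k + 1) + c t (k - 1) + of_real (v k) * c t k) \<le> 1 + 1 + V * 1"
    by (intro norm_triangle_mono norm_le_1 assms)
  then show ?thesis by (simp add: norm_mult)
qed

text \<open>The spectral parameter is \<open>z = \<i> * s\<close>.\<close>

definition green :: "complex \<Rightarrow> int \<Rightarrow> complex" where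
  "green s k = (LINT t:{0..}|lborel. exp (- (s * of_real t)) * c t k)"

lemma norm_green_le: "Re s > 0 \<Longrightarrow> norm (green s k) \<le> 1 / Re s"
  unfolding green_def
proof (rule norm_set_integral_exp_decay)
  show "norm (exp (- (s * of_real t)) * c t k) \<le> 1 * exp (- (Re s * t))" if "t \<ge> 0" for t
    using norm_le_1[OF that, of k] by (simp add: norm_exp_minus_mult)
qed simp_all

lemma set_integrable_green: "Re s > 0 \<Longrightarrow> set_integrable lborel {0..} (\<lambda>t. exp (- (s * of_real t)) * c t k)"
proof (rule set_integrable_exp_decay_mult)
  show "norm (exp (- (s * of_real t)) * c t k) \<le> 1 * exp (- (Re s * t))" if "t \<ge> 0" for t
    using norm_le_1[OF that, of k] by (simp add: norm_exp_minus_mult)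
qed simp_all

text \<open>This is the Laplace transform of the differential equation. The initial value is its
  only source term, and it vanishes off the site \<open>a\<close>.\<close>

lemma green_equation:
  assumes s: "Re s > 0" and k: "k \<noteq> a"
  shows "green s (k + 1) + green s (k - 1) = (\<i> * s - of_real (v k)) * green s k"
proof -
  let ?e = "\<lambda>t::real. exp (- (s * of_real t))"
  have "(LINT t:{0..}|lborel. ?e t * (- \<i> * (c t (k + 1) + c t (k - 1) + of_real (v k) * c t k)))
      = s * (LINT t:{0..}|lborel. ?e t * c t k) - c 0 k"
    by (rule laplace_derivative[OF s flow _ norm_le_1 norm_flow_derivative_le])
      (intro continuous_intros continuous_flow)
  also have "(\<lambda>t. ?e t * (- \<i> * (c t (k + 1) + c t (k - 1) + of_real (v k) * c t k)))
      = (\<lambda>t. - \<i> * (?e t * c t (k + 1) + ?e t * c t (k - 1) + of_real (v k) * (?e t * c t k)))"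
    by (simp add: algebra_simps)
  also have "(LINT t:{0..}|lborel. - \<i> * (?e t * c t (k + 1) + ?e t * c t (k - 1) + of_real (v k) * (?e t * c t k)))
      = - \<i> * (green s (k + 1) + green s (k - 1) + of_real (v k) * green s k)"
    using set_integrable_green[OF s]
    by (simp only: set_integral_mult_right set_integral_add set_integrable_mult_right green_def)
  finally have *: "- \<i> * (green s (k + 1) + green s (k - 1) + of_real (v k) * green s k) = s * green s k"
    using k by (simp add: green_def init)
  have "x = \<i> * (- \<i> * x)" for x by simp
  from this[of "green s (k + 1) + green s (k - 1) + of_real (v k) * green s k"]
  have "green s (k + 1) + green s (k - 1) + of_real (v k) * green s k = \<i> * (s * green s k)"
    unfolding * .
  then show ?thesis by (simp add: algebra_simps eq_diff_eq)
qed

text \<open>Extending the amplitude by 0 to negative times creates no jump, because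
  \<open>c 0 k = 0\<close> for \<open>k \<noteq> a\<close>; so the derivative bound on the half-line
  gives a Lipschitz constant on the whole line.\<close>

lemma damped_flow_lipschitz:
  assumes e: "e > 0" and k: "k \<noteq> a"
  defines "f \<equiv> \<lambda>t. if t \<ge> 0 then exp (- (e * t)) *\<^sub>R c t k else 0"
  shows "norm (f s - f t) \<le> (e + 2 + V) * \<bar>s - t\<bar>"
proof -
  have pos: "norm (f s - f t) \<le> (e + 2 + V) * norm (s - t)" if "s \<ge> 0" "t \<ge> 0" for s t
  proof -
    let ?h = "\<lambda>t. exp (- (e * t)) *\<^sub>R c t k"
    let ?h' = "\<lambda>t. exp (- (e * t)) *\<^sub>R (- \<i> * (c t (k + 1) + c t (k - 1) + of_real (v k) * c t k)) + (- e * exp (- (e * t))) *\<^sub>R c t k"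
    have "norm (?h s - ?h t) \<le> (e + 2 + V) * norm (s - t)"
    proof (rule differentiable_bound[of "{0..}"])
      fix x :: real assume x: "x \<in> {0..}"
      have "((\<lambda>t. exp (- (e * t))) has_real_derivative (- e * exp (- (e * x)))) (at x)"
        by (auto intro!: derivative_eq_intros)
      then have "(?h has_vector_derivative ?h' x) (at x)"
        by (rule has_vector_derivative_scaleR[OF _ flow])
      then show "(?h has_derivative (\<lambda>y. y *\<^sub>R ?h' x)) (at x within {0..})"
        using has_vector_derivative_at_within unfolding has_vector_derivative_def by blast
      have "norm (?h' x) \<le> exp (- (e * x)) * (2 + V) + (e * exp (- (e * x))) * 1"
      proof (rule norm_triangle_mono)
        show "norm (exp (- (e * x)) *\<^sub>R (- \<i> * (c x (k + 1) + c x (k - 1) + of_real (v k) * c x k))) \<le> exp (- (e * x)) * (2 + V)"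
          using x norm_flow_derivative_le[of x k] unfolding norm_scaleR by (intro mult_mono) auto
        show "norm ((- e * exp (- (e * x))) *\<^sub>R c x k) \<le> (e * exp (- (e * x))) * 1"
          using x e norm_le_1[of x k] unfolding norm_scaleR by (intro mult_mono) (auto simp: abs_mult)
      qed
      also have "\<dots> = exp (- (e * x)) * (e + 2 + V)" by (simp add: algebra_simps)
      also have "\<dots> \<le> 1 * (e + 2 + V)"
        using x e V_nonneg by (intro mult_right_mono) auto
      finally have h': "norm (?h' x) \<le> e + 2 + V" by simp
      show "onorm (\<lambda>y. y *\<^sub>R ?h' x) \<le> e + 2 + V"
      proof (rule onorm_bound)
        show "norm (y *\<^sub>R ?h' x) \<le> (e + 2 + V) * norm y" for y
          using mult_left_mono[OF h' norm_ge_zero[of y]] unfolding norm_scaleR real_norm_def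
          by (simp only: mult.commute)
      qed (use e V_nonneg in simp)
    qed (use that in auto)
    then show ?thesis using that by (simp add: f_def)
  qed
  have f0: "f 0 = 0" using k by (simp add: f_def init)
  have K: "e + 2 + V \<ge> 0" using e V_nonneg by simp
  have one: "norm (f s - f t) \<le> (e + 2 + V) * \<bar>s - t\<bar>" if "s \<ge> 0" "t < 0" for s t
  proof -
    have "norm (f s - f t) = norm (f s - f 0)" using that f0 by (simp add: f_def)
    also have "\<dots> \<le> (e + 2 + V) * \<bar>s\<bar>" using pos[of s 0] that by simp
    also have "\<dots> \<le> (e + 2 + V) * \<bar>s - t\<bar>" using that K by (intro mult_left_mono) auto
    finally show ?thesis .
  qed
  consider "s \<ge> 0" "t \<ge> 0" | "s \<ge> 0" "t < 0" | "s < 0" "t \<ge> 0" | "s < 0" "t < 0" by linarith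
  then show ?thesis
  proof cases
    case 1 then show ?thesis using pos by simp
  next
    case 2 then show ?thesis using one by simp
  next
    case 3 then show ?thesis using one[of t s] by (simp add: norm_minus_commute abs_minus_commute)
  next
    case 4 then show ?thesis using K by (simp add: f_def)
  qed
qed

text \<open>The Fourier transform at \<open>x\<close> of the damped amplitude is the Green function
  at s = e - i x, that is, at spectral parameter x + i e; so \<open>x\<close> is the energy and
  \<open>e\<close> the distance to the real axis.\<close>

lemma flow_le_of_green_le:
  assumes e: "e > 0" and k: "k \<noteq> a" and t: "t \<ge> 0" and \<sigma>: "\<sigma> > 0"
    and small: "\<And>x. norm (green (of_real e - \<i> * of_real x) k) \<le> \<eta>"
  shows "exp (- (e * t)) * norm (c t k) \<le> \<eta> / \<sigma> + (e + 2 + V) * \<sigma>"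
proof -
  define f where "f t = (if t \<ge> 0 then exp (- (e * t)) *\<^sub>R c t k else 0)" for t
  have f: "f t = indicator {0..} t *\<^sub>R (exp (- (of_real e * of_real t)) * c t k)" for t
    using exp_of_real[of "- (e * t)", where 'a = complex] by (auto simp: f_def scaleR_conv_of_real)
  have "norm (f t) \<le> \<eta> / \<sigma> + (e + 2 + V) * \<sigma>"
  proof (rule norm_le_of_small_fourier[OF _ _ _ \<sigma>])
    show "integrable lborel f"
      using set_integrable_green[of "of_real e" k] e unfolding set_integrable_def f by simp
    show "norm (f s - f t) \<le> (e + 2 + V) * \<bar>s - t\<bar>" for s t
      unfolding f_def by (rule damped_flow_lipschitz[OF e k])
    show "norm (LINT s|lborel. iexp (x * s) * f s) \<le> \<eta>" for x
    proof -
      have "iexp (x * s) * f s = indicator {0..} s *\<^sub>R (exp (- ((of_real e - \<i> * of_real x) * of_real s)) * c s k)" for s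
      proof -
        have "exp (- ((of_real e - \<i> * of_real x) * of_real s)) = iexp (x * s) * exp (- (of_real e * of_real s))"
          unfolding exp_add[symmetric] by (simp add: algebra_simps)
        then show ?thesis unfolding f by simp
      qed
      then show ?thesis using small[of x] unfolding green_def set_lebesgue_integral_def by simp
    qed
  qed
  then show ?thesis using t by (simp add: f_def)
qed

end

section \<open>Exponentially weighted time averages\<close>

definition time_avg :: "real \<Rightarrow> (real \<Rightarrow> real) \<Rightarrow> real" where
  "time_avg T f = 2 / T * (LINT t:{0..}|lborel. exp (- 2 * t / T) * f t)"

lemma time_avg_integrable:
  fixes f :: "real \<Rightarrow> real"
  assumes "T > 0" "f \<in> borel_measurable borel" "\<And>t. t \<ge> 0 \<Longrightarrow> \<bar>f t\<bar> \<le> B"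
  shows "set_integrable lborel {0..} (\<lambda>t. exp (- 2 * t / T) * f t)"
proof (rule set_integrable_exp_decay_mult)
  show "2 / T > 0" using assms by simp
  show "norm (exp (- 2 * t / T) * f t) \<le> B * exp (- (2 / T * t))" if "t \<ge> 0" for t
    using assms(3)[OF that] by (simp add: abs_mult mult.commute mult_left_mono)
qed (use assms(2) in measurable)

lemma time_avg_const:
  assumes "T > 0" shows "time_avg T (\<lambda>_. C) = C"
proof -
  have "(LINT t:{0..}|lborel. exp (- 2 * t / T)) = T / 2"
    using exp_decay_integral(2)[of "2 / T"] assms by simp
  then have "2 / T * ((LINT t:{0..}|lborel. exp (- 2 * t / T)) * C) = C" using assms by (simp only:) simp
  then show ?thesis unfolding time_avg_def set_integral_mult_left .
qed

lemma time_avg_add: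
  assumes "T > 0" "f \<in> borel_measurable borel" "\<And>t. t \<ge> 0 \<Longrightarrow> \<bar>f t\<bar> \<le> B"
    "g \<in> borel_measurable borel" "\<And>t. t \<ge> 0 \<Longrightarrow> \<bar>g t\<bar> \<le> B'"
  shows "time_avg T (\<lambda>t. f t + g t) = time_avg T f + time_avg T g"
  using time_avg_integrable[OF assms(1,2,3)] time_avg_integrable[OF assms(1,4,5)]
  by (simp add: time_avg_def distrib_left set_integral_add)

lemma time_avg_cmult: "time_avg T (\<lambda>t. C * f t) = C * time_avg T f"
proof -
  have "(\<lambda>t. exp (- 2 * t / T) * (C * f t)) = (\<lambda>t. C * (exp (- 2 * t / T) * f t))" by (simp add: mult_ac)
  then show ?thesis by (simp add: time_avg_def)
qed

lemma time_avg_mono: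
  assumes "T > 0" "f \<in> borel_measurable borel" "\<And>t. t \<ge> 0 \<Longrightarrow> \<bar>f t\<bar> \<le> B"
    "g \<in> borel_measurable borel" "\<And>t. t \<ge> 0 \<Longrightarrow> \<bar>g t\<bar> \<le> B'"
    "\<And>t. t \<ge> 0 \<Longrightarrow> f t \<le> g t"
  shows "time_avg T f \<le> time_avg T g"
  unfolding time_avg_def using assms(1,6)
  by (intro mult_left_mono set_integral_mono time_avg_integrable[OF assms(1,2,3)]
      time_avg_integrable[OF assms(1,4,5)]) auto

lemma time_avg_nonneg:
  assumes "T > 0" "\<And>t. t \<ge> 0 \<Longrightarrow> f t \<ge> 0" shows "time_avg T f \<ge> 0"
  unfolding time_avg_def set_lebesgue_integral_def using assms
  by (intro mult_nonneg_nonneg integral_nonneg_AE AE_I2) (auto simp: indicator_def)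

section \<open>Averaged probabilities: normalization, ballistic bound, lower bound\<close>

context schroedinger_flow
begin

definition avg :: "int \<Rightarrow> real \<Rightarrow> real" where
  "avg k T = time_avg T (\<lambda>t. (norm (c t k))\<^sup>2)"

lemma norm_sq_le_1: "t \<ge> 0 \<Longrightarrow> \<bar>(norm (c t k))\<^sup>2\<bar> \<le> 1"
  using norm_le_1 by (simp add: abs_square_le_1)

lemma avg_nonneg: "T > 0 \<Longrightarrow> avg k T \<ge> 0"
  unfolding avg_def by (intro time_avg_nonneg) auto

lemma sum_avg:
  assumes "T > 0" "finite F"
  shows "(\<Sum>k\<in>F. avg k T) = time_avg T (\<lambda>t. \<Sum>k\<in>F. (norm (c t k))\<^sup>2)"
  using assms(2)
proof (induction F rule: finite_induct)
  case empty then show ?case by (simp add: time_avg_def)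
next
  case (insert x F)
  have "time_avg T (\<lambda>t. (norm (c t x))\<^sup>2 + (\<Sum>k\<in>F. (norm (c t k))\<^sup>2))
      = time_avg T (\<lambda>t. (norm (c t x))\<^sup>2) + time_avg T (\<lambda>t. \<Sum>k\<in>F. (norm (c t k))\<^sup>2)"
    using insert(1) sum_norm_sq_le_1
    by (intro time_avg_add[where B = 1 and B' = 1] norm_sq_le_1 assms(1)) (auto simp: sum_nonneg)
  then show ?case using insert by (simp add: avg_def)
qed

lemma sum_avg_le_1:
  assumes "T > 0" "finite F"
  shows "(\<Sum>k\<in>F. avg k T) \<le> 1"
proof -
  have "time_avg T (\<lambda>t. \<Sum>k\<in>F. (norm (c t k))\<^sup>2) \<le> time_avg T (\<lambda>_. 1)"
    using sum_norm_sq_le_1[OF _ assms(2)] assms(2)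
    by (intro time_avg_mono[where B = 1 and B' = 1] assms(1)) (auto simp: sum_nonneg)
  then show ?thesis using assms by (simp add: sum_avg time_avg_const)
qed

text \<open>Dominated convergence carries the conservation of mass over to the averages, so no
  averaged probability escapes to infinity.\<close>

lemma sum_avg_tendsto:
  assumes T: "T > 0"
  shows "(\<lambda>M. \<Sum>k\<in>{a - int M..a + int M}. avg k T) \<longlonglongrightarrow> 1"
proof -
  let ?w = "\<lambda>t. indicator {0..} t *\<^sub>R (exp (- 2 * t / T) * 1)"
  have "(\<lambda>M. LINT t|lborel. indicator {0..} t *\<^sub>R (exp (- 2 * t / T) * mass M t)) \<longlonglongrightarrow> (LINT t|lborel. ?w t)"
  proof (rule integral_dominated_convergence[where w = ?w])
    show "integrable lborel ?w"
      using time_avg_integrable[OF T, of "\<lambda>_. 1" 1] unfolding set_integrable_def by simp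
    show "AE t in lborel. (\<lambda>M. indicator {0..} t *\<^sub>R (exp (- 2 * t / T) * mass M t)) \<longlonglongrightarrow> ?w t"
    proof (rule AE_I2)
      fix t :: real
      show "(\<lambda>M. indicator {0..} t *\<^sub>R (exp (- 2 * t / T) * mass M t)) \<longlonglongrightarrow> ?w t"
      proof (cases "t \<ge> 0")
        case True
        then show ?thesis by (intro tendsto_scaleR tendsto_const tendsto_mult mass_tendsto)
      qed simp
    qed
    show "AE t in lborel. norm (indicator {0..} t *\<^sub>R (exp (- 2 * t / T) * mass M t)) \<le> ?w t" for M
    proof (rule AE_I2)
      fix t :: real
      have "0 \<le> mass M t" unfolding mass_def by (intro sum_nonneg) auto
      then show "norm (indicator {0..} t *\<^sub>R (exp (- 2 * t / T) * mass M t)) \<le> ?w t"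
        using mass_le_1[of t M] by (cases "t \<ge> 0") (auto simp: abs_mult)
    qed
  qed (auto simp: mass_def)
  then have "(\<lambda>M. time_avg T (mass M)) \<longlonglongrightarrow> time_avg T (\<lambda>_. 1)"
    unfolding time_avg_def set_lebesgue_integral_def by (intro tendsto_mult_left)
  moreover have "mass M = (\<lambda>t. \<Sum>k\<in>{a - int M..a + int M}. (norm (c t k))\<^sup>2)" for M
    by (simp add: fun_eq_iff mass_def)
  ultimately show ?thesis
    using T by (simp add: sum_avg time_avg_const)
qed

text \<open>Before a time proportional to the distance from the source the light cone makes the
  amplitude small; after it the weight is small.\<close>

lemma avg_ballistic:
  assumes T: "T \<ge> 1"
  shows "avg k T \<le> 3 * exp (- (ln 2 / (4 * (2 + V)) * \<bar>real_of_int (k - a)\<bar> / T))"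
proof -
  define d where "d = real (nat \<bar>k - a\<bar>)"
  \<comment> \<open>Chosen so that up to time \<kappa> d the growth factor of the light cone uses up
    only half of the decay 2^(-d).\<close>
  define \<kappa> where "\<kappa> = ln 2 / (4 * (2 + V))"
  define t0 where "t0 = \<kappa> * d"
  have d: "d = \<bar>real_of_int (k - a)\<bar>" "d \<ge> 0" unfolding d_def by auto
  have \<kappa>: "\<kappa> > 0" "\<kappa> \<le> ln 2 / 2" "2 * (2 + V) * \<kappa> = ln 2 / 2"
    unfolding \<kappa>_def using V_nonneg by (auto simp: field_simps)
  have A: "(norm (c t k))\<^sup>2 \<le> exp (- (ln 2 / 2 * d))" if "0 \<le> t" "t \<le> t0" for t
  proof -
    have "(norm (c t k))\<^sup>2 \<le> norm (c t k)"
      using norm_le_1[of t k] that by (simp add: power2_eq_square mult_left_le)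
    also have "\<dots> \<le> exp (2 * (2 + V) * t) / 2 ^ nat \<bar>k - a\<bar>"
      using light_cone[of t k] that by simp
    also have "(2::real) ^ nat \<bar>k - a\<bar> = exp (d * ln 2)"
      unfolding d_def exp_of_nat_mult by simp
    also have "exp (2 * (2 + V) * t) / exp (d * ln 2) = exp (2 * (2 + V) * t - d * ln 2)"
      by (simp add: exp_diff)
    also have "\<dots> \<le> exp (- (ln 2 / 2 * d))"
    proof -
      have "2 * (2 + V) * t \<le> 2 * (2 + V) * t0" using that V_nonneg by (intro mult_left_mono) auto
      also have "\<dots> = ln 2 / 2 * d" unfolding t0_def using \<kappa>(3) by (metis mult.assoc)
      finally show ?thesis by (simp add: algebra_simps)
    qed
    finally show ?thesis .
  qed
  have T0: "T > 0" using T by simp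
  have eA: "exp (- (ln 2 / 2 * d)) \<le> exp (- (\<kappa> * d / T))"
  proof -
    have "\<kappa> * d / T \<le> \<kappa> * d / 1" using \<kappa> d T by (intro divide_left_mono) auto
    also have "\<dots> \<le> ln 2 / 2 * d" using mult_right_mono[OF \<kappa>(2) d(2)] by simp
    finally show ?thesis by simp
  qed
  have P: "exp (- 2 * t / T) * (norm (c t k))\<^sup>2 \<le> exp (- (\<kappa> * d / T)) * exp (- 2 * t / T) + exp (- (\<kappa> * d / T)) * exp (- (1 / T * t))"
    if t: "t \<ge> 0" for t
  proof (cases "t \<le> t0")
    case True
    then have "(norm (c t k))\<^sup>2 \<le> exp (- (\<kappa> * d / T))" using A[OF t] eA by linarith
    then have "exp (- 2 * t / T) * (norm (c t k))\<^sup>2 \<le> exp (- 2 * t / T) * exp (- (\<kappa> * d / T))"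
      by (intro mult_left_mono) auto
    also have "\<dots> \<le> exp (- (\<kappa> * d / T)) * exp (- 2 * t / T) + exp (- (\<kappa> * d / T)) * exp (- (1 / T * t))" by simp
    finally show ?thesis .
  next
    case False
    have "exp (- 2 * t / T) * (norm (c t k))\<^sup>2 \<le> exp (- 2 * t / T) * 1"
      using norm_sq_le_1[OF t, of k] by (intro mult_left_mono) auto
    \<comment> \<open>One half of the weight gives the decay in the distance, the other half keeps
      the integral finite.\<close>
    also have "\<dots> = exp (- t / T) * exp (- t / T)" unfolding exp_add[symmetric] by (simp add: field_simps)
    also have "\<dots> \<le> exp (- (\<kappa> * d / T)) * exp (- t / T)"
      using False T0 unfolding t0_def by (intro mult_right_mono) (auto simp: divide_right_mono)
    also have "\<dots> \<le> exp (- (\<kappa> * d / T)) * exp (- 2 * t / T) + exp (- (\<kappa> * d / T)) * exp (- (1 / T * t))" by simp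
    finally show ?thesis .
  qed
  have i1: "set_integrable lborel {0..} (\<lambda>t. exp (- 2 * t / T))" "set_integrable lborel {0..} (\<lambda>t. exp (- (1 / T * t)))"
    using exp_decay_integral(1)[of "2 / T"] exp_decay_integral(1)[of "1 / T"] T0 by simp_all
  have "avg k T \<le> 2 / T * (LINT t:{0..}|lborel. exp (- (\<kappa> * d / T)) * exp (- 2 * t / T) + exp (- (\<kappa> * d / T)) * exp (- (1 / T * t)))"
    unfolding avg_def time_avg_def using T0 P i1
    by (intro mult_left_mono set_integral_mono set_integral_add set_integrable_mult_right
        time_avg_integrable[OF _ _ norm_sq_le_1]) auto
  \<comment> \<open>The two integrals are T / 2 and T; after multiplication by 2 / T they contribute
    1 and 2, hence the constant 3.\<close>
  also have "(LINT t:{0..}|lborel. exp (- (\<kappa> * d / T)) * exp (- 2 * t / T) + exp (- (\<kappa> * d / T)) * exp (- (1 / T * t)))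
     = exp (- (\<kappa> * d / T)) * (T / 2) + exp (- (\<kappa> * d / T)) * T"
    using i1 exp_decay_integral(2)[of "2 / T"] exp_decay_integral(2)[of "1 / T"] T0
    by (simp add: set_integral_add)
  also have "2 / T * (exp (- (\<kappa> * d / T)) * (T / 2) + exp (- (\<kappa> * d / T)) * T) = 3 * exp (- (\<kappa> * d / T))"
    using T0 by (simp add: field_simps)
  finally show ?thesis unfolding d \<kappa>_def .
qed

text \<open>The particle cannot sit at b = a - 1 most of the time. The derivative of
  \<open>c t a * cnj (c t b)\<close> is -i |c t b|^2 plus a remainder \<open>R\<close> in which
  every term contains \<open>c t a\<close> or \<open>c t (a + 1)\<close>. The average of the
  derivative is at most 2 / T in modulus because the product is bounded and starts at 0, so the
  average at b is at most that of |R| plus 2 / T.\<close>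

lemma neighbour_avg_le:
  assumes T: "T \<ge> 4"
  shows "avg (a - 1) T \<le> 3 / 4 + 2 * (2 * V + 2)\<^sup>2 * (avg a T + avg (a + 1) T)"
proof -
  define b where "b = a - 1"
  define \<Lambda> where "\<Lambda> = 2 * V + 2"
  have T0: "T > 0" using T by simp
  have \<Lambda>: "\<Lambda> \<ge> 2" using V_nonneg by (simp add: \<Lambda>_def)
  let ?c' = "\<lambda>t k. - \<i> * (c t (k + 1) + c t (k - 1) + of_real (v k) * c t k)"
  define X where "X t = c t a * cnj (c t b)" for t
  define X' where "X' t = c t a * cnj (?c' t b) + ?c' t a * cnj (c t b)" for t
  define R where "R t = X' t + \<i> * of_real ((norm (c t b))\<^sup>2)" for t
  have R: "R t = \<i> * (c t a * (cnj (c t a) + cnj (c t (b - 1)) + of_real (v b - v a) * cnj (c t b)) - c t (a + 1) * cnj (c t b))" for t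
    unfolding R_def X'_def complex_norm_square b_def by (simp add: algebra_simps)
  have bd: "norm (c t k) \<le> 1" if "t \<ge> 0" for t k using norm_le_1[OF that] .
  have Rle: "norm (R t) \<le> 1 / 4 + 2 * \<Lambda>\<^sup>2 * ((norm (c t a))\<^sup>2 + (norm (c t (a + 1)))\<^sup>2)" if t: "t \<ge> 0" for t
  proof -
    have "norm (of_real (v b - v a) * cnj (c t b)) \<le> (2 * V) * 1"
      unfolding norm_mult norm_of_real complex_mod_cnj
      using bd[OF t] v_le[of a] v_le[of b] V_nonneg by (intro mult_mono) auto
    then have "norm (cnj (c t a) + cnj (c t (b - 1)) + of_real (v b - v a) * cnj (c t b)) \<le> 1 + 1 + (2 * V) * 1"
      using bd[OF t] by (intro norm_triangle_mono) auto
    then have "norm (c t a * (cnj (c t a) + cnj (c t (b - 1)) + of_real (v b - v a) * cnj (c t b))) \<le> norm (c t a) * \<Lambda>"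
      unfolding norm_mult \<Lambda>_def by (intro mult_left_mono) auto
    moreover have "norm (c t (a + 1) * cnj (c t b)) \<le> norm (c t (a + 1)) * \<Lambda>"
      unfolding norm_mult complex_mod_cnj using bd[OF t, of b] \<Lambda> by (intro mult_left_mono) auto
    moreover have "norm (R t) \<le> norm (c t a * (cnj (c t a) + cnj (c t (b - 1)) + of_real (v b - v a) * cnj (c t b)))
        + norm (c t (a + 1) * cnj (c t b))"
      unfolding R norm_mult[of \<i>] norm_ii mult_1 by (rule norm_triangle_ineq4)
    ultimately have "norm (R t) \<le> norm (c t a) * \<Lambda> + norm (c t (a + 1)) * \<Lambda>" by linarith
    \<comment> \<open>Completing the square trades the linear term for the quadratic one that
      averages to a probability, at the cost of a small constant.\<close>
    also have "x * \<Lambda> \<le> 1 / 8 + 2 * \<Lambda>\<^sup>2 * x\<^sup>2" for x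
    proof -
      have "0 \<le> 2 * (\<Lambda> * x - 1 / 4)\<^sup>2" by simp
      then show ?thesis by (simp add: power2_eq_square algebra_simps)
    qed
    then have "norm (c t a) * \<Lambda> + norm (c t (a + 1)) * \<Lambda>
      \<le> (1 / 8 + 2 * \<Lambda>\<^sup>2 * (norm (c t a))\<^sup>2) + (1 / 8 + 2 * \<Lambda>\<^sup>2 * (norm (c t (a + 1)))\<^sup>2)"
      by (intro add_mono)
    finally show ?thesis by (simp add: algebra_simps)
  qed
  have r2: "\<bar>2 * \<Lambda>\<^sup>2 * ((norm (c t a))\<^sup>2 + (norm (c t (a + 1)))\<^sup>2)\<bar> \<le> 2 * \<Lambda>\<^sup>2 * (1 + 1)" if t: "t \<ge> 0" for t
  proof -
    have "2 * \<Lambda>\<^sup>2 * ((norm (c t a))\<^sup>2 + (norm (c t (a + 1)))\<^sup>2) \<le> 2 * \<Lambda>\<^sup>2 * (1 + 1)"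
      using norm_sq_le_1[OF t, of a] norm_sq_le_1[OF t, of "a + 1"] by (intro mult_left_mono add_mono) auto
    moreover have "0 \<le> 2 * \<Lambda>\<^sup>2 * ((norm (c t a))\<^sup>2 + (norm (c t (a + 1)))\<^sup>2)" by simp
    ultimately show ?thesis by linarith
  qed
  have r1: "\<bar>1 / 4 + 2 * \<Lambda>\<^sup>2 * ((norm (c t a))\<^sup>2 + (norm (c t (a + 1)))\<^sup>2)\<bar> \<le> 1 / 4 + 2 * \<Lambda>\<^sup>2 * (1 + 1)" if t: "t \<ge> 0" for t
    using r2[OF t] by linarith
  have Xd: "(X has_vector_derivative X' t) (at t)" for t
    unfolding X_def X'_def by (intro has_vector_derivative_mult has_vector_derivative_cnj flow)
  have [measurable]: "X \<in> borel_measurable borel"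
    by (intro borel_measurable_continuous_onI continuous_at_imp_continuous_on ballI
        has_vector_derivative_continuous[OF Xd])
  have Xb: "norm (X t) \<le> 1" if "t \<ge> 0" for t
    unfolding X_def norm_mult complex_mod_cnj using bd[OF that] by (simp add: mult_le_one)
  have Rb: "norm (R t) \<le> 1 / 4 + 2 * \<Lambda>\<^sup>2 * (1 + 1)" if t: "t \<ge> 0" for t
    using Rle[OF t] r2[OF t] by linarith
  have X'b: "norm (X' t) \<le> (1 / 4 + 2 * \<Lambda>\<^sup>2 * (1 + 1)) + 1" if t: "t \<ge> 0" for t
  proof -
    have "X' t = R t - \<i> * of_real ((norm (c t b))\<^sup>2)" by (simp add: R_def)
    moreover have "norm (\<i> * of_real ((norm (c t b))\<^sup>2)) \<le> 1"
      using norm_sq_le_1[OF t, of b] unfolding norm_mult norm_ii norm_of_real by simp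
    ultimately show ?thesis using norm_triangle_le_diff[OF add_mono[OF Rb[OF t]]] by metis
  qed
  have X'c: "continuous_on UNIV X'"
    unfolding X'_def by (intro continuous_intros continuous_flow)
  let ?e = "\<lambda>t. exp (- (of_real (2 / T) * of_real t)) :: complex"
  have s: "Re (of_real (2 / T)) > 0" using T by simp
  \<comment> \<open>The damping 2 / T cancels against the bound T / 2 of the transform of
    \<open>X\<close>, leaving 1.\<close>
  have "(LINT t:{0..}|lborel. ?e t * X' t) = of_real (2 / T) * (LINT t:{0..}|lborel. ?e t * X t) - X 0"
    by (rule laplace_derivative[OF s Xd X'c Xb X'b])
  moreover have "X 0 = 0" by (simp add: X_def init b_def)
  moreover have "norm (LINT t:{0..}|lborel. ?e t * X t) \<le> 1 / (2 / T)"
  proof (rule norm_set_integral_exp_decay)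
    show "norm (?e t * X t) \<le> 1 * exp (- (2 / T * t))" if "t \<ge> 0" for t
      using Xb[OF that] unfolding norm_exp_minus_mult by simp
  qed (use T in auto)
  ultimately have "norm (LINT t:{0..}|lborel. ?e t * X' t) \<le> (2 / T) * (1 / (2 / T))"
    using T0 by (simp only: norm_mult norm_of_real diff_zero) (intro mult_mono; simp)
  then have IX: "norm (LINT t:{0..}|lborel. ?e t * X' t) \<le> 1" using T0 by simp
  have eX': "set_integrable lborel {0..} (\<lambda>t. ?e t * X' t)"
  proof (rule set_integrable_exp_decay_mult)
    show "norm (?e t * X' t) \<le> ((1 / 4 + 2 * \<Lambda>\<^sup>2 * (1 + 1)) + 1) * exp (- (2 / T * t))" if "t \<ge> 0" for t
      using X'b[OF that] unfolding norm_exp_minus_mult by (simp add: mult.commute mult_left_mono)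
  qed (use T borel_measurable_continuous_onI[OF X'c] in auto)
  have [measurable]: "X' \<in> borel_measurable borel" by (rule borel_measurable_continuous_onI[OF X'c])
  have [measurable]: "R \<in> borel_measurable borel" unfolding R_def by measurable
  have eR: "set_integrable lborel {0..} (\<lambda>t. ?e t * R t)"
  proof (rule set_integrable_exp_decay_mult)
    show "norm (?e t * R t) \<le> (1 / 4 + 2 * \<Lambda>\<^sup>2 * (1 + 1)) * exp (- (2 / T * t))" if "t \<ge> 0" for t
      using Rb[OF that] unfolding norm_exp_minus_mult by (simp add: mult.commute mult_left_mono)
  qed (use T in auto)
  have er: "?e t = of_real (exp (- 2 * t / T))" for t
    using exp_of_real[of "- 2 * t / T", where 'a = complex] by simp
  have "of_real (LINT t:{0..}|lborel. exp (- 2 * t / T) * (norm (c t b))\<^sup>2)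
      = (LINT t:{0..}|lborel. complex_of_real (exp (- 2 * t / T) * (norm (c t b))\<^sup>2))"
    by (rule set_integral_complex_of_real[symmetric])
  also have "\<dots> = (LINT t:{0..}|lborel. - \<i> * (?e t * R t - ?e t * X' t))"
    unfolding er R_def by (simp add: algebra_simps)
  also have "\<dots> = - \<i> * ((LINT t:{0..}|lborel. ?e t * R t) - (LINT t:{0..}|lborel. ?e t * X' t))"
    using eR eX' by (simp only: set_integral_mult_right set_integral_diff)
  finally have I: "of_real (LINT t:{0..}|lborel. exp (- 2 * t / T) * (norm (c t b))\<^sup>2)
     = - \<i> * ((LINT t:{0..}|lborel. ?e t * R t) - (LINT t:{0..}|lborel. ?e t * X' t))" .
  have "\<bar>LINT t:{0..}|lborel. exp (- 2 * t / T) * (norm (c t b))\<^sup>2\<bar>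
     = norm (complex_of_real (LINT t:{0..}|lborel. exp (- 2 * t / T) * (norm (c t b))\<^sup>2))"
    by (rule norm_of_real[symmetric])
  also have "\<dots> = norm ((LINT t:{0..}|lborel. ?e t * R t) - (LINT t:{0..}|lborel. ?e t * X' t))"
    unfolding I norm_mult by simp
  also have "\<dots> \<le> (LINT t:{0..}|lborel. norm (?e t * R t)) + 1"
    by (rule norm_triangle_le_diff[OF add_mono[OF set_integral_norm_bound[OF eR] IX]])
  also have "(LINT t:{0..}|lborel. norm (?e t * R t)) = (LINT t:{0..}|lborel. exp (- 2 * t / T) * norm (R t))"
    unfolding norm_mult er by simp
  finally have "(LINT t:{0..}|lborel. exp (- 2 * t / T) * (norm (c t b))\<^sup>2)
      \<le> (LINT t:{0..}|lborel. exp (- 2 * t / T) * norm (R t)) + 1" by linarith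
  then have "avg b T \<le> 2 / T * ((LINT t:{0..}|lborel. exp (- 2 * t / T) * norm (R t)) + 1)"
    unfolding avg_def time_avg_def using T0 by (intro mult_left_mono) auto
  also have "\<dots> = time_avg T (\<lambda>t. norm (R t)) + 2 / T" by (simp add: time_avg_def algebra_simps)
  also have "time_avg T (\<lambda>t. norm (R t))
      \<le> time_avg T (\<lambda>t. 1 / 4 + 2 * \<Lambda>\<^sup>2 * ((norm (c t a))\<^sup>2 + (norm (c t (a + 1)))\<^sup>2))"
    by (rule time_avg_mono[OF T0 _ _ _ r1 Rle]) (use Rb in auto)
  also have "\<dots> = time_avg T (\<lambda>t. 1 / 4) + time_avg T (\<lambda>t. 2 * \<Lambda>\<^sup>2 * ((norm (c t a))\<^sup>2 + (norm (c t (a + 1)))\<^sup>2))"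
    by (rule time_avg_add[OF T0 _ _ _ r2, where B = 1]) auto
  also have "time_avg T (\<lambda>t. (norm (c t a))\<^sup>2 + (norm (c t (a + 1)))\<^sup>2) = avg a T + avg (a + 1) T"
    unfolding avg_def by (intro time_avg_add[OF T0 _ norm_sq_le_1 _ norm_sq_le_1]) auto
  then have "time_avg T (\<lambda>t. 1 / 4) + time_avg T (\<lambda>t. 2 * \<Lambda>\<^sup>2 * ((norm (c t a))\<^sup>2 + (norm (c t (a + 1)))\<^sup>2))
      = 1 / 4 + 2 * \<Lambda>\<^sup>2 * (avg a T + avg (a + 1) T)"
    unfolding time_avg_const[OF T0] time_avg_cmult by simp
  finally have "avg b T \<le> 1 / 4 + 2 * \<Lambda>\<^sup>2 * (avg a T + avg (a + 1) T) + 2 / T" by simp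
  \<comment> \<open>With 1/4 from the squares this leaves 3/4, which has to stay below the total
    mass 1.\<close>
  moreover have "2 / T \<le> 1 / 2" using T by (simp add: field_simps)
  ultimately show ?thesis unfolding b_def \<Lambda>_def by linarith
qed

text \<open>A large window carries more than 7/8. If S is the share off \<open>a - 1\<close>, the
  previous bound gives 7/8 < 3/4 + (1 + 2 (2 V + 2)^2) S, so S is bounded below uniformly in
  T.\<close>

lemma avg_off_neighbour_ge:
  assumes T: "T \<ge> 4"
  obtains F where "finite F" "a - 1 \<notin> F" "1 / (8 * (1 + 2 * (2 * V + 2)\<^sup>2)) \<le> (\<Sum>k\<in>F. avg k T)"
proof -
  have T0: "T > 0" using T by simp
  have "\<forall>\<^sub>F M in sequentially. (\<Sum>k\<in>{a - int M..a + int M}. avg k T) > 7 / 8"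
    by (rule order_tendstoD(1)[OF sum_avg_tendsto[OF T0]]) simp
  then have "\<forall>\<^sub>F M in sequentially. M \<ge> 1 \<and> (\<Sum>k\<in>{a - int M..a + int M}. avg k T) > 7 / 8"
    using eventually_ge_at_top[of 1] by eventually_elim auto
  then obtain M where M: "M \<ge> 1" "(\<Sum>k\<in>{a - int M..a + int M}. avg k T) > 7 / 8"
    using eventually_happens'[OF sequentially_bot] by blast
  let ?F = "{a - int M..a + int M} - {a - 1}"
  let ?S = "\<Sum>k\<in>?F. avg k T"
  have "(\<Sum>k\<in>{a - int M..a + int M}. avg k T) = avg (a - 1) T + ?S"
    using M by (intro sum.remove) auto
  moreover have "avg a T + avg (a + 1) T \<le> ?S"
  proof -
    have "(\<Sum>k\<in>{a, a + 1}. avg k T) \<le> ?S"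
      using M T0 by (intro sum_mono2) (auto intro: avg_nonneg)
    then show ?thesis by simp
  qed
  then have "2 * (2 * V + 2)\<^sup>2 * (avg a T + avg (a + 1) T) \<le> 2 * (2 * V + 2)\<^sup>2 * ?S"
    by (intro mult_left_mono) auto
  ultimately have "1 / 8 \<le> ?S * (1 + 2 * (2 * V + 2)\<^sup>2)"
    using neighbour_avg_le[OF T] M(2) by (simp only: distrib_left mult.commute[of ?S] mult_1 mult_1_right)
  moreover have "1 + 2 * (2 * V + 2)\<^sup>2 > 0" by (simp add: add_pos_nonneg)
  moreover have "1 / (8 * x) \<le> y" if "1 / 8 \<le> y * x" "x > 0" for x y :: real
    using that by (simp add: field_simps)
  ultimately have "1 / (8 * (1 + 2 * (2 * V + 2)\<^sup>2)) \<le> ?S" by blast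
  then show thesis using that[of ?F] by auto
qed

end

section \<open>Power series for the amplitudes of the almost Mathieu evolution\<close>

lemma bounded_linear_coord: "bounded_linear (\<lambda>f. coord f k)"
  by (rule bounded_linear_intro[where K = 1])
    (auto simp: plus_ell2Z.rep_eq scaleR_ell2Z.rep_eq cmod_coord_le_norm)

lemma coord_evolution_sums:
  assumes "bounded_linear A"
  shows "(\<lambda>j. coord ((A ^^ j) \<psi>) k / fact j * (- \<i> * complex_of_real t) ^ j) sums coord (evolution A t \<psi>) k"
proof -
  have "(\<lambda>j. coord (((- \<i> * complex_of_real t) ^ j / fact j) *\<^sub>c ((A ^^ j) \<psi>)) k) sums coord (evolution A t \<psi>) k"
    unfolding evolution_def
    by (intro bounded_linear.sums[OF bounded_linear_coord] summable_sums summable_evolution assms)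
  then show ?thesis by (simp add: cscale.rep_eq mult.commute)
qed

context
  fixes lam \<theta> \<omega> :: real and a :: int
begin

abbreviation (input) "pot k \<equiv> lam * cos (2 * pi * (of_int k * \<theta> + \<omega>))"

definition taylor_coord :: "nat \<Rightarrow> int \<Rightarrow> complex" where
  "taylor_coord j k = coord ((almost_mathieu lam \<theta> \<omega> ^^ j) (delta a)) k"

lemma taylor_coord_0: "taylor_coord 0 k = of_bool (k = a)"
  by (simp add: taylor_coord_def delta.rep_eq)

lemma taylor_coord_Suc:
  "taylor_coord (Suc j) k = taylor_coord j (k + 1) + taylor_coord j (k - 1) + of_real (pot k) * taylor_coord j k"
  by (simp add: taylor_coord_def almost_mathieu.rep_eq)

lemma abs_pot_le: "\<bar>pot k\<bar> \<le> \<bar>lam\<bar>"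
  by (simp add: abs_mult mult_left_le)

lemma norm_taylor_coord_le: "norm (taylor_coord j k) \<le> (2 + \<bar>lam\<bar>) ^ j"
proof (induction j arbitrary: k)
  case 0 then show ?case by (simp add: taylor_coord_0)
next
  case (Suc j)
  have "norm (of_real (pot k) * taylor_coord j k) \<le> \<bar>lam\<bar> * (2 + \<bar>lam\<bar>) ^ j"
    unfolding norm_mult norm_of_real by (intro mult_mono abs_pot_le Suc) auto
  then have "norm (taylor_coord (Suc j) k) \<le> (2 + \<bar>lam\<bar>) ^ j + (2 + \<bar>lam\<bar>) ^ j + \<bar>lam\<bar> * (2 + \<bar>lam\<bar>) ^ j"
    unfolding taylor_coord_Suc by (intro norm_triangle_mono Suc)
  then show ?case by (simp add: algebra_simps)
qed

text \<open>Each application of the operator reaches only the nearest neighbours.\<close>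

lemma taylor_coord_eq_0: "int j < \<bar>k - a\<bar> \<Longrightarrow> taylor_coord j k = 0"
proof (induction j arbitrary: k)
  case 0 then show ?case by (simp add: taylor_coord_0)
next
  case (Suc j)
  then show ?case unfolding taylor_coord_Suc by (subst Suc.IH, linarith)+ simp
qed

lemma summable_taylor_coord: "summable (\<lambda>j. taylor_coord j k / fact j * x ^ j)"
proof (rule summable_comparison_test)
  show "summable (\<lambda>j. inverse (fact j) * ((2 + \<bar>lam\<bar>) * norm x) ^ j)" by (rule summable_exp)
  have "norm (taylor_coord j k / fact j * x ^ j) \<le> inverse (fact j) * ((2 + \<bar>lam\<bar>) * norm x) ^ j" for j
    using mult_right_mono[OF norm_taylor_coord_le[of j k], of "norm x ^ j * inverse (fact j)"]
    by (simp add: norm_mult norm_inverse norm_power power_mult_distrib divide_inverse mult_ac)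
  then show "\<exists>N. \<forall>n\<ge>N. norm (taylor_coord n k / fact n * x ^ n) \<le> inverse (fact n) * ((2 + \<bar>lam\<bar>) * norm x) ^ n"
    by blast
qed

definition evolution_coord :: "real \<Rightarrow> int \<Rightarrow> complex" where
  "evolution_coord t k = coord (evolution (almost_mathieu lam \<theta> \<omega>) t (delta a)) k"

lemma evolution_coord_eq:
  "evolution_coord t k = (\<Sum>j. taylor_coord j k / fact j * (- \<i> * complex_of_real t) ^ j)"
  using sums_unique[OF coord_evolution_sums[OF bounded_linear_almost_mathieu]]
  by (simp add: evolution_coord_def taylor_coord_def)

text \<open>The coordinates are everywhere convergent power series in -i t, so termwise
  differentiation gives the equation. The light cone holds because the terms of order below the
  distance from the source vanish.\<close>

lemma schroedinger_flow_almost_mathieu: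
  "schroedinger_flow (\<lambda>k. pot k) \<bar>lam\<bar> a evolution_coord"
proof
  show "\<bar>pot k\<bar> \<le> \<bar>lam\<bar>" for k by (rule abs_pot_le)
  show "evolution_coord 0 k = of_bool (k = a)" for k
    using powser_zero[of "\<lambda>j. taylor_coord j k / fact j"]
    by (simp add: evolution_coord_eq taylor_coord_0 del: powser_zero)
next
  fix t k
  let ?G = "\<lambda>k x. \<Sum>j. taylor_coord j k / fact j * x ^ j"
  have "(?G k has_field_derivative (\<Sum>j. diffs (\<lambda>j. taylor_coord j k / fact j) j * x ^ j)) (at x)" for x
    by (rule termdiffs_strong_converges_everywhere) (rule summable_taylor_coord)
  also have "(\<Sum>j. diffs (\<lambda>j. taylor_coord j k / fact j) j * x ^ j) = ?G (k + 1) x + ?G (k - 1) x + of_real (pot k) * ?G k x" for x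
  proof -
    have "diffs (\<lambda>j. taylor_coord j k / fact j) j * x ^ j = taylor_coord j (k + 1) / fact j * x ^ j
        + taylor_coord j (k - 1) / fact j * x ^ j + of_real (pot k) * (taylor_coord j k / fact j * x ^ j)" for j
    proof -
      have "of_nat (Suc j) * (y / fact (Suc j)) = y / fact j" for y :: complex
        by (simp only: fact_Suc of_nat_mult) (simp del: of_nat_Suc)
      then have "diffs (\<lambda>j. taylor_coord j k / fact j) j = taylor_coord (Suc j) k / fact j"
        unfolding diffs_def .
      then show ?thesis unfolding taylor_coord_Suc by (simp add: add_divide_distrib distrib_right)
    qed
    then show ?thesis
      by (simp only: suminf_add[symmetric] suminf_mult summable_add summable_mult summable_taylor_coord)
  qed
  finally have D: "(?G k has_field_derivative ?G (k + 1) x + ?G (k - 1) x + of_real (pot k) * ?G k x) (at x)" for x .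
  have "((\<lambda>t. - \<i> * complex_of_real t) has_vector_derivative - \<i>) (at t)"
    by (rule has_vector_derivative_eq_rhs, (rule derivative_intros)+) auto
  from field_vector_diff_chain_at[OF this D]
  show "((\<lambda>t. evolution_coord t k) has_vector_derivative
      - \<i> * (evolution_coord t (k + 1) + evolution_coord t (k - 1) + of_real (pot k) * evolution_coord t k)) (at t)"
    unfolding evolution_coord_eq o_def .
next
  fix t k
  let ?d = "nat \<bar>k - a\<bar>"
  let ?K = "2 * (2 + \<bar>lam\<bar>) * \<bar>t\<bar>"
  let ?t = "\<lambda>j. taylor_coord j k / fact j * (- \<i> * complex_of_real t) ^ j"
  have e: "(\<lambda>j. inverse (fact j) * ?K ^ j * (1 / 2 ^ ?d)) sums (exp ?K * (1 / 2 ^ ?d))"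
    using exp_converges[of ?K] by (intro sums_mult2) (simp add: scaleR_conv_of_real field_simps)
  have n: "norm (?t j) \<le> inverse (fact j) * ?K ^ j * (1 / 2 ^ ?d)" for j
  proof (cases "j < ?d")
    case True
    then have "taylor_coord j k = 0" by (intro taylor_coord_eq_0) linarith
    then show ?thesis by simp
  next
    case False
    \<comment> \<open>For orders at least the distance d, the factor 2^j / 2^d is at least 1;
      inserting it doubles the rate in the exponential and produces the decay 2^(-d).\<close>
    then have "(2::real) ^ ?d \<le> 2 ^ j" by (intro power_increasing) auto
    then have "1 \<le> 2 ^ j * (1 / (2::real) ^ ?d)" by simp
    then have "((2 + \<bar>lam\<bar>) * \<bar>t\<bar>) ^ j * 1 \<le> ((2 + \<bar>lam\<bar>) * \<bar>t\<bar>) ^ j * (2 ^ j * (1 / 2 ^ ?d))"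
      by (intro mult_left_mono) auto
    moreover have "norm (?t j) * fact j \<le> ((2 + \<bar>lam\<bar>) * \<bar>t\<bar>) ^ j * 1"
      using mult_right_mono[OF norm_taylor_coord_le[of j k], of "\<bar>t\<bar> ^ j"]
      by (simp add: norm_mult norm_divide norm_power power_mult_distrib)
    moreover have "((2 + \<bar>lam\<bar>) * \<bar>t\<bar>) ^ j * (2 ^ j * (1 / 2 ^ ?d)) = ?K ^ j * (1 / 2 ^ ?d)"
      by (simp only: power_mult_distrib mult_ac)
    ultimately have "norm (?t j) * fact j \<le> ?K ^ j * (1 / 2 ^ ?d)" by linarith
    then show ?thesis by (simp add: field_simps)
  qed
  have "norm (evolution_coord t k) \<le> (\<Sum>j. inverse (fact j) * ?K ^ j * (1 / 2 ^ ?d))"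
    unfolding evolution_coord_eq by (rule norm_suminf_le[OF n sums_summable[OF e]])
  also have "\<dots> = exp ?K * (1 / 2 ^ ?d)" using sums_unique[OF e] by simp
  finally show "norm (evolution_coord t k) \<le> exp ?K / 2 ^ ?d" by simp
qed

end

section \<open>Smallness of the averaged probabilities beyond a denominator\<close>

definition good_denominator :: "real \<Rightarrow> int \<Rightarrow> bool" where
  "good_denominator \<theta> q \<longleftrightarrow> (\<exists>p. coprime p q \<and> \<bar>\<theta> - of_int p / of_int q\<bar> \<le> 1 / (of_int q)\<^sup>2)"

context
  fixes lam \<theta> \<omega> :: real
begin

abbreviation (input) "am_prob \<equiv> avg_prob (almost_mathieu lam \<theta> \<omega>)"

interpretation am: schroedinger_flow "\<lambda>k. lam * cos (2 * pi * (of_int k * \<theta> + \<omega>))" "\<bar>lam\<bar>" 1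
    "evolution_coord lam \<theta> \<omega> 1"
  by (rule schroedinger_flow_almost_mathieu)

lemma avg_prob_eq: "am_prob n T = am.avg n T"
  unfolding avg_prob_def am.avg_def time_avg_def cinner_delta_right evolution_coord_def ..

lemma am_prob_nonneg: "T > 0 \<Longrightarrow> am_prob n T \<ge> 0"
  unfolding avg_prob_eq by (rule am.avg_nonneg)

lemma sum_am_prob_le_1: "T > 0 \<Longrightarrow> finite F \<Longrightarrow> (\<Sum>n\<in>F. am_prob n T) \<le> 1"
  unfolding avg_prob_eq by (rule am.sum_avg_le_1)

lemma am_prob_ballistic:
  obtains \<kappa> where "\<kappa> > 0" "\<And>n T. T \<ge> 1 \<Longrightarrow> am_prob n T \<le> 3 * exp (- (\<kappa> * \<bar>real_of_int (n - 1)\<bar> / T))"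
proof
  show "ln 2 / (4 * (2 + \<bar>lam\<bar>)) > 0" by simp
qed (use am.avg_ballistic in \<open>auto simp: avg_prob_eq\<close>)

text \<open>The source is site 1, so the exceptional neighbour is site 0, the only site to which the
  moments give weight 0.\<close>

lemma am_prob_off_0:
  obtains c where "c > 0" "\<And>T. T \<ge> 4 \<Longrightarrow> \<exists>F. finite F \<and> 0 \<notin> F \<and> c \<le> (\<Sum>n\<in>F. am_prob n T)"
proof
  show "1 / (8 * (1 + 2 * (2 * \<bar>lam\<bar> + 2)\<^sup>2)) > 0" by (simp add: add_pos_nonneg)
  show "\<exists>F. finite F \<and> 0 \<notin> F \<and> 1 / (8 * (1 + 2 * (2 * \<bar>lam\<bar> + 2)\<^sup>2)) \<le> (\<Sum>n\<in>F. am_prob n T)" if T: "T \<ge> 4" for T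
  proof -
    obtain F where "finite F" "1 - 1 \<notin> F" "1 / (8 * (1 + 2 * (2 * \<bar>lam\<bar> + 2)\<^sup>2)) \<le> (\<Sum>k\<in>F. am.avg k T)"
      by (rule am.avg_off_neighbour_ge[OF T])
    then show ?thesis by (intro exI[of _ F]) (simp add: avg_prob_eq)
  qed
qed

text \<open>At distance 1 / T from the real axis the Green function is bounded by T, so its decay
  beyond the block is uniform in the energy and passes to the amplitudes by Fourier inversion. The
  margin 2 beyond 2 q serves the right side: reflection about site 1 sends n to 2 - n, which must
  again be below -2 q.\<close>

lemma am_prob_le:
  assumes lam: "lam > 2" and q: "q \<ge> 200" "good_denominator \<theta> q" and T: "T \<ge> 1"
    and n: "\<bar>n\<bar> > 2 * q + 2"
  shows "am_prob n T \<le> 2 * (5 + lam) * T * exp (- (real (nat (q div 200)) * ln (lam / 2) / 4))"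
proof -
  let ?c = "evolution_coord lam \<theta> \<omega> 1"
  define L where "L = nat (q div 200)"
  \<comment> \<open>The fourth root of the block gain: one square root is lost because only the
    squared Green function is bounded, another in balancing the Gaussian width.\<close>
  define y where "y = exp (- (real L * ln (lam / 2) / 4))"
  \<comment> \<open>With \<eta> = 2 (T y)^2 this width makes \<eta> / \<sigma> and the Lipschitz
    error both multiples of \<sigma>.\<close>
  define \<sigma> where "\<sigma> = T * y"
  have y: "y > 0" "y ^ 4 * (lam / 2) ^ L = 1"
  proof -
    have "y ^ 4 = exp (- (real L * ln (lam / 2)))" unfolding y_def exp_of_nat_mult[symmetric] by simp
    moreover have "(lam / 2) ^ L = exp (real L * ln (lam / 2))"
      unfolding exp_of_nat_mult using lam by (subst exp_ln) auto
    ultimately show "y ^ 4 * (lam / 2) ^ L = 1" by (simp add: exp_minus_inverse mult.commute del: exp_of_nat_mult)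
  qed (simp add: y_def)
  have \<sigma>: "\<sigma> > 0" using T y by (simp add: \<sigma>_def)
  obtain p where p: "coprime p q" "\<bar>\<theta> - of_int p / of_int q\<bar> \<le> 1 / (of_int q)\<^sup>2"
    using q(2) unfolding good_denominator_def by auto
  have n1: "n \<noteq> 1" using n q by auto
  have small: "norm (am.green (of_real (1 / T) - \<i> * of_real x) n) \<le> 2 * (T * y)\<^sup>2" for x
  proof -
    define s where "s = of_real (1 / T) - \<i> * of_real x"
    have s: "Re s > 0" using T by (simp add: s_def)
    have z: "Im (\<i> * s) > 0" "Im (\<i> * s) = 1 / T" using T by (simp_all add: s_def)
    have bd: "norm (am.green s k) \<le> T" for k
      using am.norm_green_le[OF s, of k] T by (simp add: s_def)
    have "(Im (\<i> * s))\<^sup>2 * ((lam / 2) ^ L / 2) * (norm (am.green s n))\<^sup>2 \<le> T\<^sup>2"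
    proof (cases "n < 0")
      case True
      show ?thesis unfolding L_def
      proof (rule almost_mathieu_green_decay[OF q(1) p _ z(1) _ bd])
        show "am.green s (k - 1) = (\<i> * s - of_real (lam * cos (2 * pi * (k * \<theta> + \<omega>)))) * am.green s k - am.green s (k + 1)"
          if "k \<le> 0" for k
          using am.green_equation[OF s, of k] that by (simp add: eq_diff_eq add.commute)
      qed (use n True lam in auto)
    next
      case False
      txt \<open>Reflection about the source maps the potential to one of the same form with phase \<open>- 2 * \<theta> - \<omega>\<close>.\<close>
      define g where "g k = am.green s (2 - k)" for k
      have "(Im (\<i> * s))\<^sup>2 * ((lam / 2) ^ L / 2) * (norm (g (2 - n)))\<^sup>2 \<le> T\<^sup>2"
        unfolding L_def
      proof (rule almost_mathieu_green_decay[OF q(1) p _ z(1), where \<omega> = "- 2 * \<theta> - \<omega>"])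
        show "g (k - 1) = (\<i> * s - of_real (lam * cos (2 * pi * (k * \<theta> + (- 2 * \<theta> - \<omega>))))) * g k - g (k + 1)"
          if "k \<le> 0" for k
        proof -
          have "cos (2 * pi * (k * \<theta> + (- 2 * \<theta> - \<omega>))) = cos (- (2 * pi * (of_int (2 - k) * \<theta> + \<omega>)))"
            by (simp add: algebra_simps)
          also have "\<dots> = cos (2 * pi * (of_int (2 - k) * \<theta> + \<omega>))" by (rule cos_minus)
          finally have c: "cos (2 * pi * (k * \<theta> + (- 2 * \<theta> - \<omega>))) = cos (2 * pi * (of_int (2 - k) * \<theta> + \<omega>))" .
          have i: "2 - (k - 1) = 2 - k + 1" "2 - (k + 1) = 2 - k - 1" by auto
          show ?thesis
            using am.green_equation[OF s, of "2 - k"] that unfolding g_def c i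
            by (simp only: eq_diff_eq)
        qed
      qed (use n False lam bd in \<open>auto simp: g_def\<close>)
      then show ?thesis by (simp add: g_def)
    qed
    then have "(1 / T)\<^sup>2 * ((lam / 2) ^ L / 2) * (norm (am.green s n))\<^sup>2 * (2 * y ^ 4 * T\<^sup>2) \<le> T\<^sup>2 * (2 * y ^ 4 * T\<^sup>2)"
      unfolding z(2) using y by (intro mult_right_mono) auto
    also have "(1 / T)\<^sup>2 * ((lam / 2) ^ L / 2) * (norm (am.green s n))\<^sup>2 * (2 * y ^ 4 * T\<^sup>2)
        = (y ^ 4 * (lam / 2) ^ L) * (norm (am.green s n))\<^sup>2"
      using T by (simp add: power_divide)
    finally have "(norm (am.green s n))\<^sup>2 \<le> T\<^sup>2 * (2 * y ^ 4 * T\<^sup>2)" unfolding y by simp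
    also have "\<dots> \<le> (2 * (T * y)\<^sup>2)\<^sup>2"
      using T y by (simp add: power_mult_distrib power2_eq_square power4_eq_xxxx mult_ac)
    finally show ?thesis unfolding s_def[symmetric] by (rule power2_le_imp_le) simp
  qed
  have f: "exp (- (1 / T * t)) * norm (?c t n) \<le> (5 + lam) * \<sigma>" if "t \<ge> 0" for t
  proof -
    have "exp (- (1 / T * t)) * norm (?c t n) \<le> 2 * (T * y)\<^sup>2 / \<sigma> + (1 / T + 2 + \<bar>lam\<bar>) * \<sigma>"
      using T by (intro am.flow_le_of_green_le small n1 that \<sigma>) auto
    also have "2 * (T * y)\<^sup>2 / \<sigma> = 2 * \<sigma>" using \<sigma> unfolding \<sigma>_def by (simp add: power2_eq_square)
    also have "2 * \<sigma> + (1 / T + 2 + \<bar>lam\<bar>) * \<sigma> \<le> 2 * \<sigma> + (1 + 2 + \<bar>lam\<bar>) * \<sigma>"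
      using T \<sigma> by (intro add_left_mono mult_right_mono) auto
    also have "\<dots> = (5 + lam) * \<sigma>" using lam by (simp add: algebra_simps)
    finally show ?thesis .
  qed
  have "norm (LINT t:{0..}|lborel. exp (- 2 * t / T) * (norm (?c t n))\<^sup>2) \<le> ((5 + lam) * \<sigma>) / (1 / T)"
  proof (rule norm_set_integral_exp_decay)
    show "norm (exp (- 2 * t / T) * (norm (?c t n))\<^sup>2) \<le> (5 + lam) * \<sigma> * exp (- (1 / T * t))" if t: "t \<ge> 0" for t
    proof -
      \<comment> \<open>The weight is split between the two factors of |c|^2: one factor takes the
        small bound, the other is at most 1 and keeps an integrable weight.\<close>
      have "exp (- 2 * t / T) = exp (- (1 / T * t)) * exp (- (1 / T * t))"
        unfolding exp_add[symmetric] using T by (simp add: field_simps)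
      then have "norm (exp (- 2 * t / T) * (norm (?c t n))\<^sup>2)
          = (exp (- (1 / T * t)) * norm (?c t n)) * (exp (- (1 / T * t)) * norm (?c t n))"
        by (simp add: abs_mult power2_eq_square)
      also have "\<dots> \<le> ((5 + lam) * \<sigma>) * (exp (- (1 / T * t)) * 1)"
        by (rule mult_mono[OF f[OF t] mult_left_mono[OF am.norm_le_1[OF t]]]) (use lam \<sigma> in auto)
      finally show ?thesis by simp
    qed
  qed (use T in auto)
  then have "2 / T * (LINT t:{0..}|lborel. exp (- 2 * t / T) * (norm (?c t n))\<^sup>2) \<le> 2 / T * (((5 + lam) * \<sigma>) / (1 / T))"
    using T by (intro mult_left_mono) auto
  also have "\<dots> = 2 * (5 + lam) * \<sigma>" using T by simp
  finally show ?thesis unfolding avg_prob_eq am.avg_def time_avg_def \<sigma>_def y_def L_def by (simp only: mult.assoc)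
qed

text \<open>Rounding in \<open>q div 200\<close> loses less than one block site, hence only the
  constant factor exp(l / 4); the rate is l / (4 * 200).\<close>

lemma am_prob_super_decay:
  assumes lam: "lam > 2"
  obtains C \<kappa> where "C > 0" "\<kappa> > 0"
    "\<And>q n T. q \<ge> 200 \<Longrightarrow> good_denominator \<theta> q \<Longrightarrow> T \<ge> 1 \<Longrightarrow> \<bar>n\<bar> > 2 * q + 2 \<Longrightarrow>
      am_prob n T \<le> C * T * exp (- (\<kappa> * real_of_int q))"
proof
  define l where "l = ln (lam / 2)"
  have l: "l > 0" using lam by (simp add: l_def)
  show "2 * (5 + lam) * exp (l / 4) > 0" "l / 800 > 0" using lam l by auto
  fix q n :: int and T :: real assume *: "q \<ge> 200" "good_denominator \<theta> q" "T \<ge> 1" "\<bar>n\<bar> > 2 * q + 2"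
  have "real (nat (q div 200)) = real_of_int (q div 200)" using *(1) by simp
  moreover have "real_of_int q / 200 - 1 \<le> real_of_int (q div 200)"
    using real_of_int_div2[of q 200] real_of_int_div3[of q 200] by simp
  ultimately have "(real_of_int q / 200 - 1) * l / 4 \<le> real (nat (q div 200)) * l / 4"
    using l by (intro divide_right_mono mult_right_mono) auto
  then have e: "exp (- (real (nat (q div 200)) * l / 4)) \<le> exp (l / 4) * exp (- (l / 800 * real_of_int q))"
    unfolding exp_add[symmetric] by (simp add: algebra_simps)
  have "am_prob n T \<le> 2 * (5 + lam) * T * exp (- (real (nat (q div 200)) * l / 4))"
    unfolding l_def by (rule am_prob_le[OF lam *])
  also have "\<dots> \<le> 2 * (5 + lam) * T * (exp (l / 4) * exp (- (l / 800 * real_of_int q)))"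
    using lam * by (intro mult_left_mono e) auto
  finally show "am_prob n T \<le> 2 * (5 + lam) * exp (l / 4) * T * exp (- (l / 800 * real_of_int q))"
    by (simp add: mult_ac)
qed

end

section \<open>Transport exponents\<close>

lemma elog_mono: "x \<le> y \<Longrightarrow> elog x \<le> elog y"
proof -
  assume xy: "x \<le> y"
  show ?thesis
  proof (cases "x = 0 \<or> y = \<infinity>")
    case True then show ?thesis by (auto simp: elog_def)
  next
    case False
    then have x: "x \<noteq> \<infinity>" "y \<noteq> 0" "x \<noteq> 0" "y \<noteq> \<infinity>" using xy by (auto simp: top_unique)
    then have "0 < enn2real x" by (simp add: enn2real_positive_iff less_top zero_less_iff_neq_zero)
    moreover have "enn2real x \<le> enn2real y" using x xy by (intro enn2real_mono) (auto simp: less_top)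
    ultimately show ?thesis using x by (simp add: elog_def)
  qed
qed

lemma elog_powr: "T > 1 \<Longrightarrow> elog (ennreal (T powr m)) = ereal (m * ln T)"
  by (simp add: elog_def ln_powr)

lemma elog_ratio_le:
  assumes "T > 1" "p > 0" "x \<le> ennreal (T powr m)"
  shows "elog x / ereal (p * ln T) \<le> ereal (m / p)"
proof -
  have "elog x / ereal (p * ln T) \<le> elog (ennreal (T powr m)) / ereal (p * ln T)"
    using assms by (intro ereal_divide_right_mono elog_mono) auto
  also have "\<dots> = ereal (m / p)" using assms by (simp add: elog_powr)
  finally show ?thesis .
qed

lemma elog_ratio_ge:
  assumes "T > 1" "p > 0" "ennreal (T powr m) \<le> x"
  shows "ereal (m / p) \<le> elog x / ereal (p * ln T)"
proof -
  have "ereal (m / p) = elog (ennreal (T powr m)) / ereal (p * ln T)" using assms by (simp add: elog_powr)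
  also have "\<dots> \<le> elog x / ereal (p * ln T)"
    using assms by (intro ereal_divide_right_mono elog_mono) auto
  finally show ?thesis .
qed

lemma Liminf_le_frequently:
  fixes f :: "'a \<Rightarrow> ereal"
  assumes "\<exists>\<^sub>F x in F. f x \<le> c" shows "Liminf F f \<le> c"
proof (rule ccontr)
  assume "\<not> Liminf F f \<le> c"
  then have "\<forall>\<^sub>F x in F. c < f x" using le_Liminf_iff[of "Liminf F f" F f] by auto
  then show False using assms by (simp add: frequently_def not_le)
qed

lemma sum_int_inverse_sq_le:
  "\<exists>S::real. S > 0 \<and> (\<forall>F :: int set. finite F \<longrightarrow> (\<Sum>n\<in>F. (1 + \<bar>real_of_int n\<bar>) powr - 2) \<le> S)"
proof -
  define h where "h n = (1 + \<bar>real_of_int n\<bar>) powr - 2" for n :: int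
  let ?f = "\<lambda>k::nat. (1 + real k) powr - 2"
  have s: "summable ?f"
    using summable_iff_shift[of "\<lambda>k. real k powr - 2" 1] summable_real_powr_iff[of "- 2"] by (simp add: add.commute)
  define S where "S = 2 * suminf ?f + 1"
  have S0: "suminf ?f \<ge> 0" using s by (intro suminf_nonneg) auto
  have "(\<Sum>n\<in>F. h n) \<le> S" if F: "finite F" for F
  proof -
    define N where "N = nat (\<Sum>n\<in>F. \<bar>n\<bar>)"
    let ?A = "int ` {..N}" and ?B = "(\<lambda>k. - int k) ` {..N}"
    have "F \<subseteq> ?A \<union> ?B"
    proof
      fix n assume "n \<in> F"
      then have "\<bar>n\<bar> \<le> (\<Sum>n\<in>F. \<bar>n\<bar>)" using member_le_sum[of n F "\<lambda>n. \<bar>n\<bar>"] F by simp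
      then have N: "nat \<bar>n\<bar> \<le> N" unfolding N_def by simp
      show "n \<in> ?A \<union> ?B"
      proof (cases "n \<ge> 0")
        case True then show ?thesis using N by (intro UnI1 image_eqI[of _ _ "nat \<bar>n\<bar>"]) auto
      next
        case False then show ?thesis using N by (intro UnI2 image_eqI[of _ _ "nat \<bar>n\<bar>"]) auto
      qed
    qed
    then have "(\<Sum>n\<in>F. h n) \<le> (\<Sum>n\<in>?A \<union> ?B. h n)" by (intro sum_mono2) (auto simp: h_def)
    also have "\<dots> \<le> (\<Sum>n\<in>?A. h n) + (\<Sum>n\<in>?B. h n)"
      using sum.union_inter[of ?A ?B h] sum_nonneg[of "?A \<inter> ?B" h] by (simp add: h_def)
    also have "(\<Sum>n\<in>?A. h n) = (\<Sum>k\<le>N. ?f k)" by (subst sum.reindex) (auto simp: inj_on_def h_def)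
    also have "(\<Sum>n\<in>?B. h n) = (\<Sum>k\<le>N. ?f k)" by (subst sum.reindex) (auto simp: inj_on_def h_def)
    also have "(\<Sum>k\<le>N. ?f k) + (\<Sum>k\<le>N. ?f k) \<le> S"
      unfolding S_def using sum_le_suminf[OF s, of "{..N}"] by simp
    finally show ?thesis .
  qed
  moreover have "S > 0" unfolding S_def using S0 by linarith
  ultimately show ?thesis unfolding h_def by blast
qed

lemma infsum_ennreal_le:
  fixes f :: "int \<Rightarrow> real"
  assumes "\<And>n. n \<in> X \<Longrightarrow> f n \<ge> 0" "\<And>F. finite F \<Longrightarrow> F \<subseteq> X \<Longrightarrow> (\<Sum>n\<in>F. f n) \<le> b"
  shows "(\<Sum>\<^sub>\<infinity>n\<in>X. ennreal (f n)) \<le> ennreal b"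
proof (rule infsum_le_finite_sums)
  show "(\<lambda>n. ennreal (f n)) summable_on X" by (rule nonneg_summable_on_complete) simp
  show "(\<Sum>n\<in>F. ennreal (f n)) \<le> ennreal b" if "finite F" "F \<subseteq> X" for F
    using assms that by (subst sum_ennreal) (auto intro!: ennreal_leI)
qed

lemma infsum_ennreal_ge:
  fixes f :: "int \<Rightarrow> real"
  assumes "finite F" "F \<subseteq> X" "\<And>n. n \<in> F \<Longrightarrow> f n \<ge> 0" "b \<le> (\<Sum>n\<in>F. f n)"
  shows "ennreal b \<le> (\<Sum>\<^sub>\<infinity>n\<in>X. ennreal (f n))"
proof -
  have "ennreal b \<le> (\<Sum>n\<in>F. ennreal (f n))" using assms by (subst sum_ennreal) (auto intro!: ennreal_leI)
  also have "\<dots> \<le> (\<Sum>\<^sub>\<infinity>n\<in>X. ennreal (f n))"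
    unfolding infsum_finite[OF assms(1), symmetric]
    using assms(1,2) by (intro infsum_mono_neutral nonneg_summable_on_complete) auto
  finally show ?thesis .
qed

text \<open>Finiteness at 0 keeps the set nonempty; the supremum of the empty set of extended reals
  would be -\<infinity>.\<close>

lemma Sup_eq_0:
  fixes S :: "ereal \<Rightarrow> ereal"
  assumes "S 0 < \<infinity>" "S \<infinity> = \<infinity>" "\<And>\<alpha>. \<alpha> > 0 \<Longrightarrow> S (ereal \<alpha>) = \<infinity>"
  shows "Sup {\<alpha>. 0 \<le> \<alpha> \<and> S \<alpha> < \<infinity>} = 0"
proof -
  have "{\<alpha>. 0 \<le> \<alpha> \<and> S \<alpha> < \<infinity>} = {0}"
  proof (intro set_eqI iffI)
    fix \<alpha> assume "\<alpha> \<in> {\<alpha>. 0 \<le> \<alpha> \<and> S \<alpha> < \<infinity>}"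
    then have "\<not> \<alpha> > 0" using assms(2,3) by (cases \<alpha>) auto
    then show "\<alpha> \<in> {0}" using \<open>\<alpha> \<in> _\<close> by auto
  qed (use assms in auto)
  then show ?thesis by simp
qed

lemma ereal_le_all_minus: "(\<And>M. M \<ge> 0 \<Longrightarrow> x \<le> ereal (- M)) \<Longrightarrow> x = - \<infinity>"
proof (cases x)
  case (real r)
  assume "\<And>M. M \<ge> 0 \<Longrightarrow> x \<le> ereal (- M)"
  from this[of "\<bar>r\<bar> + 1"] show ?thesis using real by simp
next
  case PInf
  assume "\<And>M. M \<ge> 0 \<Longrightarrow> x \<le> ereal (- M)"
  from this[of 0] show ?thesis using PInf by simp
qed

section \<open>From concentration of the averaged probabilities to the exponents\<close>

locale spreading_bounds =
  fixes A :: "ell2Z \<Rightarrow> ell2Z" and \<kappa> c :: real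
  assumes prob_nonneg: "T > 0 \<Longrightarrow> avg_prob A n T \<ge> 0"
    and sum_prob_le_1: "T > 0 \<Longrightarrow> finite F \<Longrightarrow> (\<Sum>n\<in>F. avg_prob A n T) \<le> 1"
    and \<kappa>_pos: "\<kappa> > 0"
    and ballistic: "T \<ge> 1 \<Longrightarrow> avg_prob A n T \<le> 3 * exp (- (\<kappa> * \<bar>real_of_int (n - 1)\<bar> / T))"
    and c_pos: "c > 0"
    and off_0: "T \<ge> 4 \<Longrightarrow> \<exists>F. finite F \<and> 0 \<notin> F \<and> c \<le> (\<Sum>n\<in>F. avg_prob A n T)"
begin

text \<open>The cutoff is the one in the definition of S at \<alpha>; \<open>B\<close> will be taken
  arbitrarily large.\<close>

definition concentrated :: "real \<Rightarrow> real \<Rightarrow> real \<Rightarrow> bool" where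
  "concentrated \<alpha> B T \<longleftrightarrow> (\<forall>n. \<bar>real_of_int n\<bar> > T powr \<alpha> - 2 \<longrightarrow> avg_prob A n T \<le> T powr - B)"

text \<open>For |n| > T^2 the ratio |n| / T exceeds sqrt |n|, so the ballistic factor decays like
  exp(-(\<kappa> / 2) sqrt |n|). This beats any power of |n| and, since T < sqrt |n|, any power of
  T.\<close>

lemma ballistic_tail:
  assumes "M \<ge> 0" "p \<ge> 0"
  shows "\<forall>\<^sub>F T in at_top. \<forall>n. \<bar>real_of_int n\<bar> > T\<^sup>2 \<longrightarrow>
    avg_prob A n T \<le> T powr - M * (1 + \<bar>real_of_int n\<bar>) powr - (p + 2)"
proof -
  have "\<forall>\<^sub>F x in at_top. 3 * exp (- (\<kappa> / 2 * sqrt x)) * ((1 + x) powr (p + 2) * x powr (M / 2)) \<le> 1"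
    using \<kappa>_pos by real_asymp
  then obtain x0 where x0: "\<And>x. x \<ge> x0 \<Longrightarrow> 3 * exp (- (\<kappa> / 2 * sqrt x)) * ((1 + x) powr (p + 2) * x powr (M / 2)) \<le> 1"
    unfolding eventually_at_top_linorder by blast
  show ?thesis
    using eventually_ge_at_top[of 2] eventually_ge_at_top[of x0]
  proof eventually_elim
    case (elim T)
    show ?case
    proof (intro allI impI)
      fix n :: int assume n: "\<bar>real_of_int n\<bar> > T\<^sup>2"
      define x where "x = \<bar>real_of_int n\<bar>"
      have TT: "T \<le> T\<^sup>2" using elim by (simp add: power2_eq_square)
      have x: "x > T\<^sup>2" "x \<ge> x0" "x \<ge> 2" using n TT elim unfolding x_def by auto
      have "sqrt (T\<^sup>2) \<le> sqrt x" using x by (intro real_sqrt_le_mono) simp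
      then have Tx: "T \<le> sqrt x" using elim by simp
      have "\<kappa> * (x / 2) / sqrt x = \<kappa> / 2 * (x / sqrt x)" by simp
      also have "x / sqrt x = sqrt x" using x by (intro real_div_sqrt) simp
      finally have "\<kappa> / 2 * sqrt x = \<kappa> * (x / 2) / sqrt x" by (rule sym)
      also have "\<dots> \<le> \<kappa> * (x / 2) / T"
        using Tx elim x \<kappa>_pos by (intro divide_left_mono mult_pos_pos) auto
      also have "\<dots> \<le> \<kappa> * \<bar>real_of_int (n - 1)\<bar> / T"
      proof (intro divide_right_mono mult_left_mono)
        show "x / 2 \<le> \<bar>real_of_int (n - 1)\<bar>" using x(3) unfolding x_def by (auto simp: abs_if split: if_splits)
      qed (use elim \<kappa>_pos in auto)
      finally have e: "\<kappa> / 2 * sqrt x \<le> \<kappa> * \<bar>real_of_int (n - 1)\<bar> / T" .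
      have "avg_prob A n T \<le> 3 * exp (- (\<kappa> * \<bar>real_of_int (n - 1)\<bar> / T))"
        using elim by (intro ballistic) simp
      also have "\<dots> \<le> 3 * exp (- (\<kappa> / 2 * sqrt x))" using e by simp
      also have "\<dots> \<le> 1 / ((1 + x) powr (p + 2) * x powr (M / 2))"
        using x0[OF x(2)] x by (simp add: pos_le_divide_eq)
      also have "\<dots> = (1 + x) powr - (p + 2) * x powr - (M / 2)"
        by (simp only: powr_minus_divide) simp
      also have "\<dots> \<le> (1 + x) powr - (p + 2) * T powr - M"
      proof (rule mult_left_mono)
        have "x powr - (M / 2) \<le> (T\<^sup>2) powr - (M / 2)"
          using x elim assms by (intro powr_mono2') auto
        also have "T\<^sup>2 = T powr 2" using elim by simp
        then have "(T\<^sup>2) powr - (M / 2) = T powr - M" by (simp only: powr_powr) simp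
        finally show "x powr - (M / 2) \<le> T powr - M" .
      qed simp
      finally show "avg_prob A n T \<le> T powr - M * (1 + \<bar>real_of_int n\<bar>) powr - (p + 2)"
        unfolding x_def by (simp only: mult.commute)
    qed
  qed
qed

text \<open>Pointwise smallness has to become summable in n. Up to T^2 one has 1 + |n| \<le> T^3, so
  the surplus power 3 (p + 2) of T pays for the weight; beyond T^2 the ballistic tail
  applies.\<close>

lemma concentrated_imp_le:
  assumes "M \<ge> 0" "p \<ge> 0"
  shows "\<forall>\<^sub>F T in at_top. concentrated \<alpha> (M + 3 * (p + 2)) T \<longrightarrow> (\<forall>n. \<bar>real_of_int n\<bar> > T powr \<alpha> - 2 \<longrightarrow>
    avg_prob A n T \<le> T powr - M * (1 + \<bar>real_of_int n\<bar>) powr - (p + 2))"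
  using ballistic_tail[OF assms] eventually_ge_at_top[of 2]
proof eventually_elim
  case (elim T)
  show ?case
  proof (intro impI allI)
    fix n :: int assume cn: "concentrated \<alpha> (M + 3 * (p + 2)) T" and n: "\<bar>real_of_int n\<bar> > T powr \<alpha> - 2"
    show "avg_prob A n T \<le> T powr - M * (1 + \<bar>real_of_int n\<bar>) powr - (p + 2)"
    proof (cases "\<bar>real_of_int n\<bar> > T\<^sup>2")
      case True then show ?thesis using elim by blast
    next
      case False
      have "1 \<le> T\<^sup>2" using elim by (simp add: one_le_power)
      then have "1 + \<bar>real_of_int n\<bar> \<le> 2 * T\<^sup>2" using False by linarith
      also have "\<dots> \<le> T * T\<^sup>2" using elim by (intro mult_right_mono) auto
      finally have "1 + \<bar>real_of_int n\<bar> \<le> T powr 3"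
        using elim by (simp add: powr_numeral power2_eq_square power3_eq_cube)
      then have "(T powr 3) powr - (p + 2) \<le> (1 + \<bar>real_of_int n\<bar>) powr - (p + 2)"
        using assms by (intro powr_mono2') auto
      then have "T powr - (3 * (p + 2)) \<le> (1 + \<bar>real_of_int n\<bar>) powr - (p + 2)" by (simp add: powr_powr)
      then have "T powr - M * T powr - (3 * (p + 2)) \<le> T powr - M * (1 + \<bar>real_of_int n\<bar>) powr - (p + 2)"
        by (intro mult_left_mono) auto
      moreover have "T powr - M * T powr - (3 * (p + 2)) = T powr - (M + 3 * (p + 2))"
        by (simp only: powr_add[symmetric] minus_add_distrib)
      ultimately show ?thesis using cn n unfolding concentrated_def by fastforce
    qed
  qed
qed

lemma outside_prob_small:
  assumes M: "M \<ge> 0"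
  shows "\<forall>\<^sub>F T in at_top. concentrated \<alpha> (M + 7) T \<longrightarrow>
    elog (outside_prob A (epow T (ereal \<alpha>) - 2) T) / ereal (ln T) \<le> ereal (- M)"
proof -
  obtain S where S: "S > 0" "\<And>F :: int set. finite F \<Longrightarrow> (\<Sum>n\<in>F. (1 + \<bar>real_of_int n\<bar>) powr - 2) \<le> S"
    using sum_int_inverse_sq_le by blast
  have "M + 1 \<ge> 0" using M by simp
  \<comment> \<open>Six powers of T pay for the summable weight (with p = 0), one more absorbs its
    sum S.\<close>
  have B: "M + 1 + 3 * (0 + 2) = M + 7" by simp
  show ?thesis
    using concentrated_imp_le[OF \<open>M + 1 \<ge> 0\<close> order_refl, of \<alpha>] eventually_ge_at_top[of 2] eventually_ge_at_top[of S]
  proof eventually_elim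
    case (elim T)
    show ?case
    proof
      assume cn: "concentrated \<alpha> (M + 7) T"
      have le: "avg_prob A n T \<le> T powr - (M + 1) * (1 + \<bar>real_of_int n\<bar>) powr - 2"
        if "\<bar>real_of_int n\<bar> > T powr \<alpha> - 2" for n
        using elim(1)[unfolded B] cn that by simp
      have "outside_prob A (epow T (ereal \<alpha>) - 2) T \<le> ennreal (T powr - (M + 1) * S)"
        unfolding outside_prob_def
      proof (rule infsum_ennreal_le)
        show "avg_prob A n T \<ge> 0" for n using prob_nonneg elim by simp
        fix F assume F: "finite F" "F \<subseteq> {n::int. ereal \<bar>real_of_int n\<bar> > epow T (ereal \<alpha>) - 2}"
        then have "\<bar>real_of_int n\<bar> > T powr \<alpha> - 2" if "n \<in> F" for n
          using that by (auto simp: epow_def numeral_eq_ereal)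
        then have "(\<Sum>n\<in>F. avg_prob A n T) \<le> (\<Sum>n\<in>F. T powr - (M + 1) * (1 + \<bar>real_of_int n\<bar>) powr - 2)"
          by (intro sum_mono le)
        also have "\<dots> \<le> T powr - (M + 1) * S"
          unfolding sum_distrib_left[symmetric] by (intro mult_left_mono S F) simp
        finally show "(\<Sum>n\<in>F. avg_prob A n T) \<le> T powr - (M + 1) * S" .
      qed
      also have "T powr - (M + 1) * S \<le> T powr - (M + 1) * T" using elim by (intro mult_left_mono) auto
      also have "\<dots> = T powr - (M + 1) * T powr 1" using elim by simp
      also have "\<dots> = T powr - M" by (simp only: powr_add[symmetric]) simp
      finally have "outside_prob A (epow T (ereal \<alpha>) - 2) T \<le> ennreal (T powr - M)"
        by (simp add: ennreal_leI)
      then show "elog (outside_prob A (epow T (ereal \<alpha>) - 2) T) / ereal (ln T) \<le> ereal (- M)"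
        using elog_ratio_le[of T 1 _ "- M"] elim by simp
    qed
  qed
qed

text \<open>Within T^\<alpha> the weight is at most T^(\<alpha> p) and the total probability at most
  1; the rest sums to a constant.\<close>

lemma moment_small:
  assumes p: "p > 0" and \<alpha>: "\<alpha> > 0"
  shows "\<forall>\<^sub>F T in at_top. concentrated \<alpha> (3 * (p + 2)) T \<longrightarrow>
    elog (moment A p T) / ereal (p * ln T) \<le> ereal (2 * \<alpha>)"
proof -
  obtain S where S: "S > 0" "\<And>F :: int set. finite F \<Longrightarrow> (\<Sum>n\<in>F. (1 + \<bar>real_of_int n\<bar>) powr - 2) \<le> S"
    using sum_int_inverse_sq_le by blast
  \<comment> \<open>Doubling the exponent absorbs the additive constant; \<alpha> is arbitrary, so
    nothing is lost.\<close>
  have "\<forall>\<^sub>F T in at_top. T powr (\<alpha> * p) + S \<le> T powr (2 * \<alpha> * p)"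
    using p \<alpha> by real_asymp
  then show ?thesis
    using concentrated_imp_le[OF order_refl less_imp_le[OF p], of \<alpha>] eventually_ge_at_top[of 2]
  proof eventually_elim
    case (elim T)
    show ?case
    proof
      assume cn: "concentrated \<alpha> (3 * (p + 2)) T"
      have T0: "T > 0" using elim by simp
      have le: "\<bar>real_of_int n\<bar> powr p * avg_prob A n T \<le> T powr (\<alpha> * p) * avg_prob A n T + (1 + \<bar>real_of_int n\<bar>) powr - 2" for n
      proof (cases "\<bar>real_of_int n\<bar> \<le> T powr \<alpha>")
        case True
        then have "\<bar>real_of_int n\<bar> powr p \<le> (T powr \<alpha>) powr p" using p by (intro powr_mono2) auto
        then have "\<bar>real_of_int n\<bar> powr p * avg_prob A n T \<le> T powr (\<alpha> * p) * avg_prob A n T"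
          using prob_nonneg[OF T0] by (intro mult_right_mono) (auto simp: powr_powr)
        then show ?thesis by (simp add: add_increasing2)
      next
        case False
        then have "avg_prob A n T \<le> (1 + \<bar>real_of_int n\<bar>) powr - (p + 2)"
          using elim cn p T0 by auto
        then have "\<bar>real_of_int n\<bar> powr p * avg_prob A n T \<le> (1 + \<bar>real_of_int n\<bar>) powr p * (1 + \<bar>real_of_int n\<bar>) powr - (p + 2)"
          using prob_nonneg[OF T0] p by (intro mult_mono powr_mono2) auto
        also have "\<dots> = (1 + \<bar>real_of_int n\<bar>) powr - 2" by (simp only: powr_add[symmetric]) simp
        finally show ?thesis using prob_nonneg[OF T0, of n] by (simp add: add_increasing)
      qed
      have "moment A p T \<le> ennreal (T powr (\<alpha> * p) + S)"
        unfolding moment_def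
      proof (rule infsum_ennreal_le)
        show "\<bar>real_of_int n\<bar> powr p * avg_prob A n T \<ge> 0" for n using prob_nonneg[OF T0] by simp
        fix F :: "int set" assume F: "finite F"
        have "(\<Sum>n\<in>F. \<bar>real_of_int n\<bar> powr p * avg_prob A n T) \<le>
            (\<Sum>n\<in>F. T powr (\<alpha> * p) * avg_prob A n T + (1 + \<bar>real_of_int n\<bar>) powr - 2)"
          by (intro sum_mono le)
        also have "\<dots> = T powr (\<alpha> * p) * (\<Sum>n\<in>F. avg_prob A n T) + (\<Sum>n\<in>F. (1 + \<bar>real_of_int n\<bar>) powr - 2)"
          by (simp add: sum.distrib sum_distrib_left)
        also have "\<dots> \<le> T powr (\<alpha> * p) * 1 + S"
          by (intro add_mono mult_left_mono sum_prob_le_1 S F T0) simp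
        finally show "(\<Sum>n\<in>F. \<bar>real_of_int n\<bar> powr p * avg_prob A n T) \<le> T powr (\<alpha> * p) + S" by simp
      qed
      also have "\<dots> \<le> ennreal (T powr (2 * \<alpha> * p))" using elim by (intro ennreal_leI)
      finally show "elog (moment A p T) / ereal (p * ln T) \<le> ereal (2 * \<alpha>)"
        using elog_ratio_le[of T p "moment A p T" "2 * \<alpha> * p"] elim p by simp
    qed
  qed
qed

lemma powr_le_c: "e > 0 \<Longrightarrow> \<forall>\<^sub>F T in at_top. T powr - e \<le> c"
  using c_pos by real_asymp

text \<open>At \<alpha> = 0 the cutoff is 1 - 2 = -1, so all sites are counted and the sum does not
  fall below the constant \<open>c\<close>.\<close>

lemma outside_prob_all_ge: "\<forall>\<^sub>F T in at_top. ereal (- 1) \<le> elog (outside_prob A (epow T 0 - 2) T) / ereal (ln T)"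
  using powr_le_c[of 1, simplified] eventually_ge_at_top[of 4]
proof eventually_elim
  case (elim T)
  obtain F where F: "finite F" "c \<le> (\<Sum>n\<in>F. avg_prob A n T)" using off_0[of T] elim by auto
  have "{n::int. ereal \<bar>real_of_int n\<bar> > epow T 0 - 2} = UNIV"
    using elim by (auto simp: epow_def numeral_eq_ereal one_ereal_def)
  then have "ennreal c \<le> outside_prob A (epow T 0 - 2) T"
    unfolding outside_prob_def using F prob_nonneg elim by (intro infsum_ennreal_ge[of F]) auto
  moreover have "ennreal (T powr - 1) \<le> ennreal c" using elim by (intro ennreal_leI) simp
  ultimately have "ennreal (T powr - 1) \<le> outside_prob A (epow T 0 - 2) T" by order
  then show ?case using elog_ratio_ge[of T 1 "- 1"] elim by simp
qed

text \<open>Every site other than 0 has weight at least 1, so the fixed share of probability off 0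
  keeps the moment above \<open>c\<close>.\<close>

lemma moment_ge:
  assumes p: "p > 0" and e: "e > 0"
  shows "\<forall>\<^sub>F T in at_top. ereal (- e) \<le> elog (moment A p T) / ereal (p * ln T)"
  using powr_le_c[OF mult_pos_pos[OF p e]] eventually_ge_at_top[of 4]
proof eventually_elim
  case (elim T)
  obtain F where F: "finite F" "0 \<notin> F" "c \<le> (\<Sum>n\<in>F. avg_prob A n T)" using off_0[of T] elim by auto
  have "(\<Sum>n\<in>F. avg_prob A n T) \<le> (\<Sum>n\<in>F. \<bar>real_of_int n\<bar> powr p * avg_prob A n T)"
  proof (rule sum_mono)
    fix n assume "n \<in> F"
    then have "1 \<le> \<bar>n\<bar>" using F(2) by (cases "n = 0") auto
    then have "1 \<le> \<bar>real_of_int n\<bar>" by linarith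
    then have "1 \<le> \<bar>real_of_int n\<bar> powr p" using p by (intro ge_one_powr_ge_zero) auto
    then show "avg_prob A n T \<le> \<bar>real_of_int n\<bar> powr p * avg_prob A n T"
      using prob_nonneg[of T n] elim mult_right_mono[of 1 "\<bar>real_of_int n\<bar> powr p" "avg_prob A n T"] by simp
  qed
  then have "ennreal c \<le> moment A p T"
    unfolding moment_def using F prob_nonneg elim by (intro infsum_ennreal_ge[of F]) auto
  moreover have "ennreal (T powr - (p * e)) \<le> ennreal c" using elim by (intro ennreal_leI) simp
  ultimately have "ennreal (T powr - (p * e)) \<le> moment A p T" by order
  then show ?case using elog_ratio_ge[of T p "- (p * e)"] elim p by simp
qed

lemma Liminf_moment_nonneg:
  assumes p: "p > 0" shows "0 \<le> Liminf at_top (\<lambda>T. elog (moment A p T) / ereal (p * ln T))"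
  unfolding le_Liminf_iff
proof (intro allI impI)
  fix y :: ereal assume "y < 0"
  then obtain r where r: "y < ereal r" "ereal r < 0" using ereal_dense2 by blast
  define e where "e = - r"
  have e: "e > 0" "y < ereal (- e)" using r by (auto simp: e_def)
  show "\<forall>\<^sub>F T in at_top. y < elog (moment A p T) / ereal (p * ln T)"
    using moment_ge[OF p e(1)] by eventually_elim (use e(2) in order)
qed

lemma outside_prob_infinity: "T > 1 \<Longrightarrow> elog (outside_prob A (epow T \<infinity> - 2) T) / ereal (ln T) = - \<infinity>"
  by (simp add: outside_prob_def epow_def elog_def)

text \<open>A lower limit is bounded by values attained at arbitrarily large T, so concentration
  along an unbounded set of times suffices. All M and all \<alpha> > 0 being allowed gives the
  values -\<infinity> and 0 of the limits.\<close>

lemma no_transport_minus: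
  assumes "\<And>\<alpha> B. \<alpha> > 0 \<Longrightarrow> \<exists>\<^sub>F T in at_top. concentrated \<alpha> B T"
  shows "alpha_u_minus A = 0" "p > 0 \<Longrightarrow> beta_minus A p = 0"
proof -
  show "alpha_u_minus A = 0"
    unfolding alpha_u_minus_def
  proof (rule Sup_eq_0)
    have "ereal (- 1) \<le> Liminf at_top (\<lambda>T. elog (outside_prob A (epow T 0 - 2) T) / ereal (ln T))"
      by (rule Liminf_bounded[OF outside_prob_all_ge])
    then have "S_minus A 0 \<le> - ereal (- 1)" unfolding S_minus_def ereal_minus_le_minus .
    then show "S_minus A 0 < \<infinity>" by (rule order_le_less_trans) simp
    have "Liminf at_top (\<lambda>T. elog (outside_prob A (epow T \<infinity> - 2) T) / ereal (ln T)) = Liminf at_top (\<lambda>T::real. - \<infinity> :: ereal)"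
      by (intro Liminf_eq eventually_mono[OF eventually_gt_at_top[of 1]] outside_prob_infinity)
    then show "S_minus A \<infinity> = \<infinity>" unfolding S_minus_def by (simp add: Liminf_const)
    fix \<alpha> :: real assume \<alpha>: "\<alpha> > 0"
    have "Liminf at_top (\<lambda>T. elog (outside_prob A (epow T (ereal \<alpha>) - 2) T) / ereal (ln T)) = - \<infinity>"
    proof (rule ereal_le_all_minus, rule Liminf_le_frequently)
      fix M :: real assume "M \<ge> 0"
      show "\<exists>\<^sub>F T in at_top. elog (outside_prob A (epow T (ereal \<alpha>) - 2) T) / ereal (ln T) \<le> ereal (- M)"
        by (rule frequently_rev_mp[OF assms[OF \<alpha>] outside_prob_small[OF \<open>M \<ge> 0\<close>]])
    qed
    then show "S_minus A (ereal \<alpha>) = \<infinity>" unfolding S_minus_def by simp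
  qed
  assume p: "p > 0"
  have "beta_minus A p \<le> ereal (2 * \<alpha>)" if "\<alpha> > 0" for \<alpha>
    unfolding beta_minus_def
    by (rule Liminf_le_frequently, rule frequently_rev_mp[OF assms[OF that] moment_small[OF p that]])
  then have "beta_minus A p \<le> 0 + ereal e" if "e > 0" for e
    using that by (metis add_0 half_gt_zero field_sum_of_halves mult_2)
  then have "beta_minus A p \<le> 0" by (rule ereal_le_epsilon2) blast
  then show "beta_minus A p = 0"
    using Liminf_moment_nonneg[OF p] unfolding beta_minus_def by order
qed

text \<open>For upper limits the smallness must hold at all large T; the lower bounds are inherited
  from the lower limits.\<close>

lemma no_transport_plus:
  assumes "\<And>\<alpha> B. \<alpha> > 0 \<Longrightarrow> \<forall>\<^sub>F T in at_top. concentrated \<alpha> B T"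
  shows "alpha_u_plus A = 0" "p > 0 \<Longrightarrow> beta_plus A p = 0"
proof -
  show "alpha_u_plus A = 0"
    unfolding alpha_u_plus_def
  proof (rule Sup_eq_0)
    have "ereal (- 1) \<le> Liminf at_top (\<lambda>T. elog (outside_prob A (epow T 0 - 2) T) / ereal (ln T))"
      by (rule Liminf_bounded[OF outside_prob_all_ge])
    also have "\<dots> \<le> Limsup at_top (\<lambda>T. elog (outside_prob A (epow T 0 - 2) T) / ereal (ln T))"
      by (rule Liminf_le_Limsup) simp
    finally have "S_plus A 0 \<le> - ereal (- 1)" unfolding S_plus_def ereal_minus_le_minus .
    then show "S_plus A 0 < \<infinity>" by (rule order_le_less_trans) simp
    have "Limsup at_top (\<lambda>T. elog (outside_prob A (epow T \<infinity> - 2) T) / ereal (ln T)) = Limsup at_top (\<lambda>T::real. - \<infinity> :: ereal)"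
      by (intro Limsup_eq eventually_mono[OF eventually_gt_at_top[of 1]] outside_prob_infinity)
    then show "S_plus A \<infinity> = \<infinity>" unfolding S_plus_def by (simp add: Limsup_const)
    fix \<alpha> :: real assume \<alpha>: "\<alpha> > 0"
    have "Limsup at_top (\<lambda>T. elog (outside_prob A (epow T (ereal \<alpha>) - 2) T) / ereal (ln T)) = - \<infinity>"
    proof (rule ereal_le_all_minus, rule Limsup_bounded)
      fix M :: real assume "M \<ge> 0"
      show "\<forall>\<^sub>F T in at_top. elog (outside_prob A (epow T (ereal \<alpha>) - 2) T) / ereal (ln T) \<le> ereal (- M)"
        by (rule eventually_rev_mp[OF assms[OF \<alpha>] outside_prob_small[OF \<open>M \<ge> 0\<close>]])
    qed
    then show "S_plus A (ereal \<alpha>) = \<infinity>" unfolding S_plus_def by simp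
  qed
  assume p: "p > 0"
  have "beta_plus A p \<le> ereal (2 * \<alpha>)" if "\<alpha> > 0" for \<alpha>
    unfolding beta_plus_def
    by (rule Limsup_bounded, rule eventually_rev_mp[OF assms[OF that] moment_small[OF p that]])
  then have "beta_plus A p \<le> 0 + ereal e" if "e > 0" for e
    using that by (metis add_0 half_gt_zero field_sum_of_halves mult_2)
  then have "beta_plus A p \<le> 0" by (rule ereal_le_epsilon2) blast
  moreover have "0 \<le> beta_plus A p"
    unfolding beta_plus_def
    by (rule order_trans[OF Liminf_moment_nonneg[OF p] Liminf_le_Limsup]) simp
  ultimately show "beta_plus A p = 0" by order
qed

end

section \<open>Matching denominators to times\<close>

context
  fixes lam \<theta> \<omega> :: real
  assumes lam: "lam > 2"
begin

lemma almost_mathieu_spreading_bounds: "\<exists>\<kappa> c. spreading_bounds (almost_mathieu lam \<theta> \<omega>) \<kappa> c"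
proof -
  obtain \<kappa> where \<kappa>: "\<kappa> > 0" "\<And>n T. T \<ge> 1 \<Longrightarrow> avg_prob (almost_mathieu lam \<theta> \<omega>) n T \<le> 3 * exp (- (\<kappa> * \<bar>real_of_int (n - 1)\<bar> / T))"
    using am_prob_ballistic[of lam \<theta> \<omega>] by blast
  obtain c where c: "c > 0" "\<And>T. T \<ge> 4 \<Longrightarrow> \<exists>F. finite F \<and> 0 \<notin> F \<and> c \<le> (\<Sum>n\<in>F. avg_prob (almost_mathieu lam \<theta> \<omega>) n T)"
    using am_prob_off_0[of lam \<theta> \<omega>] by blast
  have "spreading_bounds (almost_mathieu lam \<theta> \<omega>) \<kappa> c"
    by unfold_locales (fact \<kappa> c am_prob_nonneg sum_am_prob_le_1)+
  then show ?thesis by blast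
qed

text \<open>The denominator has to be small compared with T^\<alpha> and large compared with ln T.
  Of the two extra powers in B + 2, one pays for the prefactor T and one for the constant
  \<open>C\<close>, which is at most T.\<close>

lemma almost_mathieu_concentrated:
  "\<exists>C \<kappa>. \<kappa> > 0 \<and> (\<forall>q T \<alpha> B. q \<ge> 200 \<longrightarrow> good_denominator \<theta> q \<longrightarrow> T \<ge> 1 \<longrightarrow> T \<ge> C \<longrightarrow>
      2 * real_of_int q + 4 \<le> T powr \<alpha> \<longrightarrow> (B + 2) * ln T \<le> \<kappa> * real_of_int q \<longrightarrow>
      spreading_bounds.concentrated (almost_mathieu lam \<theta> \<omega>) \<alpha> B T)"
proof -
  obtain \<kappa>' c where "spreading_bounds (almost_mathieu lam \<theta> \<omega>) \<kappa>' c"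
    using almost_mathieu_spreading_bounds by blast
  then interpret spreading_bounds "almost_mathieu lam \<theta> \<omega>" \<kappa>' c .
  obtain C \<kappa> where C: "C > 0" "\<kappa> > 0"
    and le: "\<And>q n T. q \<ge> 200 \<Longrightarrow> good_denominator \<theta> q \<Longrightarrow> T \<ge> 1 \<Longrightarrow> \<bar>n\<bar> > 2 * q + 2 \<Longrightarrow>
      avg_prob (almost_mathieu lam \<theta> \<omega>) n T \<le> C * T * exp (- (\<kappa> * real_of_int q))"
    using am_prob_super_decay[OF lam, of \<theta> \<omega>] by blast
  show ?thesis
  proof (rule exI[of _ C], rule exI[of _ \<kappa>], intro conjI allI impI)
    fix q :: int and T \<alpha> B :: real
    assume *: "q \<ge> 200" "good_denominator \<theta> q" "T \<ge> 1" "T \<ge> C" "2 * real_of_int q + 4 \<le> T powr \<alpha>"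
      "(B + 2) * ln T \<le> \<kappa> * real_of_int q"
    show "concentrated \<alpha> B T"
      unfolding concentrated_def
    proof (intro allI impI)
      fix n :: int assume "\<bar>real_of_int n\<bar> > T powr \<alpha> - 2"
      then have "\<bar>n\<bar> > 2 * q + 2" using *(5) by linarith
      then have "avg_prob (almost_mathieu lam \<theta> \<omega>) n T \<le> C * T * exp (- (\<kappa> * real_of_int q))"
        using * by (intro le)
      also have "\<dots> \<le> T * T * exp (- ((B + 2) * ln T))"
        using * by (intro mult_mono) auto
      also have "exp (- ((B + 2) * ln T)) = T powr - (B + 2)"
        using *(3) by (simp add: powr_def algebra_simps)
      also have "T * T = T powr 2" using *(3) by (simp add: power2_eq_square)
      also have "T powr 2 * T powr - (B + 2) = T powr - B" by (simp only: powr_add[symmetric]) simp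
      finally show "avg_prob (almost_mathieu lam \<theta> \<omega>) n T \<le> T powr - B" .
    qed
  qed (rule C)
qed

end

lemma frequently_at_top_filterlim:
  assumes "filterlim f F sequentially" "\<forall>\<^sub>F k in sequentially. P (f k)"
  shows "\<exists>\<^sub>F x in F. P x"
  unfolding frequently_def
proof
  assume "\<forall>\<^sub>F x in F. \<not> P x"
  then have "\<forall>\<^sub>F k in sequentially. \<not> P (f k)" using assms(1) by (rule eventually_compose_filterlim)
  then have "\<forall>\<^sub>F k in sequentially. False" using assms(2) by eventually_elim simp
  then show False by simp
qed

lemma filterlim_convergent_denom:
  assumes "\<theta> \<notin> \<rat>" shows "filterlim (\<lambda>k. real_of_int (convergent_denom \<theta> k)) at_top sequentially"
proof (rule filterlim_at_top_mono[OF filterlim_real_sequentially])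
  have "real k \<le> real_of_int (convergent_denom \<theta> k)" for k
    using convergent_denom_approx(2)[OF assms, of k] by linarith
  then show "\<forall>\<^sub>F k in sequentially. real k \<le> real_of_int (convergent_denom \<theta> k)" by simp
qed

lemma good_denominator_convergent_denom: "\<theta> \<notin> \<rat> \<Longrightarrow> good_denominator \<theta> (convergent_denom \<theta> k)"
  unfolding good_denominator_def by (rule convergent_denom_approx(3))

text \<open>At the times T = exp(sqrt q) with q the denominator of a convergent, ln T = sqrt q is
  negligible against q, and q is negligible against T^\<alpha>. No growth condition is imposed,
  since q only needs to be unbounded.\<close>

lemma frequently_concentrated:
  assumes lam: "lam > 2" and \<theta>: "\<theta> \<notin> \<rat>" and \<alpha>: "\<alpha> > 0"
  shows "\<exists>\<^sub>F T in at_top. spreading_bounds.concentrated (almost_mathieu lam \<theta> \<omega>) \<alpha> B T"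
proof -
  let ?q = "\<lambda>k. real_of_int (convergent_denom \<theta> k)"
  obtain C \<kappa> where \<kappa>: "\<kappa> > 0"
    and conc: "\<forall>q T \<alpha> B. q \<ge> 200 \<longrightarrow> good_denominator \<theta> q \<longrightarrow> T \<ge> 1 \<longrightarrow> T \<ge> C \<longrightarrow>
      2 * real_of_int q + 4 \<le> T powr \<alpha> \<longrightarrow> (B + 2) * ln T \<le> \<kappa> * real_of_int q \<longrightarrow>
      spreading_bounds.concentrated (almost_mathieu lam \<theta> \<omega>) \<alpha> B T"
    using almost_mathieu_concentrated[OF lam, of \<theta> \<omega>] by blast
  have lim: "filterlim (\<lambda>x::real. exp (sqrt x)) at_top at_top" by real_asymp
  have "\<forall>\<^sub>F x in at_top. 2 * x + 4 \<le> exp (sqrt x) powr \<alpha>"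
    using \<alpha> by real_asymp
  moreover have "\<forall>\<^sub>F x in at_top. (B + 2) * sqrt x \<le> \<kappa> * x"
    using \<kappa> by real_asymp
  moreover have "\<forall>\<^sub>F x in at_top. C \<le> exp (sqrt x)"
    using lim unfolding filterlim_at_top by blast
  ultimately have "\<forall>\<^sub>F x in at_top. x \<ge> 200 \<and> 2 * x + 4 \<le> exp (sqrt x) powr \<alpha> \<and> (B + 2) * sqrt x \<le> \<kappa> * x \<and> C \<le> exp (sqrt x)"
    using eventually_ge_at_top[of 200] by eventually_elim simp
  then have ev: "\<forall>\<^sub>F k in sequentially. ?q k \<ge> 200 \<and> 2 * ?q k + 4 \<le> exp (sqrt (?q k)) powr \<alpha> \<and>
      (B + 2) * sqrt (?q k) \<le> \<kappa> * ?q k \<and> C \<le> exp (sqrt (?q k))"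
    by (rule eventually_compose_filterlim[OF _ filterlim_convergent_denom[OF \<theta>]])
  show ?thesis
  proof (rule frequently_at_top_filterlim)
    show "filterlim (\<lambda>k. exp (sqrt (?q k))) at_top sequentially"
      by (rule filterlim_compose[OF lim filterlim_convergent_denom[OF \<theta>]])
    show "\<forall>\<^sub>F k in sequentially. spreading_bounds.concentrated (almost_mathieu lam \<theta> \<omega>) \<alpha> B (exp (sqrt (?q k)))"
      using ev
    proof eventually_elim
      case (elim k)
      then show ?case
        by (intro conc[rule_format, OF _ good_denominator_convergent_denom[OF \<theta>, of k]]) auto
    qed
  qed
qed

text \<open>For large \<open>T\<close> the largest denominator \<open>q\<^sub>k\<close> with \<open>2 * q\<^sub>k + 4 \<le> T\<^sup>\<alpha>\<close> is used; by the growth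
  condition \<open>ln T\<close> is negligible compared to it, as \<open>ln q\<^sub>k\<^sub>+\<^sub>1\<close> is.\<close>

lemma eventually_concentrated:
  assumes lam: "lam > 2" and \<theta>: "\<theta> \<notin> \<rat>" and \<alpha>: "\<alpha> > 0"
    and lim: "(\<lambda>k. ln (real_of_int (convergent_denom \<theta> (Suc k))) / real_of_int (convergent_denom \<theta> k)) \<longlonglongrightarrow> 0"
  shows "\<forall>\<^sub>F T in at_top. spreading_bounds.concentrated (almost_mathieu lam \<theta> \<omega>) \<alpha> B T"
proof -
  let ?q = "\<lambda>k. real_of_int (convergent_denom \<theta> k)"
  obtain C \<kappa> where \<kappa>: "\<kappa> > 0"
    and conc: "\<forall>q T \<alpha> B. q \<ge> 200 \<longrightarrow> good_denominator \<theta> q \<longrightarrow> T \<ge> 1 \<longrightarrow> T \<ge> C \<longrightarrow>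
      2 * real_of_int q + 4 \<le> T powr \<alpha> \<longrightarrow> (B + 2) * ln T \<le> \<kappa> * real_of_int q \<longrightarrow>
      spreading_bounds.concentrated (almost_mathieu lam \<theta> \<omega>) \<alpha> B T"
    using almost_mathieu_concentrated[OF lam, of \<theta> \<omega>] by blast
  define D where "D = \<bar>B\<bar> + 2"
  \<comment> \<open>Chosen so that (\<alpha> / 2) ln T \<le> \<delta> q is the same as D ln T \<le>
    \<kappa> q; the absolute value in \<open>D\<close> keeps the divisor positive.\<close>
  define \<delta> where "\<delta> = \<alpha> * \<kappa> / (2 * D)"
  have D: "D > 0" unfolding D_def by simp
  have \<delta>: "\<delta> > 0" unfolding \<delta>_def using \<alpha> \<kappa> D by simp
  have qk: "?q k \<ge> real k" "?q k \<ge> 1" for k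
    using convergent_denom_approx(1,2)[OF \<theta>, of k] by linarith+
  obtain k0 where k0: "\<And>k. k \<ge> k0 \<Longrightarrow> ln (?q (Suc k)) / ?q k < \<delta>"
    using order_tendstoD(2)[OF lim \<delta>] unfolding eventually_sequentially by blast
  \<comment> \<open>The k-th denominator is at least k, so indices from 200 on meet the size
    requirement.\<close>
  define k1 where "k1 = max k0 200"
  have "\<forall>\<^sub>F T in at_top. 2 * ?q k1 + 4 \<le> T powr \<alpha>" using \<alpha> by real_asymp
  \<comment> \<open>The first denominator that is too large exceeds (T^\<alpha> - 4) / 2; halving
    the exponent turns this into a clean power of T.\<close>
  moreover have "\<forall>\<^sub>F T in at_top. T powr (\<alpha> / 2) \<le> (T powr \<alpha> - 4) / 2" using \<alpha> by real_asymp
  ultimately show ?thesis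
    using eventually_ge_at_top[of 1] eventually_ge_at_top[of C]
  proof eventually_elim
    case (elim T)
    define K where "K = {k. 2 * ?q k + 4 \<le> T powr \<alpha>}"
    \<comment> \<open>The set is finite because the denominators grow at least linearly, so a
      largest admissible index exists.\<close>
    have "k \<le> nat \<lceil>T powr \<alpha>\<rceil>" if "k \<in> K" for k
      using that qk[of k] unfolding K_def by (simp add: le_nat_iff le_ceiling_iff)
    then have fin: "finite K" by (meson finite_nat_set_iff_bounded_le)
    have k1: "k1 \<in> K" using elim unfolding K_def by simp
    define k where "k = Max K"
    have kK: "k \<in> K" unfolding k_def using fin k1 by (intro Max_in) auto
    have kge: "k \<ge> k1" unfolding k_def using fin k1 by (rule Max_ge)
    have "Suc k \<notin> K" using Max_ge[OF fin, of "Suc k"] unfolding k_def by auto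
    then have "T powr (\<alpha> / 2) \<le> ?q (Suc k)" using elim unfolding K_def by simp
    then have "ln (T powr (\<alpha> / 2)) \<le> ln (?q (Suc k))" using elim by (intro ln_mono) auto
    then have "\<alpha> / 2 * ln T \<le> ln (?q (Suc k))" using elim by (simp add: ln_powr)
    also have "\<dots> \<le> \<delta> * ?q k"
      using k0[of k] kge qk(2)[of k] unfolding k1_def by (simp add: divide_less_eq)
    finally have "D * ln T \<le> \<kappa> * ?q k"
      unfolding \<delta>_def using \<alpha> D by (simp add: field_simps)
    moreover have "(B + 2) * ln T \<le> D * ln T" unfolding D_def using elim by (intro mult_right_mono) auto
    ultimately have "(B + 2) * ln T \<le> \<kappa> * ?q k" by linarith
    moreover have "convergent_denom \<theta> k \<ge> 200"
      using convergent_denom_approx(2)[OF \<theta>, of k] kge unfolding k1_def by linarith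
    ultimately show ?case
      using elim kK unfolding K_def by (intro conc[rule_format, OF _ good_denominator_convergent_denom[OF \<theta>, of k]]) auto
  qed
qed

theorem theorem4:
  fixes lam \<theta> :: real
  assumes "lam > 2" and "\<theta> \<notin> \<rat>"
  shows "(\<forall>\<omega>\<in>{0..<1}. alpha_u_minus (almost_mathieu lam \<theta> \<omega>) = 0 \<and>
            (\<forall>p>0. beta_minus (almost_mathieu lam \<theta> \<omega>) p = 0)) \<and>
         ((\<lambda>k. ln (real_of_int (convergent_denom \<theta> (Suc k))) / real_of_int (convergent_denom \<theta> k))
             \<longlonglongrightarrow> 0 \<longrightarrow>
          (\<forall>\<omega>\<in>{0..<1}. alpha_u_plus (almost_mathieu lam \<theta> \<omega>) = 0 \<and>
            (\<forall>p>0. beta_plus (almost_mathieu lam \<theta> \<omega>) p = 0)))"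
proof (intro conjI impI ballI allI)
  fix \<omega> p :: real
  obtain \<kappa> c where "spreading_bounds (almost_mathieu lam \<theta> \<omega>) \<kappa> c"
    using almost_mathieu_spreading_bounds[OF assms(1)] by blast
  then interpret spreading_bounds "almost_mathieu lam \<theta> \<omega>" \<kappa> c .
  show "alpha_u_minus (almost_mathieu lam \<theta> \<omega>) = 0"
    by (rule no_transport_minus(1)[OF frequently_concentrated[OF assms]])
  show "beta_minus (almost_mathieu lam \<theta> \<omega>) p = 0" if "p > 0"
    by (rule no_transport_minus(2)[OF frequently_concentrated[OF assms] that])
  assume lim: "(\<lambda>k. ln (real_of_int (convergent_denom \<theta> (Suc k))) / real_of_int (convergent_denom \<theta> k)) \<longlonglongrightarrow> 0"
  show "alpha_u_plus (almost_mathieu lam \<theta> \<omega>) = 0"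
    by (rule no_transport_plus(1)[OF eventually_concentrated[OF assms _ lim]])
  show "beta_plus (almost_mathieu lam \<theta> \<omega>) p = 0" if "p > 0"
    by (rule no_transport_plus(2)[OF eventually_concentrated[OF assms _ lim] that])
qed

end
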